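(* Assume the setting and hypotheses (A1)–(A3) described in the context, and assume that $\sup_{\omega\in\Omega_0}\|h\|_{{\rm C}^2_b(\mathbb{R}^n)}<\infty$. Let $\nu_0>0$ and, for $\nu\in(0,\nu_0]$, let $y_\nu$ be the $\mathcal{F}^B_t$-adapted ${\rm C}^{\frac{\beta}{2},2}_b$-solution of \[ y(t,x) = h(x) + \int_0^t \big[\nu \Delta y(s,x) - (y,\nabla)y(s,x) + f(s,x,y(s,x))\big]\,ds + \int_0^t g(s,x)\,dB_s . \] Then there exists a stopping time $S$, positive a.s., such that on $[0,S]$ there exists an $\mathcal{F}^B_t$-adapted ${\rm C}^{\frac{\beta}{2},1}_b$-solution $y_0(t,x)$ of the inviscid stochastic Burgers equation \[ y(t,x) = h(x) + \int_0^t \big[f(s,x,y(s,x)) - (y,\nabla)y(s,x)\big]\,ds + \int_0^t g(s,x)\,dB_s . \] Moreover, if $\tilde y_0$ is another solution of the inviscid equation on $[0,\tilde S]$ for a stopping time $\tilde S>0$, then a.s. $\tilde y_0=y_0$ on $[0,S\wedge\tilde S]$. Furthermore, there exists a version of the ${\rm C}_b([0,S]\times\mathbb{R}^n)$-valued process $[0,\nu_0]\times\Omega\ni(\nu,\omega)\mapsto y_\nu$ which is continuous in $\nu$; for this version, a.s., $\lim_{\nu\to0}y_\nu(t,x)=y_0(t,x)$ uniformly in $(t,x)\in[0,S]\times\mathbb{R}^n$.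
   Context: Fix $T>0$, integers $n,d\ge1$, $\beta\in(0,1)$. $(\Omega,\mathcal{F},\mathbb{P})$ carries a $d$-dimensional Brownian motion $B_t$; $\mathcal{F}_0$ is a $\sigma$-algebra independent of the natural filtration of $B$; $\mathcal{F}^B_t=\sigma\{B_s,s\le t\}\vee\mathcal{F}_0\vee\mathcal{N}$ ($\mathcal{N}$ = null sets). $(y,\nabla)y=\sum_jy_j\partial_{x_j}y$. ${\rm C}^{\frac{\beta}{2},l}_b([0,T]\times\mathbb{R}^m)$: functions bounded and continuous with their spatial derivatives up to order $l$, and $\frac\beta2$-Hölder in $t$ uniformly in the spatial variable. ${\rm C}^{2+\beta}_b(\mathbb{R}^n)$: ${\rm C}^2_b$ functions with $\beta$-Hölder (on scales $<1$) second derivatives. (A1) $f$ deterministic $\mathbb{R}^n$-valued, of class ${\rm C}^{\frac{\beta}{2},2}_b([0,T]\times\mathbb{R}^{2n})$; $|f(t,x,y)|\le L(1+|y|)$, $|f(t,x,y)-f(t,x,y')|\le L|y-y'|$; first and second derivatives in $x,y$ bounded on $[0,T]\times\mathbb{R}^n\times[-D,D]^n$ for each $D>0$; $f(0,\cdot,0)$ compactly supported. (A2) $g=(g_1,\dots,g_d)$ $\mathcal{F}^B_t$-adapted with values in $H^k(\mathbb{R}^{d\times n})$, $k=[\frac n2]+5$, $\mathbb{E}\int_0^T\|g(s,\cdot)\|^p_{H^k}ds<\infty$ for some $p>\frac{4}{1-\beta}$; pointwise values via $H^k\hookrightarrow{\rm C}^4_b$. (A3) each $h(x)$ is $\mathcal{F}_0$-measurable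 and $h(\cdot,\omega)\in{\rm C}^{2+\beta}_b(\mathbb{R}^n)$ for all $\omega$. $\Omega_0$ denotes a set of full $\mathbb{P}$-measure on which a version $\eta(t,x)$ of $\int_0^tg(s,x)dB_s$ belongs to ${\rm C}^{\frac\beta2,4}_b([0,T]\times\mathbb{R}^n)$. *)

theory Defs
  imports "HOL-Probability.Probability"
begin

definition pd :: "'x::euclidean_space \<Rightarrow> ('x \<Rightarrow> 'b::real_normed_vector) \<Rightarrow> 'x \<Rightarrow> 'b" where
  "pd i u x = vector_derivative (\<lambda>s. u (x + s *\<^sub>R i)) (at 0)"

fun pds :: "'x::euclidean_space list \<Rightarrow> ('x \<Rightarrow> 'b::real_normed_vector) \<Rightarrow> 'x \<Rightarrow> 'b" where
  "pds [] u = u"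
| "pds (i # is) u = pd i (pds is u)"

definition has_pds_upto :: "nat \<Rightarrow> ('x::euclidean_space \<Rightarrow> 'b::real_normed_vector) \<Rightarrow> bool" where
  "has_pds_upto l u \<longleftrightarrow>
     (\<forall>\<alpha> i x. set \<alpha> \<subseteq> Basis \<and> i \<in> Basis \<and> length \<alpha> < l \<longrightarrow>
        ((\<lambda>s. pds \<alpha> u (x + s *\<^sub>R i)) has_vector_derivative pds (i # \<alpha>) u x) (at 0))"

definition Cb_hoelder :: "real \<Rightarrow> nat \<Rightarrow> real \<Rightarrow> real \<Rightarrow>
    (real \<Rightarrow> 'x::euclidean_space \<Rightarrow> 'b::real_normed_vector) \<Rightarrow> bool" where
  "Cb_hoelder \<beta> l a b u \<longleftrightarrow>
     (\<forall>t\<in>{a..b}. has_pds_upto l (u t)) \<and>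
     (\<forall>\<alpha>. set \<alpha> \<subseteq> Basis \<and> length \<alpha> \<le> l \<longrightarrow>
        continuous_on ({a..b} \<times> UNIV) (\<lambda>(t,x). pds \<alpha> (u t) x) \<and>
        bounded ((\<lambda>(t,x). pds \<alpha> (u t) x) ` ({a..b} \<times> UNIV))) \<and>
     (\<exists>C. \<forall>t\<in>{a..b}. \<forall>s\<in>{a..b}. \<forall>x. norm (u t x - u s x) \<le> C * \<bar>t - s\<bar> powr (\<beta> / 2))"

definition C2beta_b :: "real \<Rightarrow> ('x::euclidean_space \<Rightarrow> 'b::real_normed_vector) \<Rightarrow> bool" where
  "C2beta_b \<beta> u \<longleftrightarrow>
     has_pds_upto 2 u \<and>
     (\<forall>\<alpha>. set \<alpha> \<subseteq> Basis \<and> length \<alpha> \<le> 2 \<longrightarrow> continuous_on UNIV (pds \<alpha> u) \<and> bounded (range (pds \<alpha> u))) \<and>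
     (\<exists>C. \<forall>\<alpha>. set \<alpha> \<subseteq> Basis \<and> length \<alpha> = 2 \<longrightarrow>
        (\<forall>x y. dist x y < 1 \<longrightarrow> norm (pds \<alpha> u x - pds \<alpha> u y) \<le> C * dist x y powr \<beta>))"

definition test_fun :: "('x::euclidean_space \<Rightarrow> real) \<Rightarrow> bool" where
  "test_fun \<phi> \<longleftrightarrow> (\<forall>l. has_pds_upto l \<phi>) \<and>
     (\<forall>\<alpha>. set \<alpha> \<subseteq> Basis \<longrightarrow> continuous_on UNIV (pds \<alpha> \<phi>)) \<and>
     compact (closure {x. \<phi> x \<noteq> 0})"

definition weak_deriv :: "'x::euclidean_space list \<Rightarrow> ('x \<Rightarrow> 'b::euclidean_space) \<Rightarrow> ('x \<Rightarrow> 'b) \<Rightarrow> bool" where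
  "weak_deriv \<alpha> u v \<longleftrightarrow> v \<in> borel_measurable lborel \<and>
     (\<forall>\<phi>. test_fun \<phi> \<longrightarrow>
        integrable lborel (\<lambda>x. pds \<alpha> \<phi> x *\<^sub>R u x) \<and> integrable lborel (\<lambda>x. \<phi> x *\<^sub>R v x) \<and>
        (\<integral>x. pds \<alpha> \<phi> x *\<^sub>R u x \<partial>lborel) = (-1) ^ length \<alpha> *\<^sub>R (\<integral>x. \<phi> x *\<^sub>R v x \<partial>lborel))"

definition multi_indices :: "nat \<Rightarrow> 'x::euclidean_space list set" where
  "multi_indices k = {\<alpha>. set \<alpha> \<subseteq> Basis \<and> length \<alpha> \<le> k}"

definition in_Hk :: "nat \<Rightarrow> ('x::euclidean_space \<Rightarrow> 'b::euclidean_space) \<Rightarrow> bool" where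
  "in_Hk k u \<longleftrightarrow> (\<forall>\<alpha>\<in>multi_indices k. \<exists>v. weak_deriv \<alpha> u v \<and>
        integrable lborel (\<lambda>x. (norm (v x))\<^sup>2))"

text \<open>(An equivalent version of) the \<open>H^k\<close> norm.\<close>
definition Hk_norm :: "nat \<Rightarrow> ('x::euclidean_space \<Rightarrow> 'b::euclidean_space) \<Rightarrow> real" where
  "Hk_norm k u = sqrt (\<Sum>\<alpha>\<in>multi_indices k.
      (\<integral>x. (norm ((SOME v. weak_deriv \<alpha> u v) x))\<^sup>2 \<partial>lborel))"

definition std_BM_1d :: "'w measure \<Rightarrow> (real \<Rightarrow> 'w \<Rightarrow> real) \<Rightarrow> bool" where
  "std_BM_1d M W \<longleftrightarrow>
     (\<forall>t. W t \<in> borel_measurable M) \<and>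
     (\<forall>\<omega>\<in>space M. W 0 \<omega> = 0 \<and> continuous_on {0..} (\<lambda>t. W t \<omega>)) \<and>
     (\<forall>s t. 0 \<le> s \<and> s < t \<longrightarrow>
        distributed M lborel (\<lambda>\<omega>. W t \<omega> - W s \<omega>) (normal_density 0 (sqrt (t - s))) \<and>
        prob_space.indep_set M
          (sigma_sets (space M) {(\<lambda>\<omega>. W t \<omega> - W s \<omega>) -` A \<inter> space M | A. A \<in> sets borel})
          (sigma_sets (space M) {W r -` A \<inter> space M | r A. 0 \<le> r \<and> r \<le> s \<and> A \<in> sets borel}))"

definition std_BM :: "'w measure \<Rightarrow> (real \<Rightarrow> 'w \<Rightarrow> real^'d) \<Rightarrow> bool" where
  "std_BM M B \<longleftrightarrow> prob_space M \<and>
     (\<forall>j. std_BM_1d M (\<lambda>t \<omega>. B t \<omega> $ j)) \<and>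
     prob_space.indep_sets M
       (\<lambda>j. sigma_sets (space M) {(\<lambda>\<omega>. B t \<omega> $ j) -` A \<inter> space M | t A. 0 \<le> t \<and> A \<in> sets borel}) UNIV"

definition nat_sets :: "'w measure \<Rightarrow> (real \<Rightarrow> 'w \<Rightarrow> real^'d) \<Rightarrow> real \<Rightarrow> 'w set set" where
  "nat_sets M B t = {B s -` A \<inter> space M | s A. 0 \<le> s \<and> s \<le> t \<and> A \<in> sets borel}"

definition FB :: "'w measure \<Rightarrow> (real \<Rightarrow> 'w \<Rightarrow> real^'d) \<Rightarrow> 'w set set \<Rightarrow> real \<Rightarrow> 'w measure" where
  "FB M B F0 t = sigma (space M) (nat_sets M B t \<union> F0 \<union> null_sets M)"

definition simple_adm :: "(real \<Rightarrow> 'w measure) \<Rightarrow> real \<Rightarrow> real list \<Rightarrow> (nat \<Rightarrow> 'w \<Rightarrow> real) \<Rightarrow> bool" where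
  "simple_adm F T ts \<xi> \<longleftrightarrow> sorted_wrt (<) ts \<and> set ts \<subseteq> {0..T} \<and>
     (\<forall>i < length ts. \<xi> i \<in> borel_measurable (F (ts ! i)) \<and> (\<exists>C. \<forall>\<omega>. \<bar>\<xi> i \<omega>\<bar> \<le> C))"

definition simple_val :: "real list \<Rightarrow> (nat \<Rightarrow> 'w \<Rightarrow> real) \<Rightarrow> real \<Rightarrow> 'w \<Rightarrow> real" where
  "simple_val ts \<xi> s \<omega> = (\<Sum>i < length ts - 1. if ts ! i < s \<and> s \<le> ts ! (i+1) then \<xi> i \<omega> else 0)"

definition simple_int :: "(real \<Rightarrow> 'w \<Rightarrow> real) \<Rightarrow> real list \<Rightarrow> (nat \<Rightarrow> 'w \<Rightarrow> real) \<Rightarrow> real \<Rightarrow> 'w \<Rightarrow> real" where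
  "simple_int W ts \<xi> t \<omega> = (\<Sum>i < length ts - 1.
       \<xi> i \<omega> * (W (min t (ts ! (i+1))) \<omega> - W (min t (ts ! i)) \<omega>))"

definition is_ito_integral :: "'w measure \<Rightarrow> (real \<Rightarrow> 'w measure) \<Rightarrow> (real \<Rightarrow> 'w \<Rightarrow> real) \<Rightarrow> real \<Rightarrow>
    (real \<Rightarrow> 'w \<Rightarrow> real) \<Rightarrow> (real \<Rightarrow> 'w \<Rightarrow> real) \<Rightarrow> bool" where
  "is_ito_integral M F W T H I \<longleftrightarrow>
     (\<forall>t\<in>{0..T}. I t \<in> borel_measurable M) \<and>
     (\<exists>ts \<xi>. (\<forall>k. simple_adm F T (ts k) (\<xi> k)) \<and>
        ((\<lambda>k. \<integral>\<^sup>+\<omega>. (\<integral>\<^sup>+s\<in>{0..T}. ennreal ((H s \<omega> - simple_val (ts k) (\<xi> k) s \<omega>)\<^sup>2) \<partial>lborel) \<partial>M)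
           \<longlonglongrightarrow> 0) \<and>
        (\<forall>t\<in>{0..T}. (\<lambda>k. \<integral>\<^sup>+\<omega>. ennreal ((I t \<omega> - simple_int W (ts k) (\<xi> k) t \<omega>)\<^sup>2) \<partial>M) \<longlonglongrightarrow> 0))"

definition is_stoch_int_version :: "'w measure \<Rightarrow> (real \<Rightarrow> 'w measure) \<Rightarrow> (real \<Rightarrow> 'w \<Rightarrow> real^'d) \<Rightarrow> real \<Rightarrow>
    ('w \<Rightarrow> real \<Rightarrow> real^'n \<Rightarrow> real^'n^'d) \<Rightarrow> ('w \<Rightarrow> real \<Rightarrow> real^'n \<Rightarrow> real^'n) \<Rightarrow> bool" where
  "is_stoch_int_version M F B T g \<eta> \<longleftrightarrow>
     (\<forall>x i. \<exists>I. (\<forall>j. is_ito_integral M F (\<lambda>t \<omega>. B t \<omega> $ j) T (\<lambda>s \<omega>. g \<omega> s x $ j $ i) (I j)) \<and>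
        (\<forall>t\<in>{0..T}. AE \<omega> in M. \<eta> \<omega> t x $ i = (\<Sum>j\<in>UNIV. I j t \<omega>)))"

definition lap :: "(real^'n \<Rightarrow> real^'n) \<Rightarrow> real^'n \<Rightarrow> real^'n" where
  "lap u x = (\<Sum>i\<in>Basis. pd i (pd i u) x)"

definition adv :: "(real^'n \<Rightarrow> real^'n) \<Rightarrow> real^'n \<Rightarrow> real^'n" where
  "adv u x = (\<Sum>i\<in>Basis. (u x \<bullet> i) *\<^sub>R pd i u x)"

text \<open>y is an \<open>\<F>^B_t\<close>-adapted \<open>C_b^{\<beta>/2,l}\<close>-solution on the random interval [0,S] of
  \<open>y(t,x) = h(x) + \<integral>_0^t [\<nu>\<Delta>y - (y,\<nabla>)y + f(s,x,y)] ds + \<integral>_0^t g dB\<close>, where the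
  stochastic integral is represented by its regular version \<eta>.\<close>
definition burgers_sol :: "'w measure \<Rightarrow> (real \<Rightarrow> 'w measure) \<Rightarrow> real \<Rightarrow> real \<Rightarrow> nat \<Rightarrow> real \<Rightarrow>
    (real \<Rightarrow> real^'n \<Rightarrow> real^'n \<Rightarrow> real^'n) \<Rightarrow> ('w \<Rightarrow> real^'n \<Rightarrow> real^'n) \<Rightarrow>
    ('w \<Rightarrow> real \<Rightarrow> real^'n \<Rightarrow> real^'n) \<Rightarrow> ('w \<Rightarrow> real) \<Rightarrow> ('w \<Rightarrow> real \<Rightarrow> real^'n \<Rightarrow> real^'n) \<Rightarrow> bool" where
  "burgers_sol M F T \<beta> l \<nu> f h \<eta> S y \<longleftrightarrow>
     (\<forall>t\<in>{0..T}. \<forall>x. (\<lambda>\<omega>. if t \<le> S \<omega> then y \<omega> t x else 0) \<in> borel_measurable (F t)) \<and>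
     (AE \<omega> in M. Cb_hoelder \<beta> l 0 (S \<omega>) (y \<omega>) \<and>
        (\<forall>t\<in>{0..S \<omega>}. \<forall>x. y \<omega> t x = h \<omega> x
            + integral {0..t} (\<lambda>s. \<nu> *\<^sub>R lap (y \<omega> s) x - adv (y \<omega> s) x + f s x (y \<omega> s x))
            + \<eta> \<omega> t x))"

end

theory Submission
  imports Defs
begin

text \<open>
  The argument is pathwise. For \<open>u = y - \<eta>\<close> the equation is a parabolic system without noise, and
  any bounded \<open>w\<close> with \<open>|w\<^sub>t - \<nu> \<Delta>w + (b, \<nabla>)w| \<le> A\<close> satisfies \<open>|w(t)| \<le> sup |w(0)| + A t\<close> whatever
  \<open>\<nu> \<ge> 0\<close> and the bounded drift \<open>b\<close> are. Since solutions have only two spatial derivatives, the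
  principle is applied to first and second differences of \<open>u\<close> instead of derivatives. This bounds
  \<open>\<nabla>y\<^sub>\<nu>\<close> and \<open>\<nabla>\<^sup>2y\<^sub>\<nu>\<close> uniformly in \<open>\<nu>\<close> up to the first time \<open>S\<close> at which \<open>100 t R(t)\<^sup>3 = 1\<close>, where \<open>R(t)\<close>
  is a constant plus the size on \<open>[0,t]\<close> of the derivatives of \<open>\<eta>\<close> of order at most 3.
  Applied to a difference of two solutions the principle gives \<open>|y\<^sub>\<nu> - y\<^sub>\<mu>| \<le> C |\<nu> - \<mu>|\<close> on \<open>[0,S]\<close>,
  also for \<open>\<nu> = 0\<close>: hence uniqueness, and uniform convergence as \<open>\<mu> \<rightarrow> 0\<close>. By Landau's
  inequality the gradients converge too, so the limit solves the inviscid equation.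
\<close>

section \<open>Differences and directional derivatives\<close>

definition fdiff :: "'x::plus \<Rightarrow> ('x \<Rightarrow> 'b::minus) \<Rightarrow> 'x \<Rightarrow> 'b" where
  "fdiff a u x = u (x + a) - u x"

definition has_dir_deriv :: "('x::real_vector \<Rightarrow> 'b::real_normed_vector) \<Rightarrow> 'x \<Rightarrow> ('x \<Rightarrow> 'b) \<Rightarrow> bool"
  where
  "has_dir_deriv u i u' \<longleftrightarrow> (\<forall>x. ((\<lambda>s. u (x + s *\<^sub>R i)) has_vector_derivative u' x) (at 0))"

lemma has_dir_derivD:
  "has_dir_deriv u i u' \<Longrightarrow> ((\<lambda>s. u (x + s *\<^sub>R i)) has_vector_derivative u' x) (at 0)"
  by (simp add: has_dir_deriv_def)

lemma fdiff_commute: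
  fixes u :: "'x::ab_semigroup_add \<Rightarrow> 'b::ab_group_add"
  shows "fdiff a (fdiff c u) = fdiff c (fdiff a u)"
  by (rule ext) (simp add: fdiff_def algebra_simps)

lemma has_dir_deriv_diff:
  "has_dir_deriv u i u' \<Longrightarrow> has_dir_deriv v i v' \<Longrightarrow> has_dir_deriv (\<lambda>x. u x - v x) i (\<lambda>x. u' x - v' x)"
  by (auto simp: has_dir_deriv_def intro: has_vector_derivative_diff)

lemma has_dir_deriv_shift:
  assumes "has_dir_deriv u i u'"
  shows "has_dir_deriv (\<lambda>x. u (x + a)) i (\<lambda>x. u' (x + a))"
  unfolding has_dir_deriv_def
proof
  fix x
  show "((\<lambda>s. u (x + s *\<^sub>R i + a)) has_vector_derivative u' (x + a)) (at 0)"
    using has_dir_derivD[OF assms, of "x + a"] by (simp add: add_ac)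
qed

lemma has_dir_deriv_fdiff:
  assumes "has_dir_deriv u i u'"
  shows "has_dir_deriv (fdiff a u) i (fdiff a u')"
  using has_dir_deriv_diff[OF has_dir_deriv_shift[OF assms] assms] by (simp add: fdiff_def[abs_def])

lemma has_dir_deriv_bounded_linear:
  assumes "bounded_linear L" "has_dir_deriv u i u'"
  shows "has_dir_deriv (\<lambda>x. L (u x)) i (\<lambda>x. L (u' x))"
  using bounded_linear.has_vector_derivative[OF assms(1)] assms(2) by (auto simp: has_dir_deriv_def)

lemma has_dir_deriv_along_line:
  assumes "has_dir_deriv u i u'"
  shows "((\<lambda>s. u (x + s *\<^sub>R i)) has_vector_derivative u' (x + r *\<^sub>R i)) (at r)"
proof -
  have "((\<lambda>s::real. s - r) has_vector_derivative 1) (at r)"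
    by (auto intro!: derivative_eq_intros
      simp: has_real_derivative_iff_has_vector_derivative[symmetric])
  from vector_diff_chain_at[OF this, of "\<lambda>s. u (x + r *\<^sub>R i + s *\<^sub>R i)"] has_dir_derivD[OF assms]
  have "((\<lambda>s. u (x + r *\<^sub>R i + (s - r) *\<^sub>R i)) has_vector_derivative u' (x + r *\<^sub>R i)) (at r)"
    by (simp add: o_def)
  then show ?thesis by (simp add: algebra_simps)
qed

lemma norm_fdiff_le:
  assumes deriv: "has_dir_deriv u i u'" and bound: "\<And>x. norm (u' x) \<le> C"
  shows "norm (fdiff (s *\<^sub>R i) u x) \<le> C * \<bar>s\<bar>"
proof -
  have "norm (u (x + s *\<^sub>R i) - u (x + 0 *\<^sub>R i)) \<le> C * norm (s - 0)"
  proof (rule differentiable_bound[of UNIV _ "\<lambda>r h. h *\<^sub>R u' (x + r *\<^sub>R i)"])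
    show "((\<lambda>r. u (x + r *\<^sub>R i)) has_derivative (\<lambda>h. h *\<^sub>R u' (x + r *\<^sub>R i)))
        (at r within UNIV)" for r
      using has_dir_deriv_along_line[OF deriv] by (simp add: has_vector_derivative_def)
    show "onorm (\<lambda>h. h *\<^sub>R u' (x + r *\<^sub>R i)) \<le> C" for r
      using mult_left_mono[OF bound[of "x + r *\<^sub>R i"] abs_ge_zero]
      by (intro onorm_le) (simp add: mult.commute)
  qed auto
  then show ?thesis by (simp add: fdiff_def)
qed

lemma norm_fdiff_fdiff_le:
  assumes "has_dir_deriv u i u'" "has_dir_deriv u' j u''" "\<And>x. norm (u'' x) \<le> C"
  shows "norm (fdiff (r *\<^sub>R j) (fdiff (s *\<^sub>R i) u) x) \<le> C * \<bar>r\<bar> * \<bar>s\<bar>"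
  unfolding fdiff_commute[of "r *\<^sub>R j"]
  by (rule norm_fdiff_le[OF has_dir_deriv_fdiff[OF assms(1)] norm_fdiff_le[OF assms(2,3)]])

lemma has_dir_deriv_LIMSEQ:
  assumes "has_dir_deriv u i u'"
  shows "(\<lambda>k. real (Suc k) *\<^sub>R fdiff ((1 / real (Suc k)) *\<^sub>R i) u x) \<longlonglongrightarrow> u' x"
proof -
  have quotient: "norm (u (x + s *\<^sub>R i) - u x - s *\<^sub>R u' x) / norm s
      = norm ((1 / s) *\<^sub>R fdiff (s *\<^sub>R i) u x - u' x)"
    if "s \<noteq> 0" for s
  proof -
    have "u (x + s *\<^sub>R i) - u x - s *\<^sub>R u' x = s *\<^sub>R ((1 / s) *\<^sub>R fdiff (s *\<^sub>R i) u x - u' x)"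
      using that by (simp add: fdiff_def scaleR_diff_right)
    then show ?thesis using that by simp
  qed
  have "((\<lambda>s. norm (u (x + s *\<^sub>R i) - u x - s *\<^sub>R u' x) / norm s) \<longlongrightarrow> 0) (at 0)"
    using has_dir_derivD[OF assms, of x] by (simp add: has_vector_derivative_def has_derivative_at)
  then have "((\<lambda>s. norm ((1 / s) *\<^sub>R fdiff (s *\<^sub>R i) u x - u' x)) \<longlongrightarrow> 0) (at 0)"
    by (rule Lim_transform_eventually)
      (unfold eventually_at_filter, intro always_eventually allI impI quotient)
  then have "((\<lambda>s. (1 / s) *\<^sub>R fdiff (s *\<^sub>R i) u x) \<longlongrightarrow> u' x) (at 0)"
    by (rule LIM_zero_cancel[OF tendsto_norm_zero_cancel])
  moreover have "filterlim (\<lambda>k. 1 / real (Suc k)) (at 0) sequentially"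
    using LIMSEQ_Suc[OF lim_1_over_n] by (simp add: filterlim_at)
  ultimately show ?thesis using filterlim_compose by fastforce
qed

lemma norm_dir_deriv_le:
  assumes deriv: "has_dir_deriv u i u'" and bound: "\<And>s. 0 < s \<Longrightarrow> norm (fdiff (s *\<^sub>R i) u x) \<le> C * s"
  shows "norm (u' x) \<le> C"
proof (rule tendsto_upperbound[OF tendsto_norm[OF has_dir_deriv_LIMSEQ[OF deriv]]])
  show "\<forall>\<^sub>F k in sequentially. norm (real (Suc k) *\<^sub>R fdiff ((1 / real (Suc k)) *\<^sub>R i) u x) \<le> C"
  proof (intro always_eventually allI)
    fix k
    define c where "c = real (Suc k)"
    have "0 < c" by (simp add: c_def)
    then have "c * norm (fdiff ((1 / c) *\<^sub>R i) u x) \<le> c * (C * (1 / c))"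
      by (intro mult_left_mono bound) auto
    then show "norm (real (Suc k) *\<^sub>R fdiff ((1 / real (Suc k)) *\<^sub>R i) u x) \<le> C"
      using \<open>0 < c\<close> unfolding c_def[symmetric] by simp
  qed
qed simp

lemma norm_second_dir_deriv_le:
  assumes deriv: "has_dir_deriv u i u'" and deriv2: "has_dir_deriv u' j u''"
    and bound: "\<And>r s. 0 < r \<Longrightarrow> 0 < s \<Longrightarrow> norm (fdiff (r *\<^sub>R j) (fdiff (s *\<^sub>R i) u) x) \<le> C * r * s"
  shows "norm (u'' x) \<le> C"
  using bound unfolding fdiff_commute[of "_ *\<^sub>R j"]
  by (intro norm_dir_deriv_le[OF deriv2] norm_dir_deriv_le[OF has_dir_deriv_fdiff[OF deriv]])

lemma norm_taylor_remainder_le: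
  assumes deriv: "has_dir_deriv u i u'" and deriv2: "has_dir_deriv u' i u''"
    and bound: "\<And>x. norm (u'' x) \<le> C"
  shows "norm (fdiff (s *\<^sub>R i) u x - s *\<^sub>R u' x) \<le> C * s\<^sup>2"
proof -
  have "0 \<le> C" using bound norm_ge_zero order_trans by blast
  have "norm (u (x + s *\<^sub>R i) - u (x + 0 *\<^sub>R i) - (s - 0) *\<^sub>R u' (x + 0 *\<^sub>R i))
      \<le> norm (s - 0) * (C * \<bar>s\<bar>)"
  proof (rule vector_differentiable_bound_linearization[where S="closed_segment 0 s"])
    show "((\<lambda>r. u (x + r *\<^sub>R i)) has_vector_derivative u' (x + r *\<^sub>R i))
        (at r within closed_segment 0 s)" for r
      using has_dir_deriv_along_line[OF deriv] by (rule has_vector_derivative_at_within)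
    show "norm (u' (x + r *\<^sub>R i) - u' (x + 0 *\<^sub>R i)) \<le> C * \<bar>s\<bar>" if "r \<in> closed_segment 0 s" for r
    proof -
      have "C * \<bar>r\<bar> \<le> C * \<bar>s\<bar>"
        using that \<open>0 \<le> C\<close> by (intro mult_left_mono)
          (auto simp: closed_segment_eq_real_ivl split: if_splits)
      then show ?thesis using norm_fdiff_le[OF deriv2 bound, of r x] by (simp add: fdiff_def)
    qed
  qed auto
  then show ?thesis by (simp add: fdiff_def power2_eq_square mult.left_commute)
qed

lemma landau_inequality:
  assumes deriv: "has_dir_deriv u i u'" and deriv2: "has_dir_deriv u' i u''"
    and bound: "\<And>x. norm (u x) \<le> a" and bound2: "\<And>x. norm (u'' x) \<le> C"
  shows "(norm (u' x))\<^sup>2 \<le> 8 * a * C"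
proof -
  have interpolation: "s * norm (u' x) \<le> 2 * a + C * s\<^sup>2" if "0 < s" for s
  proof -
    have "norm v \<le> norm y + norm z + norm (y - z - v)" for v y z :: 'b by norm
    then have "norm (s *\<^sub>R u' x)
        \<le> norm (u (x + s *\<^sub>R i)) + norm (u x) + norm (fdiff (s *\<^sub>R i) u x - s *\<^sub>R u' x)"
      unfolding fdiff_def by blast
    also have "\<dots> \<le> a + a + C * s\<^sup>2"
      by (intro add_mono bound norm_taylor_remainder_le[OF deriv deriv2 bound2])
    finally show ?thesis using that by simp
  qed
  have "0 \<le> C" using bound2 norm_ge_zero order_trans by blast
  then consider "norm (u' x) = 0" | "C = 0" "0 < norm (u' x)" | "0 < C" "0 < norm (u' x)"
    by fastforce
  then show ?thesis
  proof cases
    case 1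
    moreover have "0 \<le> a" using bound norm_ge_zero order_trans by blast
    ultimately show ?thesis using \<open>0 \<le> C\<close> by simp
  next
    case 2
    define s where "s = (2 * a + 1) / norm (u' x)"
    have "0 \<le> a" using bound norm_ge_zero order_trans by blast
    then show ?thesis using interpolation[of s] 2 by (simp add: s_def)
  next
    case 3
    then have "norm (u' x) / (2 * C) * norm (u' x) \<le> 2 * a + C * (norm (u' x) / (2 * C))\<^sup>2"
      by (intro interpolation) simp
    then show ?thesis using \<open>0 < C\<close> by (simp add: field_simps power2_eq_square)
  qed
qed

lemma norm_dir_deriv_diff_le:
  assumes u: "has_dir_deriv u i u'" "has_dir_deriv u' i u''" "\<And>x. norm (u'' x) \<le> C"
    and v: "has_dir_deriv v i v'" "has_dir_deriv v' i v''" "\<And>x. norm (v'' x) \<le> C"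
    and close: "\<And>x. norm (u x - v x) \<le> e\<^sup>2 / (16 * (C + 1))" and "0 \<le> e"
  shows "norm (u' x - v' x) \<le> e"
proof -
  have "0 \<le> C" using u(3) norm_ge_zero order_trans by blast
  have "norm (u'' x - v'' x) \<le> 2 * C" for x
    using norm_triangle_ineq4[of "u'' x" "v'' x"] u(3)[of x] v(3)[of x] by simp
  then have "(norm (u' x - v' x))\<^sup>2 \<le> 8 * (e\<^sup>2 / (16 * (C + 1))) * (2 * C)"
    by (rule landau_inequality[OF has_dir_deriv_diff[OF u(1) v(1)]
      has_dir_deriv_diff[OF u(2) v(2)] close])
  also have "\<dots> \<le> e\<^sup>2"
    using \<open>0 \<le> C\<close> by (simp add: field_simps)
  finally show ?thesis using \<open>0 \<le> e\<close> by (rule power2_le_imp_le)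
qed

lemma norm_fdiff_le_of_bounded_partials:
  fixes u :: "'x::euclidean_space \<Rightarrow> 'b::real_normed_vector"
  assumes deriv: "\<And>i. i \<in> Basis \<Longrightarrow> has_dir_deriv u i (u' i)"
    and bound: "\<And>i x. i \<in> Basis \<Longrightarrow> norm (u' i x) \<le> C"
  shows "norm (fdiff a u x) \<le> real DIM('x) * C * norm a"
proof -
  have "0 \<le> C" using bound[OF SOME_Basis] norm_ge_zero order_trans by blast
  have "norm (fdiff (\<Sum>i\<in>B. (a \<bullet> i) *\<^sub>R i) u x) \<le> (\<Sum>i\<in>B. C * \<bar>a \<bullet> i\<bar>)" if "B \<subseteq> Basis" for B
    using finite_subset[OF that finite_Basis] that
  proof (induction B rule: finite_induct)
    case (insert j B)
    let ?b = "\<Sum>i\<in>B. (a \<bullet> i) *\<^sub>R i"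
    have "fdiff (\<Sum>i\<in>insert j B. (a \<bullet> i) *\<^sub>R i) u x
        = fdiff ((a \<bullet> j) *\<^sub>R j) u (x + ?b) + fdiff ?b u x"
      using insert.hyps by (simp add: fdiff_def add_ac)
    moreover have "norm (fdiff ((a \<bullet> j) *\<^sub>R j) u (x + ?b)) \<le> C * \<bar>a \<bullet> j\<bar>"
      using insert.prems by (intro norm_fdiff_le[OF deriv] bound) auto
    ultimately show ?case
      using insert norm_triangle_ineq[of "fdiff ((a \<bullet> j) *\<^sub>R j) u (x + ?b)" "fdiff ?b u x"] by simp
  qed (simp add: fdiff_def)
  from this[of Basis] have "norm (fdiff a u x) \<le> (\<Sum>i\<in>Basis. C * \<bar>a \<bullet> i\<bar>)"
    by (simp add: euclidean_representation)
  also have "\<dots> \<le> (\<Sum>i\<in>(Basis::'x set). C * norm a)"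
    using \<open>0 \<le> C\<close> by (intro sum_mono mult_left_mono) (auto simp: Basis_le_norm)
  finally show ?thesis by (simp add: mult.assoc)
qed

lemma norm_fdiff_fdiff_le_of_bounded_partials:
  fixes u :: "'x::euclidean_space \<Rightarrow> 'b::real_normed_vector"
  assumes deriv: "\<And>i. i \<in> Basis \<Longrightarrow> has_dir_deriv u i (u' i)"
    and deriv2: "\<And>i j. i \<in> Basis \<Longrightarrow> j \<in> Basis \<Longrightarrow> has_dir_deriv (u' i) j (u'' j i)"
    and bound: "\<And>i j x. i \<in> Basis \<Longrightarrow> j \<in> Basis \<Longrightarrow> norm (u'' j i x) \<le> C"
  shows "norm (fdiff c (fdiff a u) x) \<le> (real DIM('x))\<^sup>2 * C * norm a * norm c"
proof -
  have "norm (fdiff c (fdiff a u) x) \<le> real DIM('x) * (real DIM('x) * C * norm a) * norm c"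
  proof (rule norm_fdiff_le_of_bounded_partials)
    fix i x :: 'x assume i: "i \<in> Basis"
    show "has_dir_deriv (fdiff a u) i (fdiff a (u' i))"
      by (rule has_dir_deriv_fdiff[OF deriv[OF i]])
    show "norm (fdiff a (u' i) x) \<le> real DIM('x) * C * norm a"
      by (rule norm_fdiff_le_of_bounded_partials[OF deriv2[OF i] bound[OF i]])
  qed
  then show ?thesis by (simp add: power2_eq_square mult_ac)
qed

lemma norm_fdiff_fdiff_compose_le:
  fixes F :: "'p::real_normed_vector \<Rightarrow> 'b::real_normed_vector" and \<Phi> :: "'x::ab_semigroup_add \<Rightarrow> 'p"
  assumes lip: "\<And>a p. norm (fdiff a F p) \<le> L * norm a"
    and lip2: "\<And>a c p. norm (fdiff c (fdiff a F) p) \<le> L * norm a * norm c"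
    and \<Phi>: "norm (fdiff a \<Phi> x) \<le> A" "norm (fdiff c \<Phi> x) \<le> C" "norm (fdiff c (fdiff a \<Phi>) x) \<le> D"
    and "0 \<le> L"
  shows "norm (fdiff c (fdiff a (\<lambda>x. F (\<Phi> x))) x) \<le> L * (A * C + D)"
proof -
  have "fdiff c (fdiff a (\<lambda>x. F (\<Phi> x))) x
      = fdiff (fdiff c \<Phi> x) (fdiff (fdiff a \<Phi> x) F) (\<Phi> x)
        + fdiff (fdiff c (fdiff a \<Phi>) x) F (\<Phi> (x + c) + fdiff a \<Phi> x)"
    by (simp add: fdiff_def algebra_simps)
  also have "norm \<dots> \<le> L * norm (fdiff a \<Phi> x) * norm (fdiff c \<Phi> x)
      + L * norm (fdiff c (fdiff a \<Phi>) x)"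
    by (intro norm_triangle_le add_mono lip lip2)
  also have "\<dots> = L * (norm (fdiff a \<Phi> x) * norm (fdiff c \<Phi> x) + norm (fdiff c (fdiff a \<Phi>) x))"
    by (simp add: algebra_simps)
  also have "\<dots> \<le> L * (A * C + D)"
    using \<Phi> \<open>0 \<le> L\<close> order_trans[OF norm_ge_zero \<Phi>(1)]
    by (intro mult_left_mono add_mono mult_mono) auto
  finally show ?thesis .
qed

section \<open>Uniform limits and equicontinuity of derivatives\<close>

lemma uniformly_convergent_dir_deriv:
  fixes u :: "nat \<Rightarrow> 'p \<Rightarrow> 'x::real_vector \<Rightarrow> 'b::banach"
  assumes deriv: "\<And>k p. p \<in> P \<Longrightarrow> has_dir_deriv (u k p) i (u' k p)"
    and deriv2: "\<And>k p. p \<in> P \<Longrightarrow> has_dir_deriv (u' k p) i (u'' k p)"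
    and bound: "\<And>k p x. p \<in> P \<Longrightarrow> norm (u'' k p x) \<le> C"
    and conv: "uniformly_convergent_on (P \<times> UNIV) (\<lambda>k (p, x). u k p x)"
  shows "uniformly_convergent_on (P \<times> UNIV) (\<lambda>k (p, x). u' k p x)"
proof (cases "P = {}")
  case False
  then have "0 \<le> C" using bound norm_ge_zero order_trans by blast
  show ?thesis unfolding uniformly_convergent_eq_Cauchy
  proof (rule uniformly_Cauchy_onI)
    fix e :: real assume "0 < e"
    then have "0 < (e / 2)\<^sup>2 / (16 * (C + 1))" using \<open>0 \<le> C\<close> by simp
    with conv obtain N where cauchy: "\<And>m n p x. N \<le> m \<Longrightarrow> N \<le> n \<Longrightarrow> p \<in> P \<Longrightarrow>
        norm (u m p x - u n p x) < (e / 2)\<^sup>2 / (16 * (C + 1))"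
      unfolding uniformly_convergent_eq_Cauchy uniformly_Cauchy_on_def
      by (force simp: dist_norm)
    have "norm (u' m p x - u' n p x) \<le> e / 2" if "N \<le> m" "N \<le> n" "p \<in> P" for m n p x
      using that \<open>0 < e\<close> cauchy[OF that]
      by (intro norm_dir_deriv_diff_le[OF deriv deriv2 bound deriv deriv2 bound])
        (auto intro: less_imp_le)
    then have "dist (u' m p x) (u' n p x) < e" if "N \<le> m" "N \<le> n" "p \<in> P" for m n p x
      using that \<open>0 < e\<close> by (smt (verit) dist_norm field_sum_of_halves)
    then show "\<exists>M. \<forall>z\<in>P \<times> UNIV. \<forall>m\<ge>M. \<forall>n\<ge>M.
        dist (case z of (p, x) \<Rightarrow> u' m p x) (case z of (p, x) \<Rightarrow> u' n p x) < e"
      by (auto intro!: exI[of _ N])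
  qed
qed (simp add: uniformly_convergent_on_def)

lemma has_dir_deriv_uniform_limit:
  fixes u :: "nat \<Rightarrow> 'x::real_vector \<Rightarrow> 'b::banach"
  assumes deriv: "\<And>k. has_dir_deriv (u k) i (u' k)"
    and lim: "\<And>x. (\<lambda>k. u k x) \<longlonglongrightarrow> v x" and lim': "uniform_limit UNIV u' v' sequentially"
  shows "has_dir_deriv v i v'"
  unfolding has_dir_deriv_def
proof
  fix x
  have "\<exists>g. \<forall>r\<in>UNIV. (\<lambda>k. u k (x + r *\<^sub>R i)) \<longlonglongrightarrow> g r \<and>
      (g has_derivative (\<lambda>h. h *\<^sub>R v' (x + r *\<^sub>R i))) (at r)"
  proof (rule has_derivative_sequence[where f="\<lambda>k r. u k (x + r *\<^sub>R i)"
        and f'="\<lambda>k r h. h *\<^sub>R u' k (x + r *\<^sub>R i)" and ?x0.0=0 and l="v x"])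
    show "((\<lambda>r. u k (x + r *\<^sub>R i)) has_derivative (\<lambda>h. h *\<^sub>R u' k (x + r *\<^sub>R i))) (at r)" for k r
      using has_dir_deriv_along_line[OF deriv] by (simp add: has_vector_derivative_def)
    show "\<forall>\<^sub>F k in sequentially. \<forall>r\<in>UNIV. \<forall>h.
        norm (h *\<^sub>R u' k (x + r *\<^sub>R i) - h *\<^sub>R v' (x + r *\<^sub>R i)) \<le> e * norm h"
      if "0 < e" for e
      using uniform_limitD[OF lim' that]
    proof eventually_elim
      case (elim k)
      have "norm (h *\<^sub>R (u' k z - v' z)) \<le> \<bar>h\<bar> * e" for h z
        using elim by (metis UNIV_I abs_ge_zero dist_norm less_imp_le mult_left_mono norm_scaleR)
      then show ?case by (simp add: scaleR_diff_right mult.commute)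
    qed
  qed (use lim in auto)
  then obtain g where g_lim: "\<And>r. (\<lambda>k. u k (x + r *\<^sub>R i)) \<longlonglongrightarrow> g r"
    and g_deriv: "(g has_derivative (\<lambda>h. h *\<^sub>R v' (x + 0 *\<^sub>R i))) (at 0)" by blast
  have "g = (\<lambda>r. v (x + r *\<^sub>R i))" using LIMSEQ_unique[OF g_lim lim] by auto
  then show "((\<lambda>r. v (x + r *\<^sub>R i)) has_vector_derivative v' x) (at 0)"
    using g_deriv by (simp add: has_vector_derivative_def)
qed

definition time_equicontinuous_on :: "real set \<Rightarrow> (real \<Rightarrow> 'x \<Rightarrow> 'b::real_normed_vector) \<Rightarrow> bool" where
  "time_equicontinuous_on A u \<longleftrightarrow>
     (\<forall>e>0. \<exists>d>0. \<forall>s\<in>A. \<forall>t\<in>A. \<bar>t - s\<bar> < d \<longrightarrow> (\<forall>x. norm (u t x - u s x) \<le> e))"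

lemma time_equicontinuous_onE:
  assumes "time_equicontinuous_on A u" "0 < e"
  obtains d where "0 < d" "\<And>s t x. s \<in> A \<Longrightarrow> t \<in> A \<Longrightarrow> \<bar>t - s\<bar> < d \<Longrightarrow> norm (u t x - u s x) \<le> e"
  using assms unfolding time_equicontinuous_on_def by meson

lemma time_equicontinuous_on_finiteE:
  assumes "finite I" "\<And>i. i \<in> I \<Longrightarrow> time_equicontinuous_on A (u i)" "0 < e"
  obtains d where "0 < d"
    "\<And>i s t x. i \<in> I \<Longrightarrow> s \<in> A \<Longrightarrow> t \<in> A \<Longrightarrow> \<bar>t - s\<bar> < d \<Longrightarrow> norm (u i t x - u i s x) \<le> e"
proof -
  have "\<exists>d>0. \<forall>i\<in>I. \<forall>s\<in>A. \<forall>t\<in>A. \<bar>t - s\<bar> < d \<longrightarrow> (\<forall>x. norm (u i t x - u i s x) \<le> e)"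
    using assms(1,2)
  proof (induction I rule: finite_induct)
    case empty
    then show ?case by (auto intro: exI[of _ 1])
  next
    case (insert j I)
    obtain d where "0 < d"
      "\<forall>i\<in>I. \<forall>s\<in>A. \<forall>t\<in>A. \<bar>t - s\<bar> < d \<longrightarrow> (\<forall>x. norm (u i t x - u i s x) \<le> e)"
      using insert.IH insert.prems by auto
    moreover obtain d' where "0 < d'"
      "\<And>s t x. s \<in> A \<Longrightarrow> t \<in> A \<Longrightarrow> \<bar>t - s\<bar> < d' \<Longrightarrow> norm (u j t x - u j s x) \<le> e"
      by (rule time_equicontinuous_onE[OF insert.prems[OF insertI1] \<open>0 < e\<close>]) auto
    ultimately show ?case by (intro exI[of _ "min d d'"]) auto
  qed
  then show thesis using that by blast
qed

lemma time_equicontinuous_on_diff: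
  assumes u: "time_equicontinuous_on A u" and v: "time_equicontinuous_on A v"
  shows "time_equicontinuous_on A (\<lambda>t x. u t x - v t x)"
  unfolding time_equicontinuous_on_def
proof (intro allI impI)
  fix e :: real assume "0 < e"
  then obtain d d' where "0 < d" "0 < d'"
    and u_close: "\<And>s t x. s \<in> A \<Longrightarrow> t \<in> A \<Longrightarrow> \<bar>t - s\<bar> < d \<Longrightarrow> norm (u t x - u s x) \<le> e / 2"
    and v_close: "\<And>s t x. s \<in> A \<Longrightarrow> t \<in> A \<Longrightarrow> \<bar>t - s\<bar> < d' \<Longrightarrow> norm (v t x - v s x) \<le> e / 2"
    using time_equicontinuous_onE[OF u, of "e / 2"] time_equicontinuous_onE[OF v, of "e / 2"]
    by (metis half_gt_zero)
  have "norm (u t x - v t x - (u s x - v s x)) \<le> e"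
    if "s \<in> A" "t \<in> A" "\<bar>t - s\<bar> < min d d'" for s t x
    using u_close[of s t x] v_close[of s t x] that
      norm_triangle_ineq4[of "u t x - u s x" "v t x - v s x"]
    by (simp add: algebra_simps)
  with \<open>0 < d\<close> \<open>0 < d'\<close>
  show "\<exists>d>0. \<forall>s\<in>A. \<forall>t\<in>A. \<bar>t - s\<bar> < d \<longrightarrow> (\<forall>x. norm (u t x - v t x - (u s x - v s x)) \<le> e)"
    by (intro exI[of _ "min d d'"]) auto
qed

lemma time_equicontinuous_on_dir_deriv:
  assumes equi: "time_equicontinuous_on A u"
    and deriv: "\<And>t. t \<in> A \<Longrightarrow> has_dir_deriv (u t) i (u' t)"
    and deriv2: "\<And>t. t \<in> A \<Longrightarrow> has_dir_deriv (u' t) i (u'' t)"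
    and bound: "\<And>t x. t \<in> A \<Longrightarrow> norm (u'' t x) \<le> C"
  shows "time_equicontinuous_on A u'"
proof (cases "A = {}")
  case False
  then have "0 \<le> C" using bound norm_ge_zero order_trans by blast
  show ?thesis unfolding time_equicontinuous_on_def
  proof (intro allI impI)
    fix e :: real assume "0 < e"
    then have "0 < e\<^sup>2 / (16 * (C + 1))" using \<open>0 \<le> C\<close> by simp
    with equi obtain d where "0 < d"
      and close: "\<And>s t x. s \<in> A \<Longrightarrow> t \<in> A \<Longrightarrow> \<bar>t - s\<bar> < d \<Longrightarrow> norm (u t x - u s x) \<le> e\<^sup>2 / (16 * (C + 1))"
      by (rule time_equicontinuous_onE) blast
    have "norm (u' t x - u' s x) \<le> e" if "s \<in> A" "t \<in> A" "\<bar>t - s\<bar> < d" for s t x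
      using that \<open>0 < e\<close> close[OF that]
      by (intro norm_dir_deriv_diff_le[OF deriv deriv2 bound deriv deriv2 bound]) auto
    with \<open>0 < d\<close> show "\<exists>d>0. \<forall>s\<in>A. \<forall>t\<in>A. \<bar>t - s\<bar> < d \<longrightarrow> (\<forall>x. norm (u' t x - u' s x) \<le> e)" by blast
  qed
qed (auto simp: time_equicontinuous_on_def intro: exI[of _ 1])

section \<open>Transport--diffusion equations\<close>

definition advect :: "'x::euclidean_space \<Rightarrow> ('x \<Rightarrow> 'b::real_vector) \<Rightarrow> 'b" where
  "advect a v = (\<Sum>k\<in>Basis. (a \<bullet> k) *\<^sub>R v k)"

lemma advect_diff_left: "advect (a - b) v = advect a v - advect b v"
  by (simp add: advect_def inner_diff_left scaleR_diff_left sum_subtractf)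

lemma advect_diff_right: "advect a (\<lambda>k. v k - w k) = advect a v - advect a w"
  by (simp add: advect_def scaleR_diff_right sum_subtractf)

lemma advect_linear:
  assumes "linear L"
  shows "L (advect a v) = advect a (\<lambda>k. L (v k))"
  by (simp add: advect_def linear_sum[OF assms] linear_scale[OF assms])

lemma norm_advect_le:
  fixes a :: "'x::euclidean_space" and v :: "'x \<Rightarrow> 'b::real_normed_vector"
  assumes "norm a \<le> A" "\<And>k. k \<in> Basis \<Longrightarrow> norm (v k) \<le> V"
  shows "norm (advect a v) \<le> real DIM('x) * (A * V)"
proof -
  have "norm ((a \<bullet> k) *\<^sub>R v k) \<le> A * V" if "k \<in> Basis" for k
    using Basis_le_norm[OF that, of a] assms(1) assms(2)[OF that] by (auto intro!: mult_mono)
  then show ?thesis unfolding advect_def by (rule sum_norm_bound)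
qed

lemma fdiff_advect:
  "fdiff a (\<lambda>x. advect (b x) (\<lambda>k. v k x)) x
    = advect (b (x + a)) (\<lambda>k. fdiff a (v k) x) + advect (fdiff a b x) (\<lambda>k. v k x)"
  by (simp add: fdiff_def advect_diff_left advect_diff_right)

lemma fdiff_fdiff_advect:
  fixes b :: "'x::euclidean_space \<Rightarrow> 'x"
  shows "fdiff c (fdiff a (\<lambda>x. advect (b x) (\<lambda>k. v k x))) x
    = advect (b (x + c + a)) (\<lambda>k. fdiff c (fdiff a (v k)) x)
      + advect (fdiff c b (x + a)) (\<lambda>k. fdiff a (v k) x)
      + advect (fdiff a b (x + c)) (\<lambda>k. fdiff c (v k) x)
      + advect (fdiff c (fdiff a b) x) (\<lambda>k. v k x)"
  unfolding fdiff_def advect_diff_left advect_diff_right by (simp add: algebra_simps)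

definition transport_diffusion :: "real \<Rightarrow> real \<Rightarrow> (real \<Rightarrow> 'x::euclidean_space \<Rightarrow> 'x) \<Rightarrow>
    (real \<Rightarrow> 'x \<Rightarrow> 'b::real_normed_vector) \<Rightarrow> (real \<Rightarrow> 'x \<Rightarrow> 'b) \<Rightarrow> ('x \<Rightarrow> real \<Rightarrow> 'x \<Rightarrow> 'b) \<Rightarrow>
    ('x \<Rightarrow> real \<Rightarrow> 'x \<Rightarrow> 'b) \<Rightarrow> bool" where
  "transport_diffusion \<nu> \<tau> b S w w1 w2 \<longleftrightarrow>
     continuous_on ({0..\<tau>} \<times> UNIV) (\<lambda>(t, x). w t x) \<and>
     (\<forall>t\<in>{0..\<tau>}. \<forall>x. ((\<lambda>s. w s x) has_vector_derivative
        \<nu> *\<^sub>R (\<Sum>i\<in>Basis. w2 i t x) - advect (b t x) (\<lambda>i. w1 i t x) + S t x) (at t within {0..\<tau>})) \<and>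
     (\<forall>t\<in>{0..\<tau>}. \<forall>i\<in>Basis. has_dir_deriv (w t) i (w1 i t)) \<and>
     (0 < \<nu> \<longrightarrow> (\<forall>t\<in>{0..\<tau>}. \<forall>i\<in>Basis. has_dir_deriv (w1 i t) i (w2 i t)))"

lemma transport_diffusionD:
  assumes "transport_diffusion \<nu> \<tau> b S w w1 w2"
  shows "continuous_on ({0..\<tau>} \<times> UNIV) (\<lambda>(t, x). w t x)"
    and "t \<in> {0..\<tau>} \<Longrightarrow> ((\<lambda>s. w s x) has_vector_derivative
        \<nu> *\<^sub>R (\<Sum>i\<in>Basis. w2 i t x) - advect (b t x) (\<lambda>i. w1 i t x) + S t x) (at t within {0..\<tau>})"
    and "t \<in> {0..\<tau>} \<Longrightarrow> i \<in> Basis \<Longrightarrow> has_dir_deriv (w t) i (w1 i t)"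
    and "0 < \<nu> \<Longrightarrow> t \<in> {0..\<tau>} \<Longrightarrow> i \<in> Basis \<Longrightarrow> has_dir_deriv (w1 i t) i (w2 i t)"
  using assms by (auto simp: transport_diffusion_def)

lemma transport_diffusion_diff:
  assumes w: "transport_diffusion \<nu> \<tau> b S w w1 w2" and v: "transport_diffusion \<nu> \<tau> c S' v v1 v2"
  shows "transport_diffusion \<nu> \<tau> b (\<lambda>t x. S t x - S' t x - advect (b t x - c t x) (\<lambda>i. v1 i t x))
    (\<lambda>t x. w t x - v t x) (\<lambda>i t x. w1 i t x - v1 i t x) (\<lambda>i t x. w2 i t x - v2 i t x)"
proof -
  have "((\<lambda>s. w s x - v s x) has_vector_derivative
      \<nu> *\<^sub>R (\<Sum>i\<in>Basis. w2 i t x - v2 i t x) - advect (b t x) (\<lambda>i. w1 i t x - v1 i t x)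
      + (S t x - S' t x - advect (b t x - c t x) (\<lambda>i. v1 i t x))) (at t within {0..\<tau>})"
    if "t \<in> {0..\<tau>}" for t x
    using has_vector_derivative_diff[OF transport_diffusionD(2)[OF w that]
      transport_diffusionD(2)[OF v that]]
    by (simp add: sum_subtractf advect_diff_left advect_diff_right algebra_simps)
  moreover have "continuous_on ({0..\<tau>} \<times> UNIV) (\<lambda>(t, x). w t x - v t x)"
    using transport_diffusionD(1)[OF w] transport_diffusionD(1)[OF v] unfolding case_prod_beta
    by (rule continuous_on_diff)
  ultimately show ?thesis
    using transport_diffusionD(3,4)[OF w] transport_diffusionD(3,4)[OF v]
    unfolding transport_diffusion_def by (auto intro: has_dir_deriv_diff)
qed

lemma transport_diffusion_shift:
  assumes w: "transport_diffusion \<nu> \<tau> b S w w1 w2"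
  shows "transport_diffusion \<nu> \<tau> (\<lambda>t x. b t (x + a)) (\<lambda>t x. S t (x + a))
    (\<lambda>t x. w t (x + a)) (\<lambda>i t x. w1 i t (x + a)) (\<lambda>i t x. w2 i t (x + a))"
proof -
  have "continuous_on ({0..\<tau>} \<times> UNIV) (\<lambda>(t, x). w t (x + a))"
    using continuous_on_compose2[OF transport_diffusionD(1)[OF w],
      of "{0..\<tau>} \<times> UNIV" "\<lambda>z. (fst z, snd z + a)"]
    by (force intro!: continuous_intros simp: case_prod_beta)
  then show ?thesis
    using transport_diffusionD(2-4)[OF w]
    unfolding transport_diffusion_def by (auto intro: has_dir_deriv_shift)
qed

lemma transport_diffusion_fdiff:
  assumes "transport_diffusion \<nu> \<tau> b S w w1 w2"
  shows "transport_diffusion \<nu> \<tau> (\<lambda>t x. b t (x + a))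
    (\<lambda>t x. fdiff a (S t) x - advect (fdiff a (b t) x) (\<lambda>i. w1 i t x))
    (\<lambda>t. fdiff a (w t)) (\<lambda>i t. fdiff a (w1 i t)) (\<lambda>i t. fdiff a (w2 i t))"
  using transport_diffusion_diff[OF transport_diffusion_shift[OF assms] assms]
  by (simp add: fdiff_def[abs_def])

lemma transport_diffusion_bounded_linear:
  assumes L: "bounded_linear L" and w: "transport_diffusion \<nu> \<tau> b S w w1 w2"
  shows "transport_diffusion \<nu> \<tau> b (\<lambda>t x. L (S t x)) (\<lambda>t x. L (w t x))
      (\<lambda>i t x. L (w1 i t x)) (\<lambda>i t x. L (w2 i t x))"
proof -
  interpret L: bounded_linear L by fact
  have "((\<lambda>s. L (w s x)) has_vector_derivative
      \<nu> *\<^sub>R (\<Sum>i\<in>Basis. L (w2 i t x)) - advect (b t x) (\<lambda>i. L (w1 i t x)) + L (S t x))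
      (at t within {0..\<tau>})"
    if "t \<in> {0..\<tau>}" for t x
    using L.has_vector_derivative[OF transport_diffusionD(2)[OF w that]]
    by (simp add: L.add L.diff L.scaleR L.sum advect_linear[OF L.linear_axioms])
  moreover have "continuous_on ({0..\<tau>} \<times> UNIV) (\<lambda>(t, x). L (w t x))"
    using L.continuous_on[OF transport_diffusionD(1)[OF w]] by (simp add: case_prod_beta)
  ultimately show ?thesis
    using transport_diffusionD(3,4)[OF w] L
    unfolding transport_diffusion_def by (auto intro: has_dir_deriv_bounded_linear)
qed

lemma transport_diffusion_subinterval:
  assumes w: "transport_diffusion \<nu> \<tau> b S w w1 w2" and "\<tau>' \<le> \<tau>"
  shows "transport_diffusion \<nu> \<tau>' b S w w1 w2"
proof -
  have "{0..\<tau>'} \<subseteq> {0..\<tau>}" using assms(2) by auto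
  moreover from this have "continuous_on ({0..\<tau>'} \<times> UNIV) (\<lambda>(t, x). w t x)"
    using continuous_on_subset[OF transport_diffusionD(1)[OF w]] by blast
  ultimately show ?thesis
    using transport_diffusionD(2-4)[OF w] unfolding transport_diffusion_def
    by (meson has_vector_derivative_within_subset in_mono)
qed

lemma transport_diffusion_change_viscosity:
  assumes w: "transport_diffusion \<mu> \<tau> b S w w1 w2" and "0 < \<mu>"
  shows "transport_diffusion \<nu> \<tau> b (\<lambda>t x. S t x + (\<mu> - \<nu>) *\<^sub>R (\<Sum>i\<in>Basis. w2 i t x)) w w1 w2"
proof -
  have "((\<lambda>s. w s x) has_vector_derivative
      \<nu> *\<^sub>R (\<Sum>i\<in>Basis. w2 i t x) - advect (b t x) (\<lambda>i. w1 i t x)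
      + (S t x + (\<mu> - \<nu>) *\<^sub>R (\<Sum>i\<in>Basis. w2 i t x))) (at t within {0..\<tau>})" if "t \<in> {0..\<tau>}" for t x
    using transport_diffusionD(2)[OF w that, of x] by (simp add: algebra_simps)
  then show ?thesis
    using transport_diffusionD(1,3,4)[OF w] \<open>0 < \<mu>\<close> unfolding transport_diffusion_def by auto
qed

section \<open>The maximum principle\<close>

lemma attains_positive_max:
  fixes q :: "'t::topological_space \<Rightarrow> 'x::euclidean_space \<Rightarrow> real"
  assumes cont: "continuous_on (K \<times> UNIV) (\<lambda>(t, x). q t x)" and "compact K"
    and far: "\<And>t x. t \<in> K \<Longrightarrow> \<rho> < norm x \<Longrightarrow> q t x \<le> 0"
    and pos: "t0 \<in> K" "0 < q t0 x0"
  obtains t1 x1 where "t1 \<in> K" "0 < q t1 x1" "\<And>t x. t \<in> K \<Longrightarrow> q t x \<le> q t1 x1"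
proof -
  have near: "norm x \<le> \<rho>" if "t \<in> K" "0 < q t x" for t x using far[of t x] that by fastforce
  have "compact (K \<times> cball (0::'x) \<rho>)" using \<open>compact K\<close> by (intro compact_Times) auto
  moreover have "(t0, x0) \<in> K \<times> cball 0 \<rho>" using near pos by auto
  moreover have "continuous_on (K \<times> cball 0 \<rho>) (\<lambda>(t, x). q t x)"
    using cont by (rule continuous_on_subset) auto
  ultimately obtain z where "z \<in> K \<times> cball 0 \<rho>"
    and z_max: "\<forall>z'\<in>K \<times> cball 0 \<rho>. (\<lambda>(t, x). q t x) z' \<le> (\<lambda>(t, x). q t x) z"
    using continuous_attains_sup by blast
  obtain t1 x1 where "z = (t1, x1)" by force
  with z_max have max: "q t x \<le> q t1 x1" if "t \<in> K" "norm x \<le> \<rho>" for t x using that by auto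
  have "0 < q t1 x1" using max[OF pos(1) near[OF pos]] pos(2) by simp
  then have "q t x \<le> q t1 x1" if "t \<in> K" for t x
    using max[OF that, of x] far[OF that, of x] by fastforce
  with \<open>0 < q t1 x1\<close> show thesis using that \<open>z \<in> _\<close> \<open>z = (t1, x1)\<close> by auto
qed

lemma time_deriv_nonneg_at_max:
  fixes \<phi> :: "real \<Rightarrow> real"
  assumes deriv: "(\<phi> has_real_derivative D) (at t within {a..b})" and "a < t" "t \<le> b"
    and max: "\<And>s. s \<in> {a..b} \<Longrightarrow> \<phi> s \<le> \<phi> t"
  shows "0 \<le> D"
proof (rule ccontr)
  assume "\<not> 0 \<le> D"
  then obtain e where "0 < e" and decreasing: "\<And>h. 0 < h \<Longrightarrow> t - h \<in> {a..b} \<Longrightarrow> h < e \<Longrightarrow> \<phi> t < \<phi> (t - h)"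
    using has_real_derivative_neg_dec_left[OF deriv] by auto
  define h where "h = min (e / 2) (t - a)"
  have "0 < h" "h < e" "t - h \<in> {a..b}" using assms(2,3) \<open>0 < e\<close> by (auto simp: h_def min_def)
  then show False using decreasing max[of "t - h"] by fastforce
qed

lemma dir_deriv_at_max:
  fixes u :: "'x::real_vector \<Rightarrow> real"
  assumes deriv: "has_dir_deriv u i u'" and max: "\<And>x. u x \<le> u x0"
  shows "u' x0 = 0"
  using DERIV_local_max[of "\<lambda>s. u (x0 + s *\<^sub>R i)" "u' x0" 0 1] has_dir_derivD[OF deriv, of x0] max
  by (simp add: has_real_derivative_iff_has_vector_derivative)

lemma second_dir_deriv_at_max:
  fixes u :: "'x::real_vector \<Rightarrow> real"
  assumes deriv: "has_dir_deriv u i u'" and deriv2: "has_dir_deriv u' i u''"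
    and max: "\<And>x. u x \<le> u x0"
  shows "u'' x0 \<le> 0"
proof (rule ccontr)
  have line: "((\<lambda>s. v (x0 + s *\<^sub>R i)) has_real_derivative v' (x0 + r *\<^sub>R i)) (at r)"
    if "has_dir_deriv v i v'" for v v' :: "'x \<Rightarrow> real" and r
    using has_dir_deriv_along_line[OF that]
    by (simp add: has_real_derivative_iff_has_vector_derivative)
  assume "\<not> u'' x0 \<le> 0"
  then obtain e where "0 < e" and increasing: "\<And>h. 0 < h \<Longrightarrow> h < e \<Longrightarrow> 0 < u' (x0 + h *\<^sub>R i)"
    using has_real_derivative_pos_inc_right[OF line[OF deriv2, of 0]] dir_deriv_at_max[OF deriv max]
    by auto
  have "u (x0 + 0 *\<^sub>R i) < u (x0 + (e / 2) *\<^sub>R i)"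
  proof (rule DERIV_pos_imp_increasing_open[where f="\<lambda>s. u (x0 + s *\<^sub>R i)"])
    show "\<exists>y. ((\<lambda>s. u (x0 + s *\<^sub>R i)) has_real_derivative y) (at s) \<and> 0 < y"
      if "0 < s" "s < e / 2" for s
      using line[OF deriv] increasing[of s] that by auto
    show "continuous_on {0..e / 2} (\<lambda>s. u (x0 + s *\<^sub>R i))"
      using line[OF deriv] by (meson DERIV_continuous_on has_field_derivative_at_within)
  qed (use \<open>0 < e\<close> in auto)
  then show False using max[of "x0 + (e / 2) *\<^sub>R i"] by simp
qed

lemma strict_max_principle:
  fixes q :: "real \<Rightarrow> 'x::euclidean_space \<Rightarrow> real"
  assumes sol: "transport_diffusion \<nu> \<tau> b S q q1 q2" and "0 \<le> \<nu>"
    and source: "\<And>t x. t \<in> {0..\<tau>} \<Longrightarrow> S t x < 0" and init: "\<And>x. q 0 x \<le> 0"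
    and far: "\<And>t x. t \<in> {0..\<tau>} \<Longrightarrow> \<rho> < norm x \<Longrightarrow> q t x \<le> 0" and t: "t \<in> {0..\<tau>}"
  shows "q t x \<le> 0"
proof (rule ccontr)
  assume "\<not> q t x \<le> 0"
  then have "0 < q t x" by simp
  then obtain t1 x1 where t1: "t1 \<in> {0..\<tau>}" and pos: "0 < q t1 x1"
    and max: "\<And>s y. s \<in> {0..\<tau>} \<Longrightarrow> q s y \<le> q t1 x1"
    using attains_positive_max[OF transport_diffusionD(1)[OF sol] compact_Icc far t] by blast
  have "0 < t1" using t1 pos init[of x1] by (cases "t1 = 0") auto
  have "q1 i t1 x1 = 0" if "i \<in> Basis" for i
    using dir_deriv_at_max[OF transport_diffusionD(3)[OF sol t1 that] max[OF t1]] .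
  then have "advect (b t1 x1) (\<lambda>i. q1 i t1 x1) = 0" by (simp add: advect_def)
  moreover have "\<nu> * (\<Sum>i\<in>Basis. q2 i t1 x1) \<le> 0"
  proof (cases "\<nu> = 0")
    case False
    then have "q2 i t1 x1 \<le> 0" if "i \<in> Basis" for i
      using second_dir_deriv_at_max[OF transport_diffusionD(3,4)[OF sol] max[OF t1]] that t1 \<open>0 \<le> \<nu>\<close>
      by auto
    then show ?thesis using \<open>0 \<le> \<nu>\<close> by (intro mult_nonneg_nonpos sum_nonpos)
  qed simp
  moreover have "0 \<le> \<nu> *\<^sub>R (\<Sum>i\<in>Basis. q2 i t1 x1) - advect (b t1 x1) (\<lambda>i. q1 i t1 x1) + S t1 x1"
    using transport_diffusionD(2)[OF sol t1, of x1] t1 \<open>0 < t1\<close> max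
    by (intro time_deriv_nonneg_at_max[where \<phi>="\<lambda>s. q s x1" and a=0 and b=\<tau> and t=t1])
      (auto simp: has_real_derivative_iff_has_vector_derivative)
  ultimately show False using source[OF t1, of x1] by simp
qed

lemma exponential_barrier:
  fixes b :: "real \<Rightarrow> 'x::euclidean_space \<Rightarrow> 'x"
  shows "transport_diffusion \<nu> \<tau> b
    (\<lambda>t x. exp (l * t) * (l * (1 + x \<bullet> x) - 2 * real DIM('x) * \<nu> + 2 * (b t x \<bullet> x)))
    (\<lambda>t x. exp (l * t) * (1 + x \<bullet> x)) (\<lambda>i t x. exp (l * t) * (2 * (x \<bullet> i)))
    (\<lambda>i t x. exp (l * t) * 2)"
  unfolding transport_diffusion_def
proof (intro conjI impI ballI allI)
  show "continuous_on ({0..\<tau>} \<times> UNIV) (\<lambda>(t, x). exp (l * t) * (1 + x \<bullet> x))"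
    unfolding case_prod_beta by (intro continuous_intros)
  show "((\<lambda>s. exp (l * s) * (1 + x \<bullet> x)) has_vector_derivative
      \<nu> *\<^sub>R (\<Sum>i\<in>(Basis::'x set). exp (l * t) * 2) - advect (b t x) (\<lambda>i. exp (l * t) * (2 * (x \<bullet> i)))
      + exp (l * t) * (l * (1 + x \<bullet> x) - 2 * real DIM('x) * \<nu> + 2 * (b t x \<bullet> x)))
      (at t within {0..\<tau>})"
    if "t \<in> {0..\<tau>}" for t x
  proof -
    have "b t x \<bullet> x = (\<Sum>i\<in>Basis. (b t x \<bullet> i) * (x \<bullet> i))" by (rule euclidean_inner)
    then have "advect (b t x) (\<lambda>i. exp (l * t) * (2 * (x \<bullet> i))) = exp (l * t) * (2 * (b t x \<bullet> x))"
      by (simp add: advect_def sum_distrib_left mult_ac)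
    then show ?thesis
      unfolding has_real_derivative_iff_has_vector_derivative[symmetric]
      by (auto intro!: derivative_eq_intros simp: algebra_simps)
  qed
  have quadratic: "((\<lambda>s. (x + s *\<^sub>R i) \<bullet> (x + s *\<^sub>R i)) has_real_derivative 2 * (x \<bullet> i)) (at 0)"
    and linear: "((\<lambda>s. (x + s *\<^sub>R i) \<bullet> i) has_real_derivative 1) (at 0)"
      if "i \<in> Basis" for i x :: 'x
    using that
    by (auto intro!: derivative_eq_intros simp: inner_add_left inner_add_right inner_commute)
  show "has_dir_deriv (\<lambda>x. exp (l * t) * (1 + x \<bullet> x)) i (\<lambda>x. exp (l * t) * (2 * (x \<bullet> i)))"
    and "has_dir_deriv (\<lambda>x. exp (l * t) * (2 * (x \<bullet> i))) i (\<lambda>x. exp (l * t) * 2)"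
      if "i \<in> Basis" for t and i :: 'x
    unfolding has_dir_deriv_def has_real_derivative_iff_has_vector_derivative[symmetric]
    by (auto intro!: derivative_eq_intros quadratic linear that)
qed

lemma exponential_barrier_source_pos:
  fixes b x :: "'x::euclidean_space"
  assumes "0 \<le> \<nu>" "norm b \<le> B" "2 * real DIM('x) * \<nu> + B < l"
  shows "0 < exp (l * t) * (l * (1 + x \<bullet> x) - 2 * real DIM('x) * \<nu> + 2 * (b \<bullet> x))"
proof -
  have "0 \<le> B" using assms(2) norm_ge_zero order_trans by blast
  have "2 * norm x \<le> 1 + x \<bullet> x"
    using zero_le_power2[of "norm x - 1"] by (simp add: power2_diff dot_square_norm)
  then have "B * (2 * norm x) \<le> B * (1 + x \<bullet> x)" using \<open>0 \<le> B\<close> by (rule mult_left_mono)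
  moreover have "\<bar>b \<bullet> x\<bar> \<le> B * norm x"
    using Cauchy_Schwarz_ineq2[of b x] mult_right_mono[OF assms(2) norm_ge_zero[of x]] by linarith
  moreover have "2 * real DIM('x) * \<nu> * (1 + x \<bullet> x) + B * (1 + x \<bullet> x) < l * (1 + x \<bullet> x)"
    unfolding distrib_right[symmetric]
    using assms(3) by (intro mult_strict_right_mono) (auto simp: add_pos_nonneg)
  moreover have "2 * real DIM('x) * \<nu> * 1 \<le> 2 * real DIM('x) * \<nu> * (1 + x \<bullet> x)"
    using assms(1) by (intro mult_left_mono) auto
  ultimately have "0 < l * (1 + x \<bullet> x) - 2 * real DIM('x) * \<nu> + 2 * (b \<bullet> x)"
    by linarith
  then show ?thesis by simp
qed

context
  fixes \<nu> \<tau> B K :: real and b :: "real \<Rightarrow> 'x::euclidean_space \<Rightarrow> 'x"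
    and S v :: "real \<Rightarrow> 'x \<Rightarrow> real" and v1 v2
  assumes sol: "transport_diffusion \<nu> \<tau> b S v v1 v2" and nu_nonneg: "0 \<le> \<nu>"
    and drift: "\<And>t x. t \<in> {0..\<tau>} \<Longrightarrow> norm (b t x) \<le> B" and bound: "\<And>t x. t \<in> {0..\<tau>} \<Longrightarrow> v t x \<le> K"
    and source: "\<And>t x. t \<in> {0..\<tau>} \<Longrightarrow> S t x \<le> 0" and init: "\<And>x. v 0 x \<le> 0"
begin

lemma le_exponential_barrier:
  assumes t: "t \<in> {0..\<tau>}" and "0 < \<epsilon>" and l: "0 \<le> l" "2 * real DIM('x) * \<nu> + B < l"
  shows "v t x \<le> \<epsilon> * (exp (l * t) * (1 + x \<bullet> x))"
proof -
  define \<psi> where "\<psi> t x = exp (l * t) * (1 + x \<bullet> x)" for t and x :: 'x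
  have "v t x - \<epsilon> * \<psi> t x \<le> 0"
  proof (rule strict_max_principle[OF transport_diffusion_diff[OF sol
          transport_diffusion_bounded_linear[OF bounded_linear_mult_right
            exponential_barrier[of \<nu> \<tau> b l]],
          of \<epsilon>, folded \<psi>_def] nu_nonneg _ _ _ t])
    fix t x assume t: "t \<in> {0..\<tau>}"
    have "0 < \<epsilon> * (exp (l * t) * (l * (1 + x \<bullet> x) - 2 * real DIM('x) * \<nu> + 2 * (b t x \<bullet> x)))"
      by (rule mult_pos_pos[OF \<open>0 < \<epsilon>\<close>
        exponential_barrier_source_pos[OF nu_nonneg drift[OF t] l(2)]])
    moreover have "advect (b t x - b t x) w = 0" for w :: "'x \<Rightarrow> real" by (simp add: advect_def)
    ultimately show "S t x
        - \<epsilon> * (exp (l * t) * (l * (1 + x \<bullet> x) - 2 * real DIM('x) * \<nu> + 2 * (b t x \<bullet> x)))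
        - advect (b t x - b t x) (\<lambda>i. \<epsilon> * (exp (l * t) * (2 * (x \<bullet> i)))) < 0"
      using source[OF t, of x] by simp
    assume far: "max 1 (K / \<epsilon>) < norm x"
    then have "norm x * 1 \<le> norm x * norm x" by (intro mult_left_mono) auto
    also have "\<dots> \<le> 1 * (1 + x \<bullet> x)" by (simp add: dot_square_norm power2_eq_square)
    also have "\<dots> \<le> \<psi> t x"
      unfolding \<psi>_def using l(1) t by (intro mult_right_mono) auto
    finally have "\<epsilon> * norm x \<le> \<epsilon> * \<psi> t x" using \<open>0 < \<epsilon>\<close> by simp
    moreover have "K < \<epsilon> * norm x" using far \<open>0 < \<epsilon>\<close> by (simp add: pos_divide_less_eq mult.commute)
    ultimately show "v t x - \<epsilon> * \<psi> t x \<le> 0" using bound[OF t, of x] by linarith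
  next
    have "0 \<le> \<epsilon> * \<psi> 0 x" for x using \<open>0 < \<epsilon>\<close> by (simp add: \<psi>_def)
    then show "v 0 x - \<epsilon> * \<psi> 0 x \<le> 0" for x using init[of x] by (smt (verit))
  qed
  then show ?thesis by (simp add: \<psi>_def)
qed

lemma max_principle_nonpos:
  assumes t: "t \<in> {0..\<tau>}"
  shows "v t x \<le> 0"
proof -
  define l where "l = 2 * real DIM('x) * \<nu> + B + 1"
  have "0 \<le> B" using drift[OF t] norm_ge_zero order_trans by blast
  then have l: "0 \<le> l" "2 * real DIM('x) * \<nu> + B < l" using nu_nonneg by (simp_all add: l_def)
  define c where "c = exp (l * t) * (1 + x \<bullet> x)"
  have "0 < c" by (simp add: c_def add_pos_nonneg)
  have "v t x \<le> 0 + e" if "0 < e" for e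
    using le_exponential_barrier[OF t divide_pos_pos[OF that \<open>0 < c\<close>] l, of x, folded c_def] \<open>0 < c\<close>
    by simp
  then show ?thesis by (rule field_le_epsilon)
qed

end

lemma transport_diffusion_affine:
  "transport_diffusion \<nu> \<tau> b (\<lambda>_ _. A) (\<lambda>t x. P + A * t) (\<lambda>_ _ _. 0) (\<lambda>_ _ _. 0 :: real)"
  unfolding transport_diffusion_def case_prod_beta
  by (auto simp: advect_def has_dir_deriv_def
    has_real_derivative_iff_has_vector_derivative[symmetric]
      intro!: continuous_intros derivative_eq_intros)

lemma transport_diffusion_norm_le:
  fixes w :: "real \<Rightarrow> 'x::euclidean_space \<Rightarrow> 'b::real_inner"
  assumes sol: "transport_diffusion \<nu> \<tau> b S w w1 w2" and "0 \<le> \<nu>"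
    and drift: "\<And>t x. t \<in> {0..\<tau>} \<Longrightarrow> norm (b t x) \<le> B"
    and bound: "\<And>t x. t \<in> {0..\<tau>} \<Longrightarrow> norm (w t x) \<le> K"
    and source: "\<And>t x. t \<in> {0..\<tau>} \<Longrightarrow> norm (S t x) \<le> A" and init: "\<And>x. norm (w 0 x) \<le> P"
    and t: "t \<in> {0..\<tau>}"
  shows "norm (w t x) \<le> P + A * t"
proof -
  define e where "e = sgn (w t x)"
  have "norm e \<le> 1" by (simp add: e_def norm_sgn)
  then have component: "v \<bullet> e \<le> norm v" for v
    using norm_cauchy_schwarz[of v e] mult_left_mono[of "norm e" 1 "norm v"] by simp
  have "0 \<le> A" using source[OF t] norm_ge_zero order_trans by blast
  have "w t x \<bullet> e - (P + A * t) \<le> 0"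
  proof (rule max_principle_nonpos[OF transport_diffusion_diff[OF
          transport_diffusion_bounded_linear[OF bounded_linear_inner_left sol, of e]
          transport_diffusion_affine[of \<nu> \<tau> b A P]] \<open>0 \<le> \<nu>\<close> drift _ _ _ t])
    show "w t x \<bullet> e - (P + A * t) \<le> K - P" if "t \<in> {0..\<tau>}" for t x
    proof -
      have "0 \<le> A * t" using \<open>0 \<le> A\<close> that by simp
      then show ?thesis using order_trans[OF component bound[OF that], of x] by linarith
    qed
    show "S t x \<bullet> e - A - advect (b t x - b t x) (\<lambda>i. 0) \<le> 0" if "t \<in> {0..\<tau>}" for t x
      using order_trans[OF component source[OF that]] by (simp add: advect_def)
    show "w 0 x \<bullet> e - (P + A * 0) \<le> 0" for x
      using order_trans[OF component init] by simp
  qed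
  moreover have "w t x \<bullet> e = norm (w t x)"
    by (cases "w t x = 0") (simp_all add: e_def sgn_div_norm dot_square_norm power2_eq_square)
  ultimately show ?thesis by simp
qed

context
  fixes \<nu> \<tau> B K :: real and b :: "real \<Rightarrow> 'x::euclidean_space \<Rightarrow> 'x"
    and S w :: "real \<Rightarrow> 'x \<Rightarrow> 'b::real_inner" and w1 w2
  assumes sol: "transport_diffusion \<nu> \<tau> b S w w1 w2" and nu_nonneg: "0 \<le> \<nu>"
    and drift_bounded: "\<And>t x. t \<in> {0..\<tau>} \<Longrightarrow> norm (b t x) \<le> B"
    and sol_bounded: "\<And>t x. t \<in> {0..\<tau>} \<Longrightarrow> norm (w t x) \<le> K"
begin

lemma fdiff_sol_bounded: "t \<in> {0..\<tau>} \<Longrightarrow> norm (fdiff a (w t) x) \<le> 2 * K"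
  using norm_triangle_ineq4[of "w t (x + a)" "w t x"] sol_bounded[of t x] sol_bounded[of t "x + a"]
  by (simp add: fdiff_def)

lemma transport_diffusion_fdiff_le:
  assumes source: "\<And>t x. t \<in> {0..\<tau>} \<Longrightarrow> norm (fdiff a (S t) x) \<le> \<sigma>"
    and drift: "\<And>t x. t \<in> {0..\<tau>} \<Longrightarrow> norm (fdiff a (b t) x) \<le> D"
    and grad: "\<And>t x i. t \<in> {0..\<tau>} \<Longrightarrow> i \<in> Basis \<Longrightarrow> norm (w1 i t x) \<le> G"
    and init: "\<And>x. norm (fdiff a (w 0) x) \<le> P" and t: "t \<in> {0..\<tau>}"
  shows "norm (fdiff a (w t) x) \<le> P + (\<sigma> + real DIM('x) * (D * G)) * t"
proof (rule transport_diffusion_norm_le[OF transport_diffusion_fdiff[OF sol] nu_nonneg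
      drift_bounded fdiff_sol_bounded _ init t])
  fix t x assume t: "t \<in> {0..\<tau>}"
  show "norm (fdiff a (S t) x - advect (fdiff a (b t) x) (\<lambda>i. w1 i t x))
      \<le> \<sigma> + real DIM('x) * (D * G)"
    using t by (intro order_trans[OF norm_triangle_ineq4] add_mono source norm_advect_le drift grad)
qed

lemma transport_diffusion_dir_deriv_le:
  assumes source: "\<And>s t x. 0 < s \<Longrightarrow> t \<in> {0..\<tau>} \<Longrightarrow> norm (fdiff (s *\<^sub>R i) (S t) x) \<le> \<sigma> * s"
    and drift: "\<And>s t x. 0 < s \<Longrightarrow> t \<in> {0..\<tau>} \<Longrightarrow> norm (fdiff (s *\<^sub>R i) (b t) x) \<le> D * s"
    and grad: "\<And>t x i. t \<in> {0..\<tau>} \<Longrightarrow> i \<in> Basis \<Longrightarrow> norm (w1 i t x) \<le> G"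
    and init: "\<And>s x. 0 < s \<Longrightarrow> norm (fdiff (s *\<^sub>R i) (w 0) x) \<le> P * s"
    and t: "t \<in> {0..\<tau>}" and i: "i \<in> Basis"
  shows "norm (w1 i t x) \<le> P + (\<sigma> + real DIM('x) * (D * G)) * t"
proof (rule norm_dir_deriv_le[OF transport_diffusionD(3)[OF sol t i]])
  fix s :: real assume "0 < s"
  then have "norm (fdiff (s *\<^sub>R i) (w t) x) \<le> P * s + (\<sigma> * s + real DIM('x) * (D * s * G)) * t"
    by (intro transport_diffusion_fdiff_le source drift grad init t)
  also have "\<dots> = (P + (\<sigma> + real DIM('x) * (D * G)) * t) * s" by (simp add: algebra_simps)
  finally show "norm (fdiff (s *\<^sub>R i) (w t) x) \<le> (P + (\<sigma> + real DIM('x) * (D * G)) * t) * s" .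
qed

lemma transport_diffusion_fdiff_fdiff_le:
  assumes source: "\<And>t x. t \<in> {0..\<tau>} \<Longrightarrow> norm (fdiff c (fdiff a (S t)) x) \<le> \<sigma>"
    and drift: "\<And>t x. t \<in> {0..\<tau>} \<Longrightarrow> norm (fdiff a (b t) x) \<le> Da"
      "\<And>t x. t \<in> {0..\<tau>} \<Longrightarrow> norm (fdiff c (b t) x) \<le> Dc"
      "\<And>t x. t \<in> {0..\<tau>} \<Longrightarrow> norm (fdiff c (fdiff a (b t)) x) \<le> D2"
    and grad: "\<And>t x i. t \<in> {0..\<tau>} \<Longrightarrow> i \<in> Basis \<Longrightarrow> norm (w1 i t x) \<le> G"
      "\<And>t x i. t \<in> {0..\<tau>} \<Longrightarrow> i \<in> Basis \<Longrightarrow> norm (fdiff a (w1 i t) x) \<le> Ga"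
      "\<And>t x i. t \<in> {0..\<tau>} \<Longrightarrow> i \<in> Basis \<Longrightarrow> norm (fdiff c (w1 i t) x) \<le> Gc"
    and init: "\<And>x. norm (fdiff c (fdiff a (w 0)) x) \<le> P" and t: "t \<in> {0..\<tau>}"
  shows "norm (fdiff c (fdiff a (w t)) x)
      \<le> P + (\<sigma> + real DIM('x) * (Da * Gc + Dc * Ga + D2 * G)) * t"
proof (rule transport_diffusion_norm_le[OF
      transport_diffusion_fdiff[OF transport_diffusion_fdiff[OF sol, of a], of c]
      nu_nonneg drift_bounded _ _ init t])
  fix t x assume t: "t \<in> {0..\<tau>}"
  show "norm (fdiff c (fdiff a (w t)) x) \<le> 2 * K + 2 * K"
    unfolding fdiff_def[of c] using t
    by (intro order_trans[OF norm_triangle_ineq4] add_mono fdiff_sol_bounded)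
  have "fdiff c (\<lambda>x. fdiff a (S t) x - advect (fdiff a (b t) x) (\<lambda>i. w1 i t x)) x
        - advect (fdiff c (\<lambda>x. b t (x + a)) x) (\<lambda>i. fdiff a (w1 i t) x)
      = fdiff c (fdiff a (S t)) x - (advect (fdiff a (b t) (x + c)) (\<lambda>i. fdiff c (w1 i t) x)
        + advect (fdiff c (b t) (x + a)) (\<lambda>i. fdiff a (w1 i t) x)
        + advect (fdiff c (fdiff a (b t)) x) (\<lambda>i. w1 i t x))"
    unfolding fdiff_def advect_diff_left advect_diff_right by (simp add: algebra_simps)
  also have "norm \<dots> \<le> \<sigma> + (real DIM('x) * (Da * Gc) + real DIM('x) * (Dc * Ga)
      + real DIM('x) * (D2 * G))"
    using t
    by (intro order_trans[OF norm_triangle_ineq4] add_mono norm_triangle_le source norm_advect_le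
        drift grad)
  finally show "norm (fdiff c (\<lambda>x. fdiff a (S t) x - advect (fdiff a (b t) x) (\<lambda>i. w1 i t x)) x
        - advect (fdiff c (\<lambda>x. b t (x + a)) x) (\<lambda>i. fdiff a (w1 i t) x))
      \<le> \<sigma> + real DIM('x) * (Da * Gc + Dc * Ga + D2 * G)"
    by (simp add: distrib_left)
qed

lemma transport_diffusion_second_dir_deriv_le:
  assumes source: "\<And>r s t x. 0 < r \<Longrightarrow> 0 < s \<Longrightarrow> t \<in> {0..\<tau>} \<Longrightarrow>
        norm (fdiff (r *\<^sub>R j) (fdiff (s *\<^sub>R i) (S t)) x) \<le> \<sigma> * r * s"
    and drift: "\<And>s t x k. 0 < s \<Longrightarrow> t \<in> {0..\<tau>} \<Longrightarrow> k \<in> Basis \<Longrightarrow> norm (fdiff (s *\<^sub>R k) (b t) x) \<le> D * s"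
      "\<And>r s t x. 0 < r \<Longrightarrow> 0 < s \<Longrightarrow> t \<in> {0..\<tau>} \<Longrightarrow>
        norm (fdiff (r *\<^sub>R j) (fdiff (s *\<^sub>R i) (b t)) x) \<le> D2 * r * s"
    and grad: "\<And>t x k. t \<in> {0..\<tau>} \<Longrightarrow> k \<in> Basis \<Longrightarrow> norm (w1 k t x) \<le> G"
      "\<And>s t x k l. 0 < s \<Longrightarrow> t \<in> {0..\<tau>} \<Longrightarrow> k \<in> Basis \<Longrightarrow> l \<in> Basis \<Longrightarrow>
        norm (fdiff (s *\<^sub>R l) (w1 k t) x) \<le> H * s"
    and init: "\<And>r s x. 0 < r \<Longrightarrow> 0 < s \<Longrightarrow> norm (fdiff (r *\<^sub>R j) (fdiff (s *\<^sub>R i) (w 0)) x) \<le> P * r * s"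
    and deriv2: "has_dir_deriv (w1 i t) j w2'" and t: "t \<in> {0..\<tau>}"
    and i: "i \<in> Basis" and j: "j \<in> Basis"
  shows "norm (w2' x) \<le> P + (\<sigma> + real DIM('x) * (2 * (D * H) + D2 * G)) * t"
proof (rule norm_second_dir_deriv_le[OF transport_diffusionD(3)[OF sol t i] deriv2])
  fix r s :: real assume "0 < r" "0 < s"
  then have "norm (fdiff (r *\<^sub>R j) (fdiff (s *\<^sub>R i) (w t)) x) \<le> P * r * s
      + (\<sigma> * r * s + real DIM('x) * ((D * s) * (H * r) + (D * r) * (H * s) + (D2 * r * s) * G)) * t"
    by (intro transport_diffusion_fdiff_fdiff_le source drift grad init t i j)
  also have "\<dots> = (P + (\<sigma> + real DIM('x) * (2 * (D * H) + D2 * G)) * t) * r * s"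
    by (simp add: algebra_simps)
  finally show "norm (fdiff (r *\<^sub>R j) (fdiff (s *\<^sub>R i) (w t)) x)
      \<le> (P + (\<sigma> + real DIM('x) * (2 * (D * H) + D2 * G)) * t) * r * s" .
qed

end

section \<open>Absorption and continuation\<close>

lemma bound_by_absorption:
  fixes \<phi> :: "'z \<Rightarrow> real"
  assumes bdd: "\<And>z. z \<in> Z \<Longrightarrow> \<phi> z \<le> C" and "\<theta> < 1"
    and step: "\<And>U z. (\<And>z. z \<in> Z \<Longrightarrow> \<phi> z \<le> U) \<Longrightarrow> z \<in> Z \<Longrightarrow> \<phi> z \<le> a + \<theta> * U"
    and z: "z \<in> Z"
  shows "\<phi> z \<le> a / (1 - \<theta>)"
proof -
  define U where "U = (SUP z\<in>Z. \<phi> z)"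
  have upper: "\<phi> z \<le> U" if "z \<in> Z" for z
    unfolding U_def using that bdd by (intro cSUP_upper bdd_aboveI2)
  have "\<phi> y \<le> a + \<theta> * U" if "y \<in> Z" for y using step[OF upper that] .
  then have "(SUP z\<in>Z. \<phi> z) \<le> a + \<theta> * U" using z by (intro cSUP_least) auto
  then have "U \<le> a + \<theta> * U" by (fold U_def)
  then have "U \<le> a / (1 - \<theta>)" using \<open>\<theta> < 1\<close> by (simp add: field_simps)
  with upper[OF z] show ?thesis by simp
qed

lemma bound_by_continuation:
  fixes \<phi> :: "'z \<Rightarrow> real \<Rightarrow> real"
  assumes init: "\<And>z. z \<in> Z \<Longrightarrow> \<phi> z 0 \<le> a"
    and "0 < \<delta>"
    and near: "\<And>z s t. z \<in> Z \<Longrightarrow> s \<in> {0..\<tau>} \<Longrightarrow> t \<in> {0..\<tau>} \<Longrightarrow>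
        \<bar>t - s\<bar> < \<delta> \<Longrightarrow> \<phi> z t \<le> \<phi> z s + (b - a)"
    and step: "\<And>r z t. r \<in> {0..\<tau>} \<Longrightarrow> (\<And>z t. z \<in> Z \<Longrightarrow> t \<in> {0..r} \<Longrightarrow> \<phi> z t \<le> b) \<Longrightarrow>
        z \<in> Z \<Longrightarrow> t \<in> {0..r} \<Longrightarrow> \<phi> z t \<le> a"
    and z: "z \<in> Z" and t: "t \<in> {0..\<tau>}"
  shows "\<phi> z t \<le> a"
proof -
  define h where "h = \<delta> / 2"
  have h: "0 < h" "h < \<delta>" using \<open>0 < \<delta>\<close> by (auto simp: h_def)
  have "\<forall>z\<in>Z. \<forall>t\<in>{0..min \<tau> (real m * h)}. \<phi> z t \<le> a" for m
  proof (induction m)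
    case 0
    then show ?case using init by auto
  next
    case (Suc m)
    have "\<phi> z t \<le> b" if z: "z \<in> Z" and t: "t \<in> {0..min \<tau> (real (Suc m) * h)}" for z t
    proof -
      define s where "s = min t (real m * h)"
      have s: "s \<in> {0..min \<tau> (real m * h)}" using t h by (auto simp: s_def)
      moreover have "t \<le> real m * h + h" using t by (simp add: distrib_right)
      then have "\<bar>t - s\<bar> < \<delta>" using h by (auto simp: s_def)
      ultimately have "\<phi> z t \<le> \<phi> z s + (b - a)" using t by (intro near z) auto
      moreover have "\<phi> z s \<le> a" using Suc.IH s z by blast
      ultimately show ?thesis by simp
    qed
    then show ?case
      using t h by (intro ballI step[of "min \<tau> (real (Suc m) * h)"]) auto
  qed
  moreover obtain m where "\<tau> \<le> real m * h" using ex_less_of_nat_mult[OF h(1), of \<tau>] less_imp_le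
    by blast
  ultimately show ?thesis using z t by (metis min.absorb1)
qed

section \<open>Functions with bounded derivatives\<close>

definition pds_bounded_by :: "nat \<Rightarrow> real \<Rightarrow> ('x::euclidean_space \<Rightarrow> 'b::real_normed_vector) \<Rightarrow> bool"
  where
  "pds_bounded_by l C u \<longleftrightarrow> has_pds_upto l u \<and>
     (\<forall>\<alpha> x. set \<alpha> \<subseteq> Basis \<and> length \<alpha> \<le> l \<longrightarrow> norm (pds \<alpha> u x) \<le> C)"

lemma has_dir_deriv_imp_pd: "has_dir_deriv u i u' \<Longrightarrow> pd i u = u'"
  unfolding pd_def by (rule ext) (intro vector_derivative_at has_dir_derivD)

lemma has_pds_upto_dir_deriv:
  assumes "has_pds_upto l u" "set \<alpha> \<subseteq> Basis" "i \<in> Basis" "length \<alpha> < l"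
  shows "has_dir_deriv (pds \<alpha> u) i (pds (i # \<alpha>) u)"
  using assms by (simp add: has_pds_upto_def has_dir_deriv_def)

lemma pds_bounded_by_dir_deriv:
  "pds_bounded_by l C u \<Longrightarrow> set \<alpha> \<subseteq> Basis \<Longrightarrow> i \<in> Basis \<Longrightarrow> length \<alpha> < l \<Longrightarrow>
    has_dir_deriv (pds \<alpha> u) i (pds (i # \<alpha>) u)"
  unfolding pds_bounded_by_def using has_pds_upto_dir_deriv by blast

lemma norm_pds_le:
  "pds_bounded_by l C u \<Longrightarrow> set \<alpha> \<subseteq> Basis \<Longrightarrow> length \<alpha> \<le> l \<Longrightarrow> norm (pds \<alpha> u x) \<le> C"
  by (simp add: pds_bounded_by_def)

lemma pds_bounded_by_nonneg:
  assumes "pds_bounded_by l C u"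
  shows "0 \<le> C"
proof -
  have "norm (pds [] u 0) \<le> C" by (rule norm_pds_le[OF assms]) auto
  then show ?thesis using norm_ge_zero order_trans by blast
qed

lemma pds_bounded_by_mono: "pds_bounded_by l C u \<Longrightarrow> C \<le> C' \<Longrightarrow> pds_bounded_by l C' u"
  unfolding pds_bounded_by_def by (meson order_trans)

lemma norm_fdiff_pds_le:
  assumes "pds_bounded_by l C u" "set \<alpha> \<subseteq> Basis" "i \<in> Basis" "length \<alpha> < l"
  shows "norm (fdiff (s *\<^sub>R i) (pds \<alpha> u) x) \<le> C * \<bar>s\<bar>"
  using assms by (intro norm_fdiff_le[OF pds_bounded_by_dir_deriv] norm_pds_le) auto

lemma norm_fdiff_fdiff_pds_le:
  assumes "pds_bounded_by l C u" "set \<alpha> \<subseteq> Basis" "i \<in> Basis" "j \<in> Basis" "Suc (length \<alpha>) < l"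
  shows "norm (fdiff (r *\<^sub>R j) (fdiff (s *\<^sub>R i) (pds \<alpha> u)) x) \<le> C * \<bar>r\<bar> * \<bar>s\<bar>"
  using assms
  by (intro norm_fdiff_fdiff_le[OF pds_bounded_by_dir_deriv pds_bounded_by_dir_deriv] norm_pds_le)
    auto

lemma norm_fdiff_le_of_pds_bounded_by:
  fixes u :: "'x::euclidean_space \<Rightarrow> 'b::real_normed_vector"
  assumes u: "pds_bounded_by l C u" and "1 \<le> l"
  shows "norm (fdiff a u x) \<le> real DIM('x) * C * norm a"
  using assms
  by (intro norm_fdiff_le_of_bounded_partials[where u'="\<lambda>i. pds [i] u"] norm_pds_le[OF u]
      pds_bounded_by_dir_deriv[OF u, of "[]", unfolded pds.simps(1)]) auto

lemma norm_fdiff_fdiff_le_of_pds_bounded_by: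
  fixes u :: "'x::euclidean_space \<Rightarrow> 'b::real_normed_vector"
  assumes u: "pds_bounded_by l C u" and "2 \<le> l"
  shows "norm (fdiff c (fdiff a u) x) \<le> (real DIM('x))\<^sup>2 * C * norm a * norm c"
  using assms
  by (intro norm_fdiff_fdiff_le_of_bounded_partials[where u'="\<lambda>i. pds [i] u"
        and u''="\<lambda>j i. pds [j, i] u"]
      norm_pds_le[OF u] pds_bounded_by_dir_deriv[OF u, of "[]", unfolded pds.simps(1)]
      pds_bounded_by_dir_deriv[OF u]) auto

lemma Basis_lists_length_le_1:
  assumes "set \<alpha> \<subseteq> Basis" "length \<alpha> \<le> 1"
  obtains "\<alpha> = []" | i where "i \<in> Basis" "\<alpha> = [i]"
  using assms by (cases \<alpha>) auto

section \<open>Hoelder spaces\<close>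

lemma Cb_hoelder_pds_upto: "Cb_hoelder \<beta> l a b u \<Longrightarrow> t \<in> {a..b} \<Longrightarrow> has_pds_upto l (u t)"
  by (simp add: Cb_hoelder_def)

lemma Cb_hoelder_dir_deriv:
  "Cb_hoelder \<beta> l a b u \<Longrightarrow> t \<in> {a..b} \<Longrightarrow> set \<alpha> \<subseteq> Basis \<Longrightarrow> i \<in> Basis \<Longrightarrow> length \<alpha> < l \<Longrightarrow>
    has_dir_deriv (pds \<alpha> (u t)) i (pds (i # \<alpha>) (u t))"
  by (intro has_pds_upto_dir_deriv Cb_hoelder_pds_upto)

lemma Cb_hoelder_continuous_on:
  "Cb_hoelder \<beta> l a b u \<Longrightarrow> set \<alpha> \<subseteq> Basis \<Longrightarrow> length \<alpha> \<le> l \<Longrightarrow>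
    continuous_on ({a..b} \<times> UNIV) (\<lambda>(t, x). pds \<alpha> (u t) x)"
  by (simp add: Cb_hoelder_def)

lemma Cb_hoelder_continuous_on_time:
  assumes "Cb_hoelder \<beta> l a b u" "set \<alpha> \<subseteq> Basis" "length \<alpha> \<le> l"
  shows "continuous_on {a..b} (\<lambda>t. pds \<alpha> (u t) x)"
  using continuous_on_compose2[OF Cb_hoelder_continuous_on[OF assms], of "{a..b}" "\<lambda>t. (t, x)"]
  by (force intro!: continuous_intros)

lemma Cb_hoelder_subinterval:
  assumes u: "Cb_hoelder \<beta> l a b u" and "b' \<le> b"
  shows "Cb_hoelder \<beta> l a b' u"
proof -
  have interval: "{a..b'} \<subseteq> {a..b}" using \<open>b' \<le> b\<close> by auto
  then have strip: "{a..b'} \<times> (UNIV :: 'a set) \<subseteq> {a..b} \<times> UNIV" by auto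
  have "bounded ((\<lambda>(t, x). pds \<alpha> (u t) x) ` ({a..b'} \<times> UNIV))"
    if "set \<alpha> \<subseteq> Basis" "length \<alpha> \<le> l" for \<alpha>
    using u that bounded_subset[OF _ image_mono[OF strip]] unfolding Cb_hoelder_def by blast
  moreover have "continuous_on ({a..b'} \<times> UNIV) (\<lambda>(t, x). pds \<alpha> (u t) x)"
    if "set \<alpha> \<subseteq> Basis" "length \<alpha> \<le> l" for \<alpha>
    using Cb_hoelder_continuous_on[OF u that] strip by (rule continuous_on_subset)
  ultimately show ?thesis
    using u interval unfolding Cb_hoelder_def by (meson subsetD)
qed

lemma Cb_hoelder_pds_bounded_by:
  fixes u :: "real \<Rightarrow> 'x::euclidean_space \<Rightarrow> 'b::real_normed_vector"
  assumes u: "Cb_hoelder \<beta> l a b u"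
  obtains C where "0 \<le> C" "\<And>t. t \<in> {a..b} \<Longrightarrow> pds_bounded_by l C (u t)"
proof -
  let ?I = "{\<alpha> :: 'x list. set \<alpha> \<subseteq> Basis \<and> length \<alpha> \<le> l}"
  have "finite ?I" by (rule finite_lists_length_le) simp
  have "\<exists>c. \<forall>t\<in>{a..b}. \<forall>x. norm (pds \<alpha> (u t) x) \<le> c" if "\<alpha> \<in> ?I" for \<alpha>
    using u that unfolding Cb_hoelder_def bounded_iff by fastforce
  then obtain c where c_bound: "\<And>\<alpha> t x. \<alpha> \<in> ?I \<Longrightarrow> t \<in> {a..b} \<Longrightarrow> norm (pds \<alpha> (u t) x) \<le> c \<alpha>" by metis
  define C where "C = (\<Sum>\<alpha>\<in>?I. \<bar>c \<alpha>\<bar>)"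
  have "norm (pds \<alpha> (u t) x) \<le> C" if "\<alpha> \<in> ?I" "t \<in> {a..b}" for \<alpha> t x
    using c_bound[OF that, of x] member_le_sum[OF \<open>\<alpha> \<in> ?I\<close>, of "\<lambda>\<alpha>. \<bar>c \<alpha>\<bar>"] \<open>finite ?I\<close>
    unfolding C_def by force
  moreover have "0 \<le> C" by (simp add: C_def sum_nonneg)
  ultimately show thesis using that Cb_hoelder_pds_upto[OF u] by (simp add: pds_bounded_by_def)
qed

lemma Cb_hoelder_time_equicontinuous_on:
  fixes u :: "real \<Rightarrow> 'x::euclidean_space \<Rightarrow> 'b::real_normed_vector"
  assumes u: "Cb_hoelder \<beta> l a b u" and "0 < \<beta>"
  shows "time_equicontinuous_on {a..b} u"
  unfolding time_equicontinuous_on_def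
proof (intro allI impI)
  fix e :: real assume "0 < e"
  obtain C where hoelder: "\<And>s t x. s \<in> {a..b} \<Longrightarrow> t \<in> {a..b} \<Longrightarrow>
      norm (u t x - u s x) \<le> C * \<bar>t - s\<bar> powr (\<beta> / 2)"
    using u unfolding Cb_hoelder_def by blast
  define D where "D = \<bar>C\<bar> + 1"
  define d where "d = (e / D) powr (2 / \<beta>)"
  have "0 < D" "C \<le> D" by (auto simp: D_def)
  have "norm (u t x - u s x) \<le> e" if "s \<in> {a..b}" "t \<in> {a..b}" "\<bar>t - s\<bar> < d" for s t x
  proof -
    have "norm (u t x - u s x) \<le> C * \<bar>t - s\<bar> powr (\<beta> / 2)" using that by (intro hoelder)
    also have "\<dots> \<le> D * d powr (\<beta> / 2)"
      using \<open>0 < D\<close> \<open>C \<le> D\<close> that \<open>0 < \<beta>\<close> by (intro mult_mono powr_mono2) auto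
    also have "\<dots> = e" using \<open>0 < e\<close> \<open>0 < D\<close> \<open>0 < \<beta>\<close> by (simp add: d_def powr_powr)
    finally show ?thesis .
  qed
  moreover have "0 < d" using \<open>0 < e\<close> \<open>0 < D\<close> by (simp add: d_def)
  ultimately show "\<exists>d>0. \<forall>s\<in>{a..b}. \<forall>t\<in>{a..b}. \<bar>t - s\<bar> < d \<longrightarrow> (\<forall>x. norm (u t x - u s x) \<le> e)"
    by blast
qed

lemma Cb_hoelder_pds_time_equicontinuous_on:
  fixes u :: "real \<Rightarrow> 'x::euclidean_space \<Rightarrow> 'b::real_normed_vector"
  assumes u: "Cb_hoelder \<beta> l a b u" and "0 < \<beta>" and "set \<alpha> \<subseteq> Basis" "length \<alpha> < l"
  shows "time_equicontinuous_on {a..b} (\<lambda>t. pds \<alpha> (u t))"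
  using assms(3,4)
proof (induction \<alpha>)
  case Nil
  then show ?case using Cb_hoelder_time_equicontinuous_on[OF u \<open>0 < \<beta>\<close>] by simp
next
  case (Cons i \<alpha>)
  obtain C where bounded: "\<And>t. t \<in> {a..b} \<Longrightarrow> pds_bounded_by l C (u t)"
    using Cb_hoelder_pds_bounded_by[OF u] by blast
  show ?case
  proof (rule time_equicontinuous_on_dir_deriv[OF Cons.IH])
    show "has_dir_deriv (pds (i # \<alpha>) (u t)) i (pds (i # i # \<alpha>) (u t))"
      and "has_dir_deriv (pds \<alpha> (u t)) i (pds (i # \<alpha>) (u t))" if "t \<in> {a..b}" for t
      using that Cons.prems by (intro Cb_hoelder_dir_deriv[OF u]; simp)+
    show "norm (pds (i # i # \<alpha>) (u t) x) \<le> C" if "t \<in> {a..b}" for t x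
      using that Cons.prems by (intro norm_pds_le[OF bounded]) auto
  qed (use Cons.prems in auto)
qed

section \<open>The pathwise equation\<close>

definition burgers_drift :: "(real \<Rightarrow> real^'n \<Rightarrow> real^'n \<Rightarrow> real^'n) \<Rightarrow> real \<Rightarrow>
    (real \<Rightarrow> real^'n \<Rightarrow> real^'n) \<Rightarrow> real \<Rightarrow> real^'n \<Rightarrow> real^'n" where
  "burgers_drift f \<nu> y s x = \<nu> *\<^sub>R lap (y s) x - adv (y s) x + f s x (y s x)"

definition burgers_path_sol :: "real \<Rightarrow> (real \<Rightarrow> real^'n \<Rightarrow> real^'n \<Rightarrow> real^'n) \<Rightarrow> (real^'n \<Rightarrow> real^'n) \<Rightarrow>
    (real \<Rightarrow> real^'n \<Rightarrow> real^'n) \<Rightarrow> real \<Rightarrow> nat \<Rightarrow> real \<Rightarrow> (real \<Rightarrow> real^'n \<Rightarrow> real^'n) \<Rightarrow> bool" where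
  "burgers_path_sol \<beta> f h \<eta> \<tau> l \<nu> y \<longleftrightarrow> Cb_hoelder \<beta> l 0 \<tau> y \<and>
     (\<forall>t\<in>{0..\<tau>}. \<forall>x. y t x = h x + integral {0..t} (\<lambda>s. burgers_drift f \<nu> y s x) + \<eta> t x)"

lemma burgers_path_sol_subinterval:
  assumes "burgers_path_sol \<beta> f h \<eta> \<tau> l \<nu> y" "\<tau>' \<le> \<tau>"
  shows "burgers_path_sol \<beta> f h \<eta> \<tau>' l \<nu> y"
proof -
  have "{0..\<tau>'} \<subseteq> {0..\<tau>}" using assms(2) by auto
  then show ?thesis
    using assms Cb_hoelder_subinterval[of \<beta> l 0 \<tau> y \<tau>'] unfolding burgers_path_sol_def by blast
qed

lemma adv_eq_advect: "adv u x = advect (u x) (\<lambda>k. pd k u x)"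
  by (simp add: adv_def advect_def)

lemma continuous_on_burgers_drift:
  assumes f_cont: "continuous_on ({0..\<tau>} \<times> UNIV) (\<lambda>(t, x, z). f t x z)"
    and y: "Cb_hoelder \<beta> l 0 \<tau> y" and l: "1 \<le> l" "\<nu> \<noteq> 0 \<Longrightarrow> 2 \<le> l"
  shows "continuous_on {0..\<tau>} (\<lambda>s. burgers_drift f \<nu> y s x)"
proof -
  have y_cont: "continuous_on {0..\<tau>} (\<lambda>s. y s x)"
    using Cb_hoelder_continuous_on_time[OF y, of "[]"] by simp
  have grad_cont: "continuous_on {0..\<tau>} (\<lambda>s. pd i (y s) x)" if "i \<in> Basis" for i
    using Cb_hoelder_continuous_on_time[OF y, of "[i]"] that l by simp
  have "continuous_on {0..\<tau>} (\<lambda>s. pd i (pd i (y s)) x)" if "i \<in> Basis" "\<nu> \<noteq> 0" for i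
    using Cb_hoelder_continuous_on_time[OF y, of "[i, i]"] that l by simp
  then have "continuous_on {0..\<tau>} (\<lambda>s. \<nu> *\<^sub>R lap (y s) x)"
    unfolding lap_def by (cases "\<nu> = 0") (auto intro!: continuous_intros)
  moreover have "continuous_on {0..\<tau>} (\<lambda>s. f s x (y s x))"
    using continuous_on_compose2[OF f_cont, of "{0..\<tau>}" "\<lambda>s. (s, (x, y s x))"] y_cont
    by (force intro!: continuous_intros)
  moreover have "continuous_on {0..\<tau>} (\<lambda>s. adv (y s) x)"
    unfolding adv_def by (intro continuous_intros y_cont grad_cont)
  ultimately show ?thesis unfolding burgers_drift_def
    by (intro continuous_on_add continuous_on_diff)
qed

text \<open>The condition \<open>100 \<tau> R\<^sup>3 \<le> 1\<close> makes the interval short enough for all terms that are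
  quadratic in the solution to be absorbed.\<close>

locale burgers_path =
  fixes \<tau> R N L \<beta> \<nu>0 :: real
    and f :: "real \<Rightarrow> real^'n \<Rightarrow> real^'n \<Rightarrow> real^'n"
    and h :: "real^'n \<Rightarrow> real^'n"
    and \<eta> :: "real \<Rightarrow> real^'n \<Rightarrow> real^'n"
  assumes tau: "0 \<le> \<tau>" and R1: "1 \<le> R" and small: "100 * \<tau> * R^3 \<le> 1"
    and nu0_le: "\<nu>0 \<le> R" and dim_le: "real DIM(real^'n) \<le> R" and beta: "0 < \<beta>" "\<beta> < 2"
    and f_cont: "continuous_on ({0..\<tau>} \<times> UNIV) (\<lambda>(t, x, z). f t x z)"
    and f_pds: "t \<in> {0..\<tau>} \<Longrightarrow> pds_bounded_by 2 L (\<lambda>(x, z). f t x z)"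
    and L_le: "(real DIM((real^'n) \<times> (real^'n)))\<^sup>2 * L \<le> R"
    and h_pds: "pds_bounded_by 2 R h"
    and eta_hoelder: "Cb_hoelder \<beta> 4 0 \<tau> \<eta>"
    and eta_pds3: "t \<in> {0..\<tau>} \<Longrightarrow> pds_bounded_by 3 R (\<eta> t)"
    and eta_pds4: "t \<in> {0..\<tau>} \<Longrightarrow> pds_bounded_by 4 N (\<eta> t)"
begin

abbreviation "path_sol \<equiv> burgers_path_sol \<beta> f h \<eta> \<tau>"

lemma R_nonneg: "0 \<le> R"
  using R1 by simp

lemma powers_R_le: "R \<le> R^3" "R^2 \<le> R^3" "R \<le> R^2"
  using R1 power_increasing[of 1 3 R] power_increasing[of 2 3 R] power_increasing[of 1 2 R] by auto

lemma tau_R_small: "\<tau> * R \<le> 1 / 100" "\<tau> * R^2 \<le> 1 / 100" "\<tau> * R^3 \<le> 1 / 100"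
proof -
  show "\<tau> * R^3 \<le> 1 / 100" using small by simp
  moreover have "\<tau> * R \<le> \<tau> * R^3" "\<tau> * R^2 \<le> \<tau> * R^3"
    using tau powers_R_le by (auto intro!: mult_left_mono)
  ultimately show "\<tau> * R \<le> 1 / 100" "\<tau> * R^2 \<le> 1 / 100" by auto
qed

lemma norm_advect_le_R:
  fixes a :: "real^'n" and v :: "real^'n \<Rightarrow> real^'n"
  assumes "norm a \<le> A" "\<And>k. k \<in> Basis \<Longrightarrow> norm (v k) \<le> V"
  shows "norm (advect a v) \<le> R * (A * V)"
proof -
  have "0 \<le> A * V"
    using assms(1) assms(2)[OF SOME_Basis] norm_ge_zero order_trans
    by (blast intro: mult_nonneg_nonneg)
  then have "real DIM(real^'n) * (A * V) \<le> R * (A * V)" by (rule mult_right_mono[OF dim_le])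
  with norm_advect_le[OF assms] show ?thesis by (rule order_trans)
qed

lemma norm_scaleR_sum_Basis_le_R:
  fixes v :: "real^'n \<Rightarrow> real^'n"
  assumes "0 \<le> \<nu>" "\<nu> \<le> R" "\<And>k. k \<in> Basis \<Longrightarrow> norm (v k) \<le> V"
  shows "norm (\<nu> *\<^sub>R (\<Sum>k\<in>Basis. v k)) \<le> R * (R * V)"
proof -
  have "0 \<le> V" using assms(3)[OF SOME_Basis] norm_ge_zero order_trans by blast
  then have "norm (\<Sum>k\<in>Basis. v k) \<le> R * V"
    using sum_norm_bound[of Basis v V] assms(3) mult_right_mono[OF dim_le, of V] by fastforce
  then show ?thesis using assms(1,2) by (simp add: mult_mono')
qed

lemma forcing_bound:
  assumes t: "t \<in> {0..\<tau>}"
  shows "norm (f t x z) \<le> R"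
    and "norm (fdiff a (\<lambda>(x, z). f t x z) p) \<le> R * norm a"
    and "norm (fdiff c (fdiff a (\<lambda>(x, z). f t x z)) p) \<le> R * norm a * norm c"
proof -
  let ?n = "real DIM((real^'n) \<times> (real^'n))"
  have "1 \<le> ?n" using DIM_positive[where 'a="(real^'n) \<times> (real^'n)"] by linarith
  moreover have "0 \<le> L" by (rule pds_bounded_by_nonneg[OF f_pds[OF t]])
  ultimately have "L \<le> ?n * L" "?n * L \<le> ?n\<^sup>2 * L"
    using mult_right_mono[of 1 ?n L] mult_right_mono[of 1 ?n "?n * L"]
    by (auto simp: power2_eq_square)
  then have L_bounds: "L \<le> R" "?n * L \<le> R" using L_le by linarith+
  show "norm (f t x z) \<le> R"
    using norm_pds_le[OF f_pds[OF t], of "[]" "(x, z)"] L_bounds by simp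
  show "norm (fdiff a (\<lambda>(x, z). f t x z) p) \<le> R * norm a"
    using norm_fdiff_le_of_pds_bounded_by[OF f_pds[OF t], of a p]
      mult_right_mono[OF L_bounds(2), of "norm a"] by simp
  have "?n\<^sup>2 * L * norm a * norm c \<le> R * norm a * norm c"
    using L_le by (intro mult_right_mono) auto
  then show "norm (fdiff c (fdiff a (\<lambda>(x, z). f t x z)) p) \<le> R * norm a * norm c"
    using norm_fdiff_fdiff_le_of_pds_bounded_by[OF f_pds[OF t], of c a p] by simp
qed

lemma norm_pds_eta_le: "t \<in> {0..\<tau>} \<Longrightarrow> set \<alpha> \<subseteq> Basis \<Longrightarrow> length \<alpha> \<le> 3 \<Longrightarrow> norm (pds \<alpha> (\<eta> t) x) \<le> R"
  using norm_pds_le[OF eta_pds3] .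

definition source :: "real \<Rightarrow> (real \<Rightarrow> real^'n \<Rightarrow> real^'n) \<Rightarrow> real \<Rightarrow> real^'n \<Rightarrow> real^'n" where
  "source \<nu> y t x = f t x (y t x) + \<nu> *\<^sub>R lap (\<eta> t) x - advect (y t x) (\<lambda>k. pd k (\<eta> t) x)"

definition remainder :: "(real^'n) list \<Rightarrow> (real \<Rightarrow> real^'n \<Rightarrow> real^'n) \<Rightarrow> real \<Rightarrow> real^'n \<Rightarrow> real^'n"
  where
  "remainder \<alpha> y t x = pds \<alpha> (y t) x - pds \<alpha> (\<eta> t) x"

lemma remainder_initial: "path_sol l \<nu> y \<Longrightarrow> remainder [] y 0 = h"
  using tau unfolding burgers_path_sol_def remainder_def by auto

lemma remainder_dir_deriv:
  assumes y: "Cb_hoelder \<beta> l 0 \<tau> y" and t: "t \<in> {0..\<tau>}"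
    and "set \<alpha> \<subseteq> Basis" "i \<in> Basis" "length \<alpha> < l" "length \<alpha> < 4"
  shows "has_dir_deriv (remainder \<alpha> y t) i (remainder (i # \<alpha>) y t)"
  unfolding remainder_def[abs_def] using assms(3-6)
  by (intro has_dir_deriv_diff Cb_hoelder_dir_deriv[OF y t] Cb_hoelder_dir_deriv[OF eta_hoelder t])

lemma norm_pds_le_of_remainder:
  assumes "t \<in> {0..\<tau>}" "set \<alpha> \<subseteq> Basis" "length \<alpha> \<le> 3" "norm (remainder \<alpha> y t x) \<le> U"
  shows "norm (pds \<alpha> (y t) x) \<le> U + R"
  using norm_pds_eta_le[OF assms(1-3), of x] assms(4)
    norm_triangle_sub[of "pds \<alpha> (y t) x" "pds \<alpha> (\<eta> t) x"]
  unfolding remainder_def by simp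

lemma remainder_time_deriv:
  assumes sol: "path_sol l \<nu> y" and l: "1 \<le> l" "\<nu> \<noteq> 0 \<Longrightarrow> 2 \<le> l" and t: "t \<in> {0..\<tau>}"
  shows "((\<lambda>s. remainder [] y s x) has_vector_derivative burgers_drift f \<nu> y t x)
      (at t within {0..\<tau>})"
proof (rule has_vector_derivative_transform[OF t])
  have y: "Cb_hoelder \<beta> l 0 \<tau> y" using sol by (simp add: burgers_path_sol_def)
  show "remainder [] y s x = h x + integral {0..s} (\<lambda>s. burgers_drift f \<nu> y s x)"
    if "s \<in> {0..\<tau>}" for s
  proof -
    have "y s x = h x + integral {0..s} (\<lambda>s. burgers_drift f \<nu> y s x) + \<eta> s x"
      using sol that unfolding burgers_path_sol_def by blast
    then show ?thesis by (simp add: remainder_def)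
  qed
  show "((\<lambda>s. h x + integral {0..s} (\<lambda>s. burgers_drift f \<nu> y s x)) has_vector_derivative
      burgers_drift f \<nu> y t x) (at t within {0..\<tau>})"
    using has_vector_derivative_add[OF has_vector_derivative_const
        integral_has_vector_derivative[OF continuous_on_burgers_drift[OF f_cont y l] t]] by simp
qed

lemma remainder_transport_diffusion:
  assumes sol: "path_sol l \<nu> y" and l: "1 \<le> l" "\<nu> \<noteq> 0 \<Longrightarrow> 2 \<le> l"
  shows "transport_diffusion \<nu> \<tau> y (source \<nu> y) (remainder [] y)
      (\<lambda>i. remainder [i] y) (\<lambda>i. remainder [i, i] y)"
  unfolding transport_diffusion_def
proof (intro conjI impI ballI allI)
  have y: "Cb_hoelder \<beta> l 0 \<tau> y" using sol by (simp add: burgers_path_sol_def)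
  show "continuous_on ({0..\<tau>} \<times> UNIV) (\<lambda>(t, x). remainder [] y t x)"
    using Cb_hoelder_continuous_on[OF y, of "[]"] Cb_hoelder_continuous_on[OF eta_hoelder, of "[]"]
    unfolding case_prod_beta remainder_def by (intro continuous_on_diff) auto
  fix t assume t: "t \<in> {0..\<tau>}"
  have "burgers_drift f \<nu> y t x = \<nu> *\<^sub>R (\<Sum>i\<in>Basis. remainder [i, i] y t x)
      - advect (y t x) (\<lambda>i. remainder [i] y t x) + source \<nu> y t x" for x
    by (simp add: burgers_drift_def source_def lap_def adv_eq_advect remainder_def advect_diff_right
        sum_subtractf scaleR_diff_right)
  then show "((\<lambda>s. remainder [] y s x) has_vector_derivative
      \<nu> *\<^sub>R (\<Sum>i\<in>Basis. remainder [i, i] y t x)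
      - advect (y t x) (\<lambda>i. remainder [i] y t x) + source \<nu> y t x) (at t within {0..\<tau>})" for x
    using remainder_time_deriv[OF sol l t, of x] by simp
  fix i :: "real^'n" assume i: "i \<in> Basis"
  show "has_dir_deriv (remainder [] y t) i (remainder [i] y t)"
    using i l by (intro remainder_dir_deriv[OF y t]) auto
  show "has_dir_deriv (remainder [i] y t) i (remainder [i, i] y t)" if "0 < \<nu>"
    using i l that by (intro remainder_dir_deriv[OF y t]) auto
qed

lemma path_sol_bounded:
  assumes "path_sol l \<nu> y"
  obtains C where "0 \<le> C" "\<And>t. t \<in> {0..\<tau>} \<Longrightarrow> pds_bounded_by l C (y t)"
  using assms Cb_hoelder_pds_bounded_by unfolding burgers_path_sol_def by blast

lemma path_sol_norm_bounded:
  assumes "path_sol l \<nu> y"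
  obtains C where "\<And>t x. t \<in> {0..\<tau>} \<Longrightarrow> norm (y t x) \<le> C"
proof -
  obtain C where bounded: "\<And>t. t \<in> {0..\<tau>} \<Longrightarrow> pds_bounded_by l C (y t)"
    using path_sol_bounded[OF assms] by blast
  have "norm (y t x) \<le> C" if "t \<in> {0..\<tau>}" for t x
    using norm_pds_le[OF bounded[OF that], of "[]"] by simp
  then show thesis by (rule that)
qed

lemma norm_source_le:
  assumes t: "t \<in> {0..\<tau>}" and "0 \<le> \<nu>" "\<nu> \<le> R" and y: "norm (y t x) \<le> Y"
  shows "norm (source \<nu> y t x) \<le> R + R^3 + R^2 * Y"
proof -
  have "norm (pd k (\<eta> t) x) \<le> R" "norm (pd k (pd k (\<eta> t)) x) \<le> R" if "k \<in> Basis" for k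
    using norm_pds_eta_le[OF t, of "[k]"] norm_pds_eta_le[OF t, of "[k, k]"] that by auto
  then have "norm (source \<nu> y t x) \<le> R + R * (R * R) + R * (Y * R)"
    unfolding source_def lap_def using assms
    by (intro order_trans[OF norm_triangle_ineq4] order_trans[OF norm_triangle_ineq] add_mono
        forcing_bound norm_scaleR_sum_Basis_le_R norm_advect_le_R) auto
  then show ?thesis by (simp add: power2_eq_square power3_eq_cube mult_ac)
qed

lemma norm_fdiff_source_le:
  assumes t: "t \<in> {0..\<tau>}" and "0 \<le> \<nu>" "\<nu> \<le> R" and i: "i \<in> Basis" and "0 < s"
    and y: "\<And>x. norm (y t x) \<le> Y" and Dy: "\<And>x. norm (fdiff (s *\<^sub>R i) (y t) x) \<le> D * s"
  shows "norm (fdiff (s *\<^sub>R i) (source \<nu> y t) x) \<le> (R * (1 + D) + R^3 + R^2 * (Y + D)) * s"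
proof -
  let ?a = "s *\<^sub>R i"
  have eta: "norm (pd k (\<eta> t) x) \<le> R" "norm (fdiff ?a (pd k (\<eta> t)) x) \<le> R * s"
    "norm (fdiff ?a (pd k (pd k (\<eta> t))) x) \<le> R * s" if "k \<in> Basis" for k x
    using norm_pds_eta_le[OF t, of "[k]"] norm_fdiff_pds_le[OF eta_pds3[OF t], of "[k]" i s x]
      norm_fdiff_pds_le[OF eta_pds3[OF t], of "[k, k]" i s x] that i \<open>0 < s\<close> by auto
  have forcing: "norm (fdiff (?a, fdiff ?a (y t) x) (\<lambda>(x, z). f t x z) (x, y t x))
      \<le> R * (s + D * s)"
    using norm_Pair_le[of ?a "fdiff ?a (y t) x"] Dy[of x] i \<open>0 < s\<close> R_nonneg
    by (intro order_trans[OF forcing_bound(2)[OF t]] mult_left_mono) auto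
  have "fdiff ?a (source \<nu> y t) x = fdiff (?a, fdiff ?a (y t) x) (\<lambda>(x, z). f t x z) (x, y t x)
      + \<nu> *\<^sub>R (\<Sum>k\<in>Basis. fdiff ?a (pd k (pd k (\<eta> t))) x)
      - fdiff ?a (\<lambda>x. advect (y t x) (\<lambda>k. pd k (\<eta> t) x)) x"
    by (simp add: source_def fdiff_def lap_def sum_subtractf scaleR_diff_right)
  also have "norm \<dots> \<le> R * (s + D * s) + R * (R * (R * s)) + (R * (Y * (R * s)) + R * (D * s * R))"
    unfolding fdiff_advect using assms(2,3) eta forcing y Dy
    by (intro order_trans[OF norm_triangle_ineq4] norm_triangle_mono add_mono
        norm_scaleR_sum_Basis_le_R norm_advect_le_R) auto
  also have "\<dots> = (R * (1 + D) + R^3 + R^2 * (Y + D)) * s"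
    by (simp add: algebra_simps power2_eq_square power3_eq_cube)
  finally show ?thesis .
qed

lemma norm_fdiff_fdiff_source_le:
  assumes t: "t \<in> {0..\<tau>}" and "0 \<le> \<nu>" "\<nu> \<le> R" and ij: "i \<in> Basis" "j \<in> Basis" and "0 < r" "0 < s"
    and y: "\<And>x. norm (y t x) \<le> Y"
    and Dy: "\<And>k s x. k \<in> Basis \<Longrightarrow> 0 < s \<Longrightarrow> norm (fdiff (s *\<^sub>R k) (y t) x) \<le> D * s"
    and D2y: "\<And>x. norm (fdiff (r *\<^sub>R j) (fdiff (s *\<^sub>R i) (y t)) x) \<le> D2 * r * s"
  shows "norm (fdiff (r *\<^sub>R j) (fdiff (s *\<^sub>R i) (source \<nu> y t)) x)
    \<le> (R * ((1 + D)\<^sup>2 + D2) + R^2 * N + R^2 * (Y + 2 * D + D2)) * r * s"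
proof -
  let ?a = "s *\<^sub>R i" and ?c = "r *\<^sub>R j" and ?F = "\<lambda>(x, z). f t x z" and ?\<Phi> = "\<lambda>x. (x, y t x)"
  have eta: "norm (pd k (\<eta> t) x) \<le> R"
    "norm (fdiff ?a (pd k (\<eta> t)) x) \<le> R * s" "norm (fdiff ?c (pd k (\<eta> t)) x) \<le> R * r"
    "norm (fdiff ?c (fdiff ?a (pd k (\<eta> t))) x) \<le> R * r * s"
    "norm (fdiff ?c (fdiff ?a (pd k (pd k (\<eta> t)))) x) \<le> N * r * s" if "k \<in> Basis" for k x
    using norm_pds_eta_le[OF t, of "[k]"] norm_fdiff_pds_le[OF eta_pds3[OF t], of "[k]" i s x]
      norm_fdiff_pds_le[OF eta_pds3[OF t], of "[k]" j r x]
      norm_fdiff_fdiff_pds_le[OF eta_pds3[OF t], of "[k]" i j r s x]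
      norm_fdiff_fdiff_pds_le[OF eta_pds4[OF t], of "[k, k]" i j r s x] that ij \<open>0 < r\<close> \<open>0 < s\<close>
    by auto
  have "norm (fdiff (s *\<^sub>R k) ?\<Phi> x) \<le> (1 + D) * s" if "k \<in> Basis" "0 < s" for k s
    using norm_Pair_le[of "s *\<^sub>R k" "fdiff (s *\<^sub>R k) (y t) x"] Dy[OF that, of x] that
    by (simp add: fdiff_def algebra_simps)
  moreover have "norm (fdiff ?c (fdiff ?a ?\<Phi>) x) \<le> D2 * r * s"
    using D2y[of x] by (simp add: fdiff_def)
  ultimately have forcing: "norm (fdiff ?c (fdiff ?a (\<lambda>x. ?F (?\<Phi> x))) x)
      \<le> R * ((1 + D) * s * ((1 + D) * r) + D2 * r * s)"
    using forcing_bound(2,3)[OF t] ij \<open>0 < r\<close> \<open>0 < s\<close> R_nonneg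
    by (intro norm_fdiff_fdiff_compose_le[where F="?F"]) auto
  have "fdiff ?c (fdiff ?a (source \<nu> y t)) x = fdiff ?c (fdiff ?a (\<lambda>x. ?F (?\<Phi> x))) x
      + \<nu> *\<^sub>R (\<Sum>k\<in>Basis. fdiff ?c (fdiff ?a (pd k (pd k (\<eta> t)))) x)
      - fdiff ?c (fdiff ?a (\<lambda>x. advect (y t x) (\<lambda>k. pd k (\<eta> t) x))) x"
    by (simp add: source_def fdiff_def lap_def sum_subtractf scaleR_diff_right)
  also have "norm \<dots> \<le> R * ((1 + D) * s * ((1 + D) * r) + D2 * r * s) + R * (R * (N * r * s))
      + (R * (Y * (R * r * s)) + R * (D * r * (R * s)) + R * (D * s * (R * r))
         + R * (D2 * r * s * R))"
    unfolding fdiff_fdiff_advect using assms(2,3) eta forcing y Dy D2y ij \<open>0 < r\<close> \<open>0 < s\<close>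
    by (intro order_trans[OF norm_triangle_ineq4] norm_triangle_mono add_mono
        norm_scaleR_sum_Basis_le_R norm_advect_le_R) auto
  also have "\<dots> = (R * ((1 + D)\<^sup>2 + D2) + R^2 * N + R^2 * (Y + 2 * D + D2)) * r * s"
    by (simp add: algebra_simps power2_eq_square)
  finally show ?thesis .
qed

section \<open>A priori estimates uniform in the viscosity\<close>

lemma norm_fdiff_h_le: "i \<in> Basis \<Longrightarrow> 0 < s \<Longrightarrow> norm (fdiff (s *\<^sub>R i) h x) \<le> R * s"
  using norm_fdiff_pds_le[OF h_pds, of "[]" i s x] by simp

lemma norm_fdiff_fdiff_h_le:
  "i \<in> Basis \<Longrightarrow> j \<in> Basis \<Longrightarrow> 0 < r \<Longrightarrow> 0 < s \<Longrightarrow> norm (fdiff (r *\<^sub>R j) (fdiff (s *\<^sub>R i) h) x) \<le> R * r * s"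
  using norm_fdiff_fdiff_pds_le[OF h_pds, of "[]" i j r s x] by simp

lemma hessian_constants_le:
  assumes "0 \<le> U"
  shows "R * ((1 + 3 * R)\<^sup>2 + (U + R)) + R^2 * N + R^2 * (3 * R + 2 * (3 * R) + (U + R))
      + real DIM(real^'n) * (2 * (3 * R * U) + (U + R) * (2 * R))
    \<le> R^2 * N + 29 * R^3 + 10 * R^2 * U"
proof -
  have "R * ((1 + 3 * R)\<^sup>2 + (U + R)) + R^2 * (3 * R + 2 * (3 * R) + (U + R))
      = 19 * R^3 + 7 * R^2 + R + R^2 * U + R * U"
    by (simp add: algebra_simps power2_eq_square power3_eq_cube)
  moreover have "real DIM(real^'n) * (2 * (3 * R * U) + (U + R) * (2 * R))
      \<le> R * (2 * (3 * R * U) + (U + R) * (2 * R))"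
    using dim_le R_nonneg assms by (intro mult_right_mono) auto
  then have "real DIM(real^'n) * (2 * (3 * R * U) + (U + R) * (2 * R)) \<le> 8 * R^2 * U + 2 * R^3"
    by (simp add: algebra_simps power2_eq_square power3_eq_cube)
  moreover have "R * U \<le> R^2 * U" using powers_R_le assms by (intro mult_right_mono)
  ultimately show ?thesis using powers_R_le by linarith
qed

context
  fixes \<nu> y
  assumes sol: "path_sol 2 \<nu> y" and nu: "0 < \<nu>" "\<nu> \<le> \<nu>0"
begin

lemma nu_range: "0 \<le> \<nu>" "\<nu> \<le> R"
  using nu nu0_le by auto

lemma y_hoelder: "Cb_hoelder \<beta> 2 0 \<tau> y"
  using sol by (simp add: burgers_path_sol_def)

lemma viscous_transport_diffusion:
  "transport_diffusion \<nu> \<tau> y (source \<nu> y) (remainder [] y) (\<lambda>i. remainder [i] y)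
      (\<lambda>i. remainder [i, i] y)"
  by (rule remainder_transport_diffusion[OF sol]) auto

lemma remainder_bounded:
  obtains C where "\<And>t \<alpha> x. t \<in> {0..\<tau>} \<Longrightarrow> set \<alpha> \<subseteq> Basis \<Longrightarrow> length \<alpha> \<le> 2 \<Longrightarrow> norm (remainder \<alpha> y t x) \<le> C"
proof -
  obtain C where y: "\<And>t. t \<in> {0..\<tau>} \<Longrightarrow> pds_bounded_by 2 C (y t)"
    using path_sol_bounded[OF sol] by blast
  have "norm (remainder \<alpha> y t x) \<le> C + R" if "t \<in> {0..\<tau>}" "set \<alpha> \<subseteq> Basis" "length \<alpha> \<le> 2" for t \<alpha> x
    unfolding remainder_def using that
    by (intro order_trans[OF norm_triangle_ineq4] add_mono norm_pds_le[OF y] norm_pds_eta_le) auto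
  then show thesis by (rule that)
qed

lemma sup_bound_step:
  assumes remainder: "\<And>t x. t \<in> {0..\<tau>} \<Longrightarrow> norm (remainder [] y t x) \<le> U" and t: "t \<in> {0..\<tau>}"
  shows "norm (remainder [] y t x) \<le> R + \<tau> * (2 * R^3 + R) + \<tau> * R^2 * U"
proof -
  have "0 \<le> U" using remainder[OF t] norm_ge_zero order_trans by blast
  have y: "norm (y t x) \<le> U + R" if "t \<in> {0..\<tau>}" for t x
    using norm_pds_le_of_remainder[OF that, of "[]"] remainder[OF that] by simp
  have "norm (remainder [] y t x) \<le> R + (R + R^3 + R^2 * (U + R)) * t"
    using norm_pds_le[OF h_pds, of "[]"]
    by (intro transport_diffusion_norm_le[OF viscous_transport_diffusion
      nu_range(1) y remainder _ _ t]
        norm_source_le nu_range y) (auto simp: remainder_initial[OF sol])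
  also have "\<dots> \<le> R + (R + R^3 + R^2 * (U + R)) * \<tau>"
    using t R_nonneg \<open>0 \<le> U\<close> by (intro add_left_mono mult_left_mono) auto
  finally show ?thesis by (simp add: algebra_simps power2_eq_square power3_eq_cube)
qed

lemma remainder_sup_bound:
  assumes t: "t \<in> {0..\<tau>}"
  shows "norm (remainder [] y t x) \<le> 2 * R"
proof -
  obtain C where bounded: "\<And>t \<alpha> x. t \<in> {0..\<tau>} \<Longrightarrow> set \<alpha> \<subseteq> Basis \<Longrightarrow> length \<alpha> \<le> 2 \<Longrightarrow>
      norm (remainder \<alpha> y t x) \<le> C" by (rule remainder_bounded) blast
  define \<phi> where "\<phi> = (\<lambda>(t, x). norm (remainder [] y t x))"
  have "\<phi> (t, x) \<le> (R + \<tau> * (2 * R^3 + R)) / (1 - \<tau> * R^2)"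
  proof (rule bound_by_absorption[where \<phi>=\<phi> and Z="{0..\<tau>} \<times> UNIV" and C=C])
    fix U and z :: "real \<times> (real^'n)"
    assume "\<And>z. z \<in> {0..\<tau>} \<times> UNIV \<Longrightarrow> \<phi> z \<le> U" and "z \<in> {0..\<tau>} \<times> UNIV"
    then show "\<phi> z \<le> R + \<tau> * (2 * R^3 + R) + \<tau> * R^2 * U"
      using sup_bound_step[of U] unfolding \<phi>_def by fastforce
  qed (use t bounded[of _ "[]"] tau_R_small in \<open>auto simp: \<phi>_def\<close>)
  also have "\<dots> \<le> 2 * R"
  proof -
    have "R + \<tau> * (2 * R^3 + R) \<le> 2 * R * (1 - 1/100)"
      using tau_R_small R1 by (simp add: algebra_simps)
    also have "\<dots> \<le> 2 * R * (1 - \<tau> * R^2)" using tau_R_small R_nonneg by (intro mult_left_mono) auto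
    finally show ?thesis using tau_R_small by (simp add: pos_divide_le_eq)
  qed
  finally show ?thesis by (simp add: \<phi>_def)
qed

lemma path_sol_sup_bound: "t \<in> {0..\<tau>} \<Longrightarrow> norm (y t x) \<le> 3 * R"
  using norm_pds_le_of_remainder[OF _ _ _ remainder_sup_bound, of t x] by simp

lemma norm_fdiff_path_sol_le:
  assumes "t \<in> {0..\<tau>}" "i \<in> Basis" "\<And>x. norm (pd i (y t) x) \<le> G"
  shows "norm (fdiff (s *\<^sub>R i) (y t) x) \<le> G * \<bar>s\<bar>"
  using Cb_hoelder_dir_deriv[OF y_hoelder assms(1), of "[]" i] assms by (intro norm_fdiff_le) auto

lemma gradient_bound_step:
  assumes r: "r \<in> {0..\<tau>}"
    and grad: "\<And>t x k. t \<in> {0..r} \<Longrightarrow> k \<in> Basis \<Longrightarrow> norm (remainder [k] y t x) \<le> 4 * R"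
    and t: "t \<in> {0..r}" and i: "i \<in> Basis"
  shows "norm (remainder [i] y t x) \<le> 2 * R"
proof -
  have sub: "t \<in> {0..\<tau>}" if "t \<in> {0..r}" for t using that r by auto
  have "norm (pd i (y t) x) \<le> 5 * R" if "t \<in> {0..r}" for t x
    using norm_pds_le_of_remainder[OF sub[OF that], of "[i]" y x "4 * R"] grad[OF that i] i by simp
  then have y_diff: "norm (fdiff (s *\<^sub>R i) (y t) x) \<le> 5 * R * s" if "0 < s" "t \<in> {0..r}" for s t x
    using norm_fdiff_path_sol_le[OF sub[OF that(2)] i, of "5 * R" s x] that by simp
  have "norm (remainder [i] y t x)
      \<le> R + (R * (1 + 5 * R) + R^3 + R^2 * (3 * R + 5 * R)
      + real DIM(real^'n) * (5 * R * (4 * R))) * t"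
    using r by (intro
        transport_diffusion_dir_deriv_le[OF
          transport_diffusion_subinterval[OF viscous_transport_diffusion]
          nu_range(1) path_sol_sup_bound[OF sub] remainder_sup_bound[OF sub] _ y_diff grad _ t i]
        norm_fdiff_source_le[OF sub nu_range i _ path_sol_sup_bound[OF sub] y_diff])
      (auto simp: remainder_initial[OF sol] i norm_fdiff_h_le)
  also have "\<dots> \<le> R + (35 * R^3) * \<tau>"
  proof -
    have "R * (1 + 5 * R) + R^3 + R^2 * (3 * R + 5 * R) = R + 5 * R^2 + 9 * R^3"
      by (simp add: algebra_simps power2_eq_square power3_eq_cube)
    moreover have "real DIM(real^'n) * (5 * R * (4 * R)) \<le> R * (5 * R * (4 * R))"
      using dim_le R_nonneg by (intro mult_right_mono) auto
    then have "real DIM(real^'n) * (5 * R * (4 * R)) \<le> 20 * R^3" by (simp add: power3_eq_cube)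
    ultimately show ?thesis using t r R_nonneg powers_R_le by (intro add_left_mono mult_mono) auto
  qed
  also have "\<dots> \<le> 2 * R" using tau_R_small R1 by (simp add: mult.commute)
  finally show ?thesis .
qed

lemma remainder_initial_gradient_bound:
  assumes "k \<in> Basis"
  shows "norm (remainder [k] y 0 x) \<le> R"
proof -
  have "has_dir_deriv h k (remainder [k] y 0)"
    using remainder_dir_deriv[OF y_hoelder, of 0 "[]" k] tau assms
    by (simp add: remainder_initial[OF sol])
  then show ?thesis using norm_fdiff_h_le[OF assms] by (rule norm_dir_deriv_le)
qed

lemma remainder_gradient_near:
  obtains \<delta> where "0 < \<delta>" "\<And>k s t x. k \<in> Basis \<Longrightarrow> s \<in> {0..\<tau>} \<Longrightarrow> t \<in> {0..\<tau>} \<Longrightarrow> \<bar>t - s\<bar> < \<delta> \<Longrightarrow>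
    norm (remainder [k] y t x) \<le> norm (remainder [k] y s x) + 2 * R"
proof -
  have equicontinuous: "time_equicontinuous_on {0..\<tau>} (remainder [k] y)" if "k \<in> Basis" for k
    unfolding remainder_def[abs_def] using that
    by (intro time_equicontinuous_on_diff
      Cb_hoelder_pds_time_equicontinuous_on[OF y_hoelder beta(1)]
        Cb_hoelder_pds_time_equicontinuous_on[OF eta_hoelder beta(1)]) auto
  obtain \<delta> where "0 < \<delta>" and near: "\<And>k s t x. k \<in> Basis \<Longrightarrow> s \<in> {0..\<tau>} \<Longrightarrow> t \<in> {0..\<tau>} \<Longrightarrow> \<bar>t - s\<bar> < \<delta> \<Longrightarrow>
      norm (remainder [k] y t x - remainder [k] y s x) \<le> 2"
    by (rule time_equicontinuous_on_finiteE[OF finite_Basis equicontinuous, where e=2]) auto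
  have "norm (remainder [k] y t x) \<le> norm (remainder [k] y s x) + 2 * R"
    if "k \<in> Basis" "s \<in> {0..\<tau>}" "t \<in> {0..\<tau>}" "\<bar>t - s\<bar> < \<delta>" for k s t x
    using near[OF that, of x] norm_triangle_sub[of "remainder [k] y t x" "remainder [k] y s x"] R1
    by simp
  with \<open>0 < \<delta>\<close> show thesis by (rule that)
qed

lemma remainder_gradient_bound:
  assumes t: "t \<in> {0..\<tau>}" and k: "k \<in> Basis"
  shows "norm (remainder [k] y t x) \<le> 2 * R"
proof -
  obtain \<delta> where "0 < \<delta>" and near: "\<And>k s t x. k \<in> Basis \<Longrightarrow> s \<in> {0..\<tau>} \<Longrightarrow> t \<in> {0..\<tau>} \<Longrightarrow> \<bar>t - s\<bar> < \<delta> \<Longrightarrow>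
      norm (remainder [k] y t x) \<le> norm (remainder [k] y s x) + 2 * R"
    by (rule remainder_gradient_near) blast
  define \<phi> where "\<phi> = (\<lambda>(x, k) t. norm (remainder [k] y t x))"
  have "\<phi> (x, k) t \<le> 2 * R"
  proof (rule bound_by_continuation[where \<phi>=\<phi> and Z="UNIV \<times> Basis"
        and b="4 * R", OF _ \<open>0 < \<delta>\<close> _ _ _ t])
    have "norm (remainder [k] y 0 x) \<le> 2 * R" if "k \<in> Basis" for k x
      using remainder_initial_gradient_bound[OF that, of x] R1 by linarith
    then show "\<phi> z 0 \<le> 2 * R" if "z \<in> UNIV \<times> Basis" for z
      using that by (auto simp: \<phi>_def)
    show "\<phi> z t \<le> \<phi> z s + (4 * R - 2 * R)"
      if "z \<in> UNIV \<times> Basis" "s \<in> {0..\<tau>}" "t \<in> {0..\<tau>}" "\<bar>t - s\<bar> < \<delta>" for z s t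
      using that near by (auto simp: \<phi>_def)
    fix r t and z :: "(real^'n) \<times> (real^'n)"
    assume r: "r \<in> {0..\<tau>}" and "z \<in> UNIV \<times> Basis" and t: "t \<in> {0..r}"
      and bound: "\<And>z t. z \<in> UNIV \<times> Basis \<Longrightarrow> t \<in> {0..r} \<Longrightarrow> \<phi> z t \<le> 4 * R"
    have "norm (remainder [k] y t x) \<le> 4 * R" if "t \<in> {0..r}" "k \<in> Basis" for t x k
      using bound[of "(x, k)" t] that by (simp add: \<phi>_def)
    from gradient_bound_step[OF r this t] show "\<phi> z t \<le> 2 * R"
      using \<open>z \<in> UNIV \<times> Basis\<close> by (auto simp: \<phi>_def)
  qed (use k in auto)
  then show ?thesis by (simp add: \<phi>_def)
qed

lemma path_sol_gradient_bound: "t \<in> {0..\<tau>} \<Longrightarrow> k \<in> Basis \<Longrightarrow> norm (pd k (y t) x) \<le> 3 * R"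
  using norm_pds_le_of_remainder[OF _ _ _ remainder_gradient_bound, of t k x] by simp

lemma norm_fdiff_fdiff_path_sol_le:
  assumes "t \<in> {0..\<tau>}" "i \<in> Basis" "j \<in> Basis" "\<And>x. norm (pd j (pd i (y t)) x) \<le> H"
  shows "norm (fdiff (r *\<^sub>R j) (fdiff (s *\<^sub>R i) (y t)) x) \<le> H * \<bar>r\<bar> * \<bar>s\<bar>"
  using Cb_hoelder_dir_deriv[OF y_hoelder assms(1), of "[]" i]
    Cb_hoelder_dir_deriv[OF y_hoelder assms(1), of "[i]" j] assms
  by (intro norm_fdiff_fdiff_le[where u'="pd i (y t)"]) auto

lemma hessian_bound_step:
  assumes hess: "\<And>t x i j. t \<in> {0..\<tau>} \<Longrightarrow> i \<in> Basis \<Longrightarrow> j \<in> Basis \<Longrightarrow> norm (remainder [j, i] y t x) \<le> U"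
    and t: "t \<in> {0..\<tau>}" and i: "i \<in> Basis" and j: "j \<in> Basis"
  shows "norm (remainder [j, i] y t x) \<le> R + (R^2 * N + 29 * R^3 + 10 * R^2 * U) * \<tau>"
proof -
  have "0 \<le> U" using hess[OF t i j] norm_ge_zero order_trans by blast
  have "0 \<le> N" by (rule pds_bounded_by_nonneg[OF eta_pds4[OF t]])
  have deriv2: "has_dir_deriv (remainder [k] y t) l (remainder [l, k] y t)"
    if "t \<in> {0..\<tau>}" "k \<in> Basis" "l \<in> Basis" for t k l
    using that by (intro remainder_dir_deriv[OF y_hoelder]) auto
  have y_diff: "norm (fdiff (s *\<^sub>R k) (y t) x) \<le> 3 * R * s"
    if "0 < s" "t \<in> {0..\<tau>}" "k \<in> Basis" for s t x k
    using norm_fdiff_path_sol_le[OF that(2,3) path_sol_gradient_bound[OF that(2,3)], of s x] that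
    by simp
  have "norm (pd j (pd i (y t)) x) \<le> U + R" if "t \<in> {0..\<tau>}" for t x
    using norm_pds_le_of_remainder[OF that, of "[j, i]"] hess[OF that i j] i j by simp
  then have y_diff2: "norm (fdiff (r *\<^sub>R j) (fdiff (s *\<^sub>R i) (y t)) x) \<le> (U + R) * r * s"
    if "0 < r" "0 < s" "t \<in> {0..\<tau>}" for r s t x
    using norm_fdiff_fdiff_path_sol_le[OF that(3) i j, of "U + R" r s x] that by simp
  have grad_diff: "norm (fdiff (s *\<^sub>R l) (remainder [k] y t) x) \<le> U * s"
    if "0 < s" "t \<in> {0..\<tau>}" "k \<in> Basis" "l \<in> Basis" for s t x k l
    using norm_fdiff_le[OF deriv2 hess, OF that(2-4,2-4), of s x] that by simp
  have "norm (remainder [j, i] y t x)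
    \<le> R + (R * ((1 + 3 * R)\<^sup>2 + (U + R)) + R^2 * N + R^2 * (3 * R + 2 * (3 * R) + (U + R))
        + real DIM(real^'n) * (2 * (3 * R * U) + (U + R) * (2 * R))) * t"
    by (intro transport_diffusion_second_dir_deriv_le[OF viscous_transport_diffusion nu_range(1)
          path_sol_sup_bound remainder_sup_bound _ y_diff y_diff2
          remainder_gradient_bound grad_diff _
          deriv2[OF t i j] t i j]
        norm_fdiff_fdiff_source_le[OF _ nu_range i j _ _ path_sol_sup_bound y_diff y_diff2])
      (auto simp: remainder_initial[OF sol] i j norm_fdiff_fdiff_h_le)
  also have "\<dots> \<le> R + (R^2 * N + 29 * R^3 + 10 * R^2 * U) * \<tau>"
    using t \<open>0 \<le> N\<close> \<open>0 \<le> U\<close> R_nonneg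
    by (intro add_left_mono mult_mono hessian_constants_le add_nonneg_nonneg
        mult_nonneg_nonneg) auto
  finally show ?thesis .
qed

end

definition hess_bound :: real where
  "hess_bound = (R + \<tau> * (R^2 * N + 29 * R^3)) / (1 - 10 * (\<tau> * R^2)) + R"

lemma hess_bound_nonneg: "0 \<le> hess_bound"
proof -
  have "0 \<le> N" using pds_bounded_by_nonneg[OF eta_pds4] tau by auto
  then show ?thesis
    unfolding hess_bound_def using R_nonneg tau tau_R_small
    by (intro add_nonneg_nonneg divide_nonneg_nonneg mult_nonneg_nonneg) auto
qed

lemma path_sol_hessian_bound:
  assumes "path_sol 2 \<nu> y" "0 < \<nu>" "\<nu> \<le> \<nu>0"
    and t: "t \<in> {0..\<tau>}" and ij: "i \<in> Basis" "j \<in> Basis"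
  shows "norm (pd j (pd i (y t)) x) \<le> hess_bound"
proof -
  define \<phi> where "\<phi> = (\<lambda>(t, x, i, j). norm (remainder [j, i] y t x))"
  let ?Z = "{0..\<tau>} \<times> UNIV \<times> Basis \<times> Basis"
  obtain C where "\<And>t \<alpha> x. t \<in> {0..\<tau>} \<Longrightarrow> set \<alpha> \<subseteq> Basis \<Longrightarrow> length \<alpha> \<le> 2 \<Longrightarrow> norm (remainder \<alpha> y t x) \<le> C"
    by (rule remainder_bounded[OF assms(1-3)]) blast
  then have bounded: "\<phi> z \<le> C" if "z \<in> ?Z" for z
    using that by (auto simp: \<phi>_def)
  have "\<phi> (t, x, i, j) \<le> (R + \<tau> * (R^2 * N + 29 * R^3)) / (1 - 10 * (\<tau> * R^2))"
  proof (rule bound_by_absorption[where \<phi>=\<phi> and Z="?Z" and C=C])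
    fix U and z :: "real \<times> (real^'n) \<times> (real^'n) \<times> (real^'n)"
    assume bound: "\<And>z. z \<in> ?Z \<Longrightarrow> \<phi> z \<le> U" and "z \<in> ?Z"
    have "norm (remainder [j, i] y t x) \<le> U" if "t \<in> {0..\<tau>}" "i \<in> Basis" "j \<in> Basis" for t x i j
      using bound[of "(t, x, i, j)"] that by (simp add: \<phi>_def)
    from hessian_bound_step[OF assms(1-3) this]
    show "\<phi> z \<le> R + \<tau> * (R^2 * N + 29 * R^3) + 10 * (\<tau> * R^2) * U"
      using \<open>z \<in> ?Z\<close> by (auto simp: \<phi>_def algebra_simps)
  qed (use t ij bounded tau_R_small in auto)
  then show ?thesis
    using norm_pds_le_of_remainder[OF t, of "[j, i]" y x] ij by (simp add: \<phi>_def hess_bound_def)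
qed

section \<open>Dependence on the viscosity\<close>

lemma forcing_lipschitz:
  assumes "t \<in> {0..\<tau>}"
  shows "norm (f t x z - f t x z') \<le> R * norm (z - z')"
  using forcing_bound(2)[OF assms, of "(0, z - z')" "(x, z')"] by (simp add: fdiff_def norm_Pair)

definition difference_source :: "real \<Rightarrow> real \<Rightarrow> (real \<Rightarrow> real^'n \<Rightarrow> real^'n) \<Rightarrow>
    (real \<Rightarrow> real^'n \<Rightarrow> real^'n) \<Rightarrow> real \<Rightarrow> real^'n \<Rightarrow> real^'n" where
  "difference_source \<nu> \<mu> y z t x = f t x (y t x) - f t x (z t x) + (\<nu> - \<mu>) *\<^sub>R lap (z t) x
     - advect (y t x - z t x) (\<lambda>k. pd k (z t) x)"

lemma path_sol_difference_transport_diffusion: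
  assumes y: "path_sol l \<nu> y" "1 \<le> l" "\<nu> \<noteq> 0 \<Longrightarrow> 2 \<le> l" and z: "path_sol 2 \<mu> z" "0 < \<mu>"
  obtains w1 w2 where
    "transport_diffusion \<nu> \<tau> y (difference_source \<nu> \<mu> y z) (\<lambda>t x. y t x - z t x) w1 w2"
proof -
  have z_eq: "transport_diffusion \<mu> \<tau> z (source \<mu> z) (remainder [] z)
      (\<lambda>i. remainder [i] z) (\<lambda>i. remainder [i, i] z)"
    by (rule remainder_transport_diffusion[OF z(1)]) auto
  have "source \<nu> y t x - (source \<mu> z t x + (\<mu> - \<nu>) *\<^sub>R (\<Sum>i\<in>Basis. remainder [i, i] z t x))
      - advect (y t x - z t x) (\<lambda>i. remainder [i] z t x) = difference_source \<nu> \<mu> y z t x" for t x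
    unfolding difference_source_def source_def lap_def advect_diff_left
      advect_diff_right remainder_def
    by (simp add: sum_subtractf algebra_simps advect_diff_right)
  moreover have "remainder [] y t x - remainder [] z t x = y t x - z t x" for t x
    by (simp add: remainder_def)
  ultimately show thesis
    using that transport_diffusion_diff[OF remainder_transport_diffusion[OF y]
        transport_diffusion_change_viscosity[OF z_eq z(2), of \<nu>]]
    by simp
qed

definition viscosity_constant :: real where
  "viscosity_constant = 2 * (\<tau> * R * hess_bound)"

lemma viscosity_constant_nonneg: "0 \<le> viscosity_constant"
  using tau R_nonneg hess_bound_nonneg by (simp add: viscosity_constant_def)

lemma norm_lap_path_sol_le:
  assumes "path_sol 2 \<nu> y" "0 < \<nu>" "\<nu> \<le> \<nu>0" "t \<in> {0..\<tau>}"
  shows "norm (lap (y t) x) \<le> R * hess_bound"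
proof -
  have "norm (lap (y t) x) \<le> real DIM(real^'n) * hess_bound"
    unfolding lap_def by (intro sum_norm_bound path_sol_hessian_bound[OF assms])
  also have "\<dots> \<le> R * hess_bound" by (rule mult_right_mono[OF dim_le hess_bound_nonneg])
  finally show ?thesis .
qed

lemma norm_difference_source_le:
  assumes z: "path_sol 2 \<mu> z" "0 < \<mu>" "\<mu> \<le> \<nu>0" and t: "t \<in> {0..\<tau>}"
    and difference: "norm (y t x - z t x) \<le> U"
  shows "norm (difference_source \<nu> \<mu> y z t x) \<le> \<bar>\<nu> - \<mu>\<bar> * (R * hess_bound) + (3 * R^2 + R) * U"
proof -
  have "norm (f t x (y t x) - f t x (z t x)) \<le> R * U"
    by (rule order_trans[OF forcing_lipschitz[OF t] mult_left_mono[OF difference R_nonneg]])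
  moreover have "norm ((\<nu> - \<mu>) *\<^sub>R lap (z t) x) \<le> \<bar>\<nu> - \<mu>\<bar> * (R * hess_bound)"
    using norm_lap_path_sol_le[OF z t] by (simp add: mult_left_mono)
  moreover have "norm (advect (y t x - z t x) (\<lambda>k. pd k (z t) x)) \<le> R * (U * (3 * R))"
    by (intro norm_advect_le_R difference path_sol_gradient_bound[OF z t])
  ultimately have "norm (difference_source \<nu> \<mu> y z t x)
      \<le> R * U + \<bar>\<nu> - \<mu>\<bar> * (R * hess_bound) + R * (U * (3 * R))"
    unfolding difference_source_def
    by (rule order_trans[OF norm_triangle_ineq4 add_mono[OF norm_triangle_mono]])
  then show ?thesis by (simp add: algebra_simps power2_eq_square)
qed

lemma viscosity_difference_step:
  assumes y: "path_sol l \<nu> y" "1 \<le> l" "\<nu> \<noteq> 0 \<Longrightarrow> 2 \<le> l" and "0 \<le> \<nu>"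
    and z: "path_sol 2 \<mu> z" "0 < \<mu>" "\<mu> \<le> \<nu>0"
    and difference: "\<And>t x. t \<in> {0..\<tau>} \<Longrightarrow> norm (y t x - z t x) \<le> U" and t: "t \<in> {0..\<tau>}"
  shows "norm (y t x - z t x) \<le> \<tau> * (\<bar>\<nu> - \<mu>\<bar> * (R * hess_bound)) + \<tau> * (3 * R^2 + R) * U"
proof -
  let ?K = "\<bar>\<nu> - \<mu>\<bar> * (R * hess_bound) + (3 * R^2 + R) * U"
  obtain w1 w2 where diff_eq:
    "transport_diffusion \<nu> \<tau> y (difference_source \<nu> \<mu> y z) (\<lambda>t x. y t x - z t x) w1 w2"
    using path_sol_difference_transport_diffusion[OF y z(1,2)] .
  obtain C where y_bounded: "\<And>t x. t \<in> {0..\<tau>} \<Longrightarrow> norm (y t x) \<le> C"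
    by (rule path_sol_norm_bounded[OF y(1)]) blast
  have "remainder [] y 0 x = remainder [] z 0 x" for x
    using remainder_initial[OF y(1)] remainder_initial[OF z(1)] by simp
  then have "norm (y 0 x - z 0 x) \<le> 0" for x by (simp add: remainder_def)
  then have "norm (y t x - z t x) \<le> 0 + ?K * t"
    by (intro transport_diffusion_norm_le[OF diff_eq \<open>0 \<le> \<nu>\<close> y_bounded difference _ _ t]
        norm_difference_source_le[OF z] difference)
  also have "\<dots> \<le> ?K * \<tau>"
    using t order_trans[OF norm_ge_zero difference[OF t]] R_nonneg hess_bound_nonneg
    by (simp add: mult_left_mono)
  finally show ?thesis by (simp add: algebra_simps)
qed

lemma path_sol_viscosity_difference:
  assumes y: "path_sol l \<nu> y" "1 \<le> l" "\<nu> \<noteq> 0 \<Longrightarrow> 2 \<le> l" and "0 \<le> \<nu>"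
    and z: "path_sol 2 \<mu> z" "0 < \<mu>" "\<mu> \<le> \<nu>0" and t: "t \<in> {0..\<tau>}"
  shows "norm (y t x - z t x) \<le> viscosity_constant * \<bar>\<nu> - \<mu>\<bar>"
proof -
  obtain C where y_bounded: "\<And>t x. t \<in> {0..\<tau>} \<Longrightarrow> norm (y t x) \<le> C"
    by (rule path_sol_norm_bounded[OF y(1)]) blast
  have bounded: "norm (y t x - z t x) \<le> C + 3 * R" if "t \<in> {0..\<tau>}" for t x
    using that
    by (intro order_trans[OF norm_triangle_ineq4] add_mono y_bounded path_sol_sup_bound[OF z])
  define K where "K = \<tau> * (\<bar>\<nu> - \<mu>\<bar> * (R * hess_bound))"
  have "0 \<le> K" using tau R_nonneg hess_bound_nonneg by (simp add: K_def)
  define \<theta> where "\<theta> = \<tau> * (3 * R^2 + R)"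
  have "\<theta> \<le> 1 / 2" using tau_R_small by (simp add: \<theta>_def algebra_simps)
  define \<phi> where "\<phi> = (\<lambda>(t, x). norm (y t x - z t x))"
  have "\<phi> (t, x) \<le> K / (1 - \<theta>)"
  proof (rule bound_by_absorption[where \<phi>=\<phi> and Z="{0..\<tau>} \<times> UNIV" and C="C + 3 * R"])
    fix U and p :: "real \<times> (real^'n)"
    assume bound: "\<And>p. p \<in> {0..\<tau>} \<times> UNIV \<Longrightarrow> \<phi> p \<le> U" and "p \<in> {0..\<tau>} \<times> UNIV"
    have "norm (y t x - z t x) \<le> U" if "t \<in> {0..\<tau>}" for t x
      using bound[of "(t, x)"] that by (simp add: \<phi>_def)
    from viscosity_difference_step[OF y \<open>0 \<le> \<nu>\<close> z this] show "\<phi> p \<le> K + \<theta> * U"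
      using \<open>p \<in> {0..\<tau>} \<times> UNIV\<close> by (auto simp: \<phi>_def \<theta>_def K_def)
  qed (use t \<open>\<theta> \<le> 1 / 2\<close> bounded in \<open>auto simp: \<phi>_def\<close>)
  also have "\<dots> \<le> 2 * K"
  proof -
    have "K * 1 \<le> K * (2 * (1 - \<theta>))"
      using \<open>\<theta> \<le> 1 / 2\<close> \<open>0 \<le> K\<close> by (intro mult_left_mono) auto
    then show ?thesis using \<open>\<theta> \<le> 1 / 2\<close> by (simp add: pos_divide_le_eq mult_ac)
  qed
  finally show ?thesis by (simp add: \<phi>_def K_def viscosity_constant_def mult_ac)
qed

section \<open>The inviscid limit\<close>

definition drift_bound :: real where
  "drift_bound = R * (R * hess_bound) + R * ((3 * R) * (3 * R)) + R"

lemma norm_burgers_drift_le: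
  assumes sol: "path_sol 2 \<nu> y" "0 < \<nu>" "\<nu> \<le> \<nu>0" and t: "t \<in> {0..\<tau>}"
  shows "norm (burgers_drift f \<nu> y t x) \<le> drift_bound"
proof -
  have "norm (\<nu> *\<^sub>R lap (y t) x) \<le> R * (R * hess_bound)"
    using norm_lap_path_sol_le[OF assms, of x] sol nu0_le by (simp add: mult_mono')
  moreover have "norm (adv (y t) x) \<le> R * ((3 * R) * (3 * R))"
    unfolding adv_eq_advect
    by (intro norm_advect_le_R path_sol_sup_bound[OF sol t] path_sol_gradient_bound[OF sol t])
  ultimately show ?thesis
    unfolding burgers_drift_def drift_bound_def
    by (intro norm_triangle_mono order_trans[OF norm_triangle_ineq4] add_mono forcing_bound[OF t])
qed

lemma remainder_time_lipschitz:
  assumes sol: "path_sol 2 \<nu> y" "0 < \<nu>" "\<nu> \<le> \<nu>0" and "s \<in> {0..\<tau>}" "t \<in> {0..\<tau>}"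
  shows "norm (remainder [] y t x - remainder [] y s x) \<le> drift_bound * \<bar>t - s\<bar>"
proof -
  have "norm (remainder [] y t x - remainder [] y s x) \<le> drift_bound * norm (t - s)"
  proof (rule differentiable_bound[of "{0..\<tau>}" _ "\<lambda>t h. h *\<^sub>R burgers_drift f \<nu> y t x"])
    fix r assume r: "r \<in> {0..\<tau>}"
    show "((\<lambda>t. remainder [] y t x) has_derivative (\<lambda>h. h *\<^sub>R burgers_drift f \<nu> y r x))
        (at r within {0..\<tau>})"
      using remainder_time_deriv[OF sol(1) _ _ r] by (simp add: has_vector_derivative_def)
    show "onorm (\<lambda>h. h *\<^sub>R burgers_drift f \<nu> y r x) \<le> drift_bound"
      using mult_left_mono[OF norm_burgers_drift_le[OF sol r, of x] abs_ge_zero]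
      by (intro onorm_le) (simp add: mult.commute)
  qed (use assms in auto)
  then show ?thesis by simp
qed

context
  fixes \<nu> :: "nat \<Rightarrow> real" and y y0
  assumes sol: "\<And>k. path_sol 2 (\<nu> k) (y k)" and nu: "\<And>k. 0 < \<nu> k" "\<And>k. \<nu> k \<le> \<nu>0" "\<nu> \<longlonglongrightarrow> 0"
    and lim: "uniform_limit ({0..\<tau>} \<times> UNIV) (\<lambda>k (t, x). y k t x) (\<lambda>(t, x). y0 t x) sequentially"
begin

lemma viscous_hoelder: "Cb_hoelder \<beta> 2 0 \<tau> (y k)"
  using sol by (simp add: burgers_path_sol_def)

lemma viscous_tendsto: "t \<in> {0..\<tau>} \<Longrightarrow> (\<lambda>k. y k t x) \<longlonglongrightarrow> y0 t x"
  using tendsto_uniform_limitI[OF lim, of "(t, x)"] by simp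

lemma gradient_uniform_limit:
  assumes i: "i \<in> Basis"
  shows "uniform_limit ({0..\<tau>} \<times> UNIV) (\<lambda>k (t, x). pd i (y k t) x)
      (\<lambda>(t, x). pd i (y0 t) x) sequentially"
    and "t \<in> {0..\<tau>} \<Longrightarrow> has_dir_deriv (y0 t) i (pd i (y0 t))"
proof -
  have deriv: "has_dir_deriv (y k t) i (pd i (y k t))"
    and deriv2: "has_dir_deriv (pd i (y k t)) i (pd i (pd i (y k t)))"
    if "t \<in> {0..\<tau>}" for k t
    using Cb_hoelder_dir_deriv[OF viscous_hoelder that, of "[]" i]
      Cb_hoelder_dir_deriv[OF viscous_hoelder that, of "[i]" i] i by auto
  have "uniformly_convergent_on ({0..\<tau>} \<times> UNIV) (\<lambda>k (t, x). pd i (y k t) x)"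
    using lim path_sol_hessian_bound[OF sol nu(1,2) _ i i]
    by (intro uniformly_convergent_dir_deriv[OF deriv deriv2])
      (auto simp: uniformly_convergent_on_def)
  then obtain p where p_lim: "uniform_limit ({0..\<tau>} \<times> UNIV)
      (\<lambda>k (t, x). pd i (y k t) x) p sequentially"
    unfolding uniformly_convergent_on_def by blast
  have limit_deriv: "has_dir_deriv (y0 t) i (\<lambda>x. p (t, x))" if "t \<in> {0..\<tau>}" for t
  proof (rule has_dir_deriv_uniform_limit[OF deriv[OF that] viscous_tendsto[OF that]])
    show "uniform_limit UNIV (\<lambda>k. pd i (y k t)) (\<lambda>x. p (t, x)) sequentially"
      using uniform_limit_compose'[OF p_lim, of "\<lambda>x. (t, x)" UNIV] that by simp
  qed
  then have pd_eq: "pd i (y0 t) = (\<lambda>x. p (t, x))" if "t \<in> {0..\<tau>}" for t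
    using that by (intro has_dir_deriv_imp_pd)
  show "has_dir_deriv (y0 t) i (pd i (y0 t))" if "t \<in> {0..\<tau>}"
    using limit_deriv[OF that] pd_eq[OF that] by simp
  show "uniform_limit ({0..\<tau>} \<times> UNIV) (\<lambda>k (t, x). pd i (y k t) x)
      (\<lambda>(t, x). pd i (y0 t) x) sequentially"
    by (rule uniform_limit_cong'[THEN iffD1, OF _ _ p_lim]) (auto simp: pd_eq)
qed

lemma gradient_tendsto: "t \<in> {0..\<tau>} \<Longrightarrow> i \<in> Basis \<Longrightarrow> (\<lambda>k. pd i (y k t) x) \<longlonglongrightarrow> pd i (y0 t) x"
  using tendsto_uniform_limitI[OF gradient_uniform_limit(1), of i "(t, x)"] by simp

lemma limit_hoelder_in_time:
  obtains C where "\<And>s t x. s \<in> {0..\<tau>} \<Longrightarrow> t \<in> {0..\<tau>} \<Longrightarrow>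
      norm (y0 t x - y0 s x) \<le> C * \<bar>t - s\<bar> powr (\<beta> / 2)"
proof -
  obtain C where eta_time_hoelder: "\<And>s t x. s \<in> {0..\<tau>} \<Longrightarrow> t \<in> {0..\<tau>} \<Longrightarrow>
      norm (\<eta> t x - \<eta> s x) \<le> C * \<bar>t - s\<bar> powr (\<beta> / 2)"
    using eta_hoelder unfolding Cb_hoelder_def by blast
  have "norm (y0 t x - y0 s x) \<le> (drift_bound + C) * \<bar>t - s\<bar> powr (\<beta> / 2)"
    if st: "s \<in> {0..\<tau>}" "t \<in> {0..\<tau>}" for s t x
  proof -
    have "norm (remainder [] y0 t x - remainder [] y0 s x) \<le> drift_bound * \<bar>t - s\<bar>"
    proof (rule tendsto_upperbound)
      show "(\<lambda>k. norm (remainder [] (y k) t x - remainder [] (y k) s x))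
          \<longlonglongrightarrow> norm (remainder [] y0 t x - remainder [] y0 s x)"
        unfolding remainder_def by (simp, intro tendsto_intros viscous_tendsto st)
    qed (use remainder_time_lipschitz[OF sol nu(1,2) st] in auto)
    also have "\<dots> \<le> drift_bound * \<bar>t - s\<bar> powr (\<beta> / 2)"
    proof (rule mult_left_mono)
      have "\<tau> * 1 \<le> \<tau> * R" using R1 tau by (intro mult_left_mono)
      then have "\<bar>t - s\<bar> \<le> 1" using st tau_R_small(1) by auto
      then have "\<bar>t - s\<bar> powr 1 \<le> \<bar>t - s\<bar> powr (\<beta> / 2)" using beta by (intro powr_mono') auto
      then show "\<bar>t - s\<bar> \<le> \<bar>t - s\<bar> powr (\<beta> / 2)" by simp
      show "0 \<le> drift_bound"
        using norm_burgers_drift_le[OF sol nu(1,2) st(1)] norm_ge_zero order_trans by blast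
    qed
    finally show ?thesis
      using eta_time_hoelder[OF st, of x]
        norm_triangle_ineq[of "remainder [] y0 t x - remainder [] y0 s x" "\<eta> t x - \<eta> s x"]
      by (simp add: remainder_def distrib_right)
  qed
  then show thesis by (rule that)
qed

lemma limit_pds_le:
  assumes t: "t \<in> {0..\<tau>}" and "set \<alpha> \<subseteq> Basis" "length \<alpha> \<le> 1"
  shows "norm (pds \<alpha> (y0 t) x) \<le> 3 * R"
  using assms(2,3)
proof (cases rule: Basis_lists_length_le_1)
  case 1
  then show ?thesis
    using tendsto_upperbound[OF tendsto_norm[OF viscous_tendsto[OF t, of x]]]
      path_sol_sup_bound[OF sol nu(1,2) t] by simp
next
  case (2 i)
  then show ?thesis
    using tendsto_upperbound[OF tendsto_norm[OF gradient_tendsto[OF t, of i x]]]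
      path_sol_gradient_bound[OF sol nu(1,2) t] by simp
qed

lemma continuous_on_limit_pds:
  assumes "set \<alpha> \<subseteq> Basis" "length \<alpha> \<le> 1"
  shows "continuous_on ({0..\<tau>} \<times> UNIV) (\<lambda>(t, x). pds \<alpha> (y0 t) x)"
  using assms
proof (cases rule: Basis_lists_length_le_1)
  case 1
  have "continuous_on ({0..\<tau>} \<times> UNIV) (\<lambda>(t, x). y k t x)" for k
    using Cb_hoelder_continuous_on[OF viscous_hoelder, of "[]"] by simp
  then have "continuous_on ({0..\<tau>} \<times> UNIV) (\<lambda>(t, x). y0 t x)"
    by (intro uniform_limit_theorem[OF _ lim]) auto
  with 1 show ?thesis by simp
next
  case (2 i)
  have "continuous_on ({0..\<tau>} \<times> UNIV) (\<lambda>(t, x). pd i (y k t) x)" for k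
    using Cb_hoelder_continuous_on[OF viscous_hoelder, of "[i]"] 2 by simp
  then have "continuous_on ({0..\<tau>} \<times> UNIV) (\<lambda>(t, x). pd i (y0 t) x)"
    using 2 by (intro uniform_limit_theorem[OF _ gradient_uniform_limit(1)]) auto
  with 2 show ?thesis by simp
qed

lemma limit_Cb_hoelder: "Cb_hoelder \<beta> 1 0 \<tau> y0"
proof -
  have "has_pds_upto 1 (y0 t)" if "t \<in> {0..\<tau>}" for t
    using gradient_uniform_limit(2)[OF _ that] by (auto simp: has_pds_upto_def has_dir_deriv_def)
  moreover have "bounded ((\<lambda>(t, x). pds \<alpha> (y0 t) x) ` ({0..\<tau>} \<times> UNIV))"
    if "set \<alpha> \<subseteq> Basis" "length \<alpha> \<le> 1" for \<alpha>
    using limit_pds_le[OF _ that] unfolding bounded_iff by (intro exI[of _ "3 * R"]) auto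
  ultimately show ?thesis
    unfolding Cb_hoelder_def using continuous_on_limit_pds limit_hoelder_in_time by metis
qed

lemma drift_tendsto:
  assumes t: "t \<in> {0..\<tau>}"
  shows "(\<lambda>k. burgers_drift f (\<nu> k) (y k) t x) \<longlonglongrightarrow> burgers_drift f 0 y0 t x"
proof -
  have "(\<lambda>k. \<nu> k *\<^sub>R lap (y k t) x) \<longlonglongrightarrow> 0"
  proof (rule Lim_null_comparison)
    show "\<forall>\<^sub>F k in sequentially. norm (\<nu> k *\<^sub>R lap (y k t) x) \<le> \<nu> k * (R * hess_bound)"
      using nu(1) norm_lap_path_sol_le[OF sol nu(1,2) t]
      by (auto simp: less_imp_le abs_of_pos intro!: mult_left_mono)
    show "(\<lambda>k. \<nu> k * (R * hess_bound)) \<longlonglongrightarrow> 0" using tendsto_mult_right[OF nu(3)] by simp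
  qed
  moreover have "(\<lambda>k. adv (y k t) x) \<longlonglongrightarrow> adv (y0 t) x"
    unfolding adv_def using t by (intro tendsto_intros viscous_tendsto gradient_tendsto)
  moreover have "(\<lambda>k. f t x (y k t x)) \<longlonglongrightarrow> f t x (y0 t x)"
  proof (rule LIM_zero_cancel, rule Lim_null_comparison)
    show "\<forall>\<^sub>F k in sequentially. norm (f t x (y k t x) - f t x (y0 t x))
        \<le> R * norm (y k t x - y0 t x)"
      using forcing_lipschitz[OF t] by simp
    have "(\<lambda>k. R * norm (y k t x - y0 t x)) \<longlonglongrightarrow> R * norm (y0 t x - y0 t x)"
      by (intro tendsto_intros viscous_tendsto[OF t])
    then show "(\<lambda>k. R * norm (y k t x - y0 t x)) \<longlonglongrightarrow> 0" by simp
  qed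
  ultimately have "(\<lambda>k. burgers_drift f (\<nu> k) (y k) t x) \<longlonglongrightarrow> 0 - adv (y0 t) x + f t x (y0 t x)"
    unfolding burgers_drift_def by (intro tendsto_add tendsto_diff)
  then show ?thesis by (simp add: burgers_drift_def)
qed

lemma path_sol_inviscid_limit: "path_sol 1 0 y0"
proof -
  have "y0 t x = h x + integral {0..t} (\<lambda>s. burgers_drift f 0 y0 s x) + \<eta> t x"
    if t: "t \<in> {0..\<tau>}" for t x
  proof (rule LIMSEQ_unique[OF viscous_tendsto[OF t]])
    have sub: "{0..t} \<subseteq> {0..\<tau>}" using t by auto
    have "(\<lambda>k. integral {0..t} (\<lambda>s. burgers_drift f (\<nu> k) (y k) s x))
        \<longlonglongrightarrow> integral {0..t} (\<lambda>s. burgers_drift f 0 y0 s x)"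
    proof (rule dominated_convergence(2)[where h="\<lambda>_. drift_bound"])
      show "(\<lambda>s. burgers_drift f (\<nu> k) (y k) s x) integrable_on {0..t}" for k
        using continuous_on_subset[OF continuous_on_burgers_drift[OF f_cont viscous_hoelder] sub]
        by (intro integrable_continuous_interval) auto
    qed (use sub norm_burgers_drift_le[OF sol nu(1,2)] drift_tendsto in auto)
    then have "(\<lambda>k. h x + integral {0..t} (\<lambda>s. burgers_drift f (\<nu> k) (y k) s x) + \<eta> t x)
        \<longlonglongrightarrow> h x + integral {0..t} (\<lambda>s. burgers_drift f 0 y0 s x) + \<eta> t x"
      by (intro tendsto_intros)
    moreover have "y k t x = h x + integral {0..t} (\<lambda>s. burgers_drift f (\<nu> k) (y k) s x) + \<eta> t x"
      for k
      using sol t unfolding burgers_path_sol_def by blast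
    ultimately show "(\<lambda>k. y k t x) \<longlonglongrightarrow> h x + integral {0..t} (\<lambda>s. burgers_drift f 0 y0 s x) + \<eta> t x"
      by simp
  qed
  with limit_Cb_hoelder show ?thesis unfolding burgers_path_sol_def by blast
qed

end

end

section \<open>Extension to all viscosities\<close>

lemma burgers_path_subinterval:
  assumes "burgers_path \<tau> R N L \<beta> \<nu>0 f h \<eta>" "0 \<le> \<tau>'" "\<tau>' \<le> \<tau>"
  shows "burgers_path \<tau>' R N L \<beta> \<nu>0 f h \<eta>"
proof -
  interpret burgers_path \<tau> R N L \<beta> \<nu>0 f h \<eta> by fact
  have sub: "t \<in> {0..\<tau>'} \<Longrightarrow> t \<in> {0..\<tau>}" for t using assms(3) by auto
  show ?thesis
  proof
    have "\<tau>' * R^3 \<le> \<tau> * R^3" using assms(3) R_nonneg by (intro mult_right_mono) auto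
    then show "100 * \<tau>' * R^3 \<le> 1" using small by simp
    show "continuous_on ({0..\<tau>'} \<times> UNIV) (\<lambda>(t, x, z). f t x z)"
      using sub by (intro continuous_on_subset[OF f_cont]) auto
    show "Cb_hoelder \<beta> 4 0 \<tau>' \<eta>" by (rule Cb_hoelder_subinterval[OF eta_hoelder assms(3)])
  qed (use sub assms(2) in \<open>blast intro: R1 nu0_le dim_le beta f_pds L_le h_pds eta_pds3 eta_pds4\<close>)+
qed

definition viscosity_extension :: "real \<Rightarrow> real set \<Rightarrow> real \<Rightarrow>
    (real \<Rightarrow> real \<Rightarrow> 'x \<Rightarrow> 'b::metric_space) \<Rightarrow> real \<Rightarrow>
    (real \<Rightarrow> real \<Rightarrow> 'x \<Rightarrow> 'b) \<Rightarrow> bool" where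
  "viscosity_extension \<nu>0 Q \<tau> y C Y \<longleftrightarrow>
     (\<forall>t\<in>{0..\<tau>}. \<forall>x. C-lipschitz_on {0..\<nu>0} (\<lambda>\<nu>. Y \<nu> t x) \<and> (\<forall>\<mu>\<in>Q. Y \<mu> t x = y \<mu> t x))"

lemma viscosity_extension_dist_le:
  assumes "viscosity_extension \<nu>0 Q \<tau> y C Y" "t \<in> {0..\<tau>}" "\<nu> \<in> {0..\<nu>0}" "\<mu> \<in> {0..\<nu>0}"
  shows "dist (Y \<nu> t x) (Y \<mu> t x) \<le> C * \<bar>\<nu> - \<mu>\<bar>"
  using assms unfolding viscosity_extension_def by (metis lipschitz_onD dist_real_def)

lemma viscosity_extension_uniformly_continuous:
  assumes ext: "viscosity_extension \<nu>0 Q \<tau> y C Y" and \<nu>: "\<nu> \<in> {0..\<nu>0}" and "0 < \<epsilon>"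
  shows "\<exists>\<delta>>0. \<forall>\<mu>\<in>{0..\<nu>0}. \<bar>\<mu> - \<nu>\<bar> < \<delta> \<longrightarrow> (\<forall>t\<in>{0..\<tau>}. \<forall>x. dist (Y \<mu> t x) (Y \<nu> t x) < \<epsilon>)"
proof (intro exI[of _ "\<epsilon> / (\<bar>C\<bar> + 1)"] conjI ballI impI allI)
  show "0 < \<epsilon> / (\<bar>C\<bar> + 1)" using \<open>0 < \<epsilon>\<close> by simp
  fix \<mu> t x assume \<mu>: "\<mu> \<in> {0..\<nu>0}" and close: "\<bar>\<mu> - \<nu>\<bar> < \<epsilon> / (\<bar>C\<bar> + 1)" and t: "t \<in> {0..\<tau>}"
  have "dist (Y \<mu> t x) (Y \<nu> t x) \<le> C * \<bar>\<mu> - \<nu>\<bar>" by (rule viscosity_extension_dist_le[OF ext t \<mu> \<nu>])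
  also have "\<dots> \<le> (\<bar>C\<bar> + 1) * \<bar>\<mu> - \<nu>\<bar>" by (intro mult_right_mono) auto
  also have "\<dots> < \<epsilon>" using close by (simp add: pos_less_divide_eq mult.commute)
  finally show "dist (Y \<mu> t x) (Y \<nu> t x) < \<epsilon>" .
qed

lemma viscosity_extension_uniform_limit:
  assumes ext: "viscosity_extension \<nu>0 Q \<tau> y C Y" and "Q \<subseteq> {0..\<nu>0}" and \<nu>: "\<nu> \<in> {0..\<nu>0}"
    and q: "\<And>k. q k \<in> Q" "q \<longlonglongrightarrow> \<nu>"
  shows "uniform_limit ({0..\<tau>} \<times> UNIV) (\<lambda>k (t, x). y (q k) t x) (\<lambda>(t, x). Y \<nu> t x) sequentially"
proof (rule uniform_limitI)
  fix e :: real assume "0 < e"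
  then obtain \<delta> where "0 < \<delta>" and
    close: "\<forall>\<mu>\<in>{0..\<nu>0}. \<bar>\<mu> - \<nu>\<bar> < \<delta> \<longrightarrow> (\<forall>t\<in>{0..\<tau>}. \<forall>x. dist (Y \<mu> t x) (Y \<nu> t x) < e)"
    using viscosity_extension_uniformly_continuous[OF ext \<nu>, of e] by blast
  show "\<forall>\<^sub>F k in sequentially. \<forall>z\<in>{0..\<tau>} \<times> UNIV.
      dist ((\<lambda>(t, x). y (q k) t x) z) ((\<lambda>(t, x). Y \<nu> t x) z) < e"
    using tendstoD[OF q(2) \<open>0 < \<delta>\<close>]
  proof eventually_elim
    case (elim k)
    have "dist (y (q k) t x) (Y \<nu> t x) < e" if t: "t \<in> {0..\<tau>}" for t x
    proof -
      have "y (q k) t x = Y (q k) t x" using ext q(1) t by (simp add: viscosity_extension_def)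
      moreover have "q k \<in> {0..\<nu>0}" using q(1) \<open>Q \<subseteq> _\<close> by blast
      ultimately show ?thesis using close elim t by (simp add: dist_real_def)
    qed
    then show ?case by auto
  qed
qed

context burgers_path
begin

context
  fixes Q :: "real set" and y :: "real \<Rightarrow> real \<Rightarrow> real^'n \<Rightarrow> real^'n"
  assumes Q: "Q \<subseteq> {0<..\<nu>0}" "{0..\<nu>0} \<subseteq> closure Q" and sol: "\<And>\<mu>. \<mu> \<in> Q \<Longrightarrow> path_sol 2 \<mu> (y \<mu>)"
begin

lemma Q_range: "Q \<subseteq> {0..\<nu>0}" and Q_pos: "\<mu> \<in> Q \<Longrightarrow> 0 < \<mu>" "\<mu> \<in> Q \<Longrightarrow> \<mu> \<le> \<nu>0"
  using Q(1) by auto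

lemma approximating_viscosities:
  assumes "\<nu> \<in> {0..\<nu>0}"
  obtains q :: "nat \<Rightarrow> real" where "\<And>k. q k \<in> Q" "q \<longlonglongrightarrow> \<nu>"
proof -
  have "\<nu> \<in> closure Q" using assms Q(2) by blast
  then show thesis using that unfolding closure_sequential by blast
qed

lemma viscosity_extension_exists: "\<exists>C Y. viscosity_extension \<nu>0 Q \<tau> y C Y"
proof -
  let ?C = viscosity_constant
  have "\<exists>g. ?C-lipschitz_on {0..\<nu>0} g \<and> (\<forall>\<mu>\<in>Q. g \<mu> = y \<mu> t x)" if t: "t \<in> {0..\<tau>}" for t x
  proof -
    have "?C-lipschitz_on Q (\<lambda>\<mu>. y \<mu> t x)"
      using path_sol_viscosity_difference[OF sol _ _ _ sol Q_pos t] Q_pos viscosity_constant_nonneg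
      by (intro lipschitz_onI) (auto simp: dist_norm dist_real_def less_imp_le)
    then obtain g where "?C-lipschitz_on (closure Q) g" "\<forall>\<mu>\<in>Q. g \<mu> = y \<mu> t x"
      using lipschitz_extend_closure by blast
    then show ?thesis using lipschitz_on_subset[OF _ Q(2)] by blast
  qed
  then obtain g where "\<And>t x. t \<in> {0..\<tau>} \<Longrightarrow>
      ?C-lipschitz_on {0..\<nu>0} (g t x) \<and> (\<forall>\<mu>\<in>Q. g t x \<mu> = y \<mu> t x)" by metis
  then have "viscosity_extension \<nu>0 Q \<tau> y ?C (\<lambda>\<nu> t x. g t x \<nu>)"
    by (simp add: viscosity_extension_def)
  then show ?thesis by blast
qed

context
  fixes C Y
  assumes ext: "viscosity_extension \<nu>0 Q \<tau> y C Y"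
begin

lemma viscosity_extension_unique:
  assumes \<tau>': "0 \<le> \<tau>'" "\<tau>' \<le> \<tau>" and z: "burgers_path_sol \<beta> f h \<eta> \<tau>' l \<nu> z" "1 \<le> l" "\<nu> \<noteq> 0 \<Longrightarrow> 2 \<le> l"
    and \<nu>: "\<nu> \<in> {0..\<nu>0}" and t: "t \<in> {0..\<tau>'}"
  shows "z t x = Y \<nu> t x"
proof -
  interpret sub: burgers_path \<tau>' R N L \<beta> \<nu>0 f h \<eta>
    using burgers_path_axioms \<tau>' by (rule burgers_path_subinterval)
  obtain q where q: "\<And>k. q k \<in> Q" "q \<longlonglongrightarrow> \<nu>" using approximating_viscosities[OF \<nu>] by blast
  have dist: "norm (z t x - y (q k) t x) \<le> sub.viscosity_constant * \<bar>\<nu> - q k\<bar>" for k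
    using sub.path_sol_viscosity_difference[OF z _
        burgers_path_sol_subinterval[OF sol[OF q(1)] \<tau>'(2)]
        Q_pos[OF q(1)] t] \<nu> by simp
  have null: "(\<lambda>k. sub.viscosity_constant * \<bar>\<nu> - q k\<bar>) \<longlonglongrightarrow> 0"
    using tendsto_mult_right_zero[OF tendsto_rabs_zero[OF LIM_zero[OF q(2)]]]
    by (simp add: abs_minus_commute)
  have "(\<lambda>k. z t x - y (q k) t x) \<longlonglongrightarrow> 0"
    by (rule Lim_null_comparison[OF always_eventually[OF allI[OF dist]] null])
  from tendsto_diff[OF tendsto_const[of "z t x"] this] have "(\<lambda>k. y (q k) t x) \<longlonglongrightarrow> z t x" by simp
  moreover have "(\<lambda>k. y (q k) t x) \<longlonglongrightarrow> Y \<nu> t x"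
    using tendsto_uniform_limitI[OF viscosity_extension_uniform_limit[OF ext Q_range \<nu> q],
      of "(t, x)"] t \<tau>' by simp
  ultimately show ?thesis by (rule LIMSEQ_unique)
qed

lemma viscosity_extension_inviscid:
  assumes "0 \<le> \<nu>0"
  shows "path_sol 1 0 (Y 0)"
proof -
  have zero: "0 \<in> {0..\<nu>0}" using assms by simp
  then obtain q where q: "\<And>k. q k \<in> Q" "q \<longlonglongrightarrow> 0" using approximating_viscosities by blast
  show ?thesis
    by (rule path_sol_inviscid_limit[OF sol[OF q(1)] Q_pos[OF q(1)] q(2)
          viscosity_extension_uniform_limit[OF ext Q_range zero q]])
qed

lemma viscosity_extension_continuous_bounded:
  assumes "\<nu> \<in> {0..\<nu>0}"
  shows "continuous_on ({0..\<tau>} \<times> UNIV) (\<lambda>(t, x). Y \<nu> t x)"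
    and "bounded ((\<lambda>(t, x). Y \<nu> t x) ` ({0..\<tau>} \<times> UNIV))"
proof -
  obtain q where q: "\<And>k. q k \<in> Q" "q \<longlonglongrightarrow> \<nu>" using approximating_viscosities[OF assms] by blast
  note lim = viscosity_extension_uniform_limit[OF ext Q_range assms q]
  have "Cb_hoelder \<beta> 2 0 \<tau> (y (q k))" for k using sol[OF q(1)] by (simp add: burgers_path_sol_def)
  then have "continuous_on ({0..\<tau>} \<times> UNIV) (\<lambda>(t, x). pds [] (y (q k) t) x)"
    and "bounded ((\<lambda>(t, x). pds [] (y (q k) t) x) ` ({0..\<tau>} \<times> UNIV))" for k
    unfolding Cb_hoelder_def by (metis empty_set empty_subsetI list.size(3) zero_le_numeral)+
  then show "continuous_on ({0..\<tau>} \<times> UNIV) (\<lambda>(t, x). Y \<nu> t x)"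
    and "bounded ((\<lambda>(t, x). Y \<nu> t x) ` ({0..\<tau>} \<times> UNIV))"
    using uniform_limit_theorem[OF _ lim] uniform_limit_bounded[OF lim] by simp_all
qed

end

end

end

section \<open>Measurability of derivatives, integrals and suprema\<close>

lemma borel_measurable_pds:
  fixes u :: "'w \<Rightarrow> 'x::euclidean_space \<Rightarrow> 'b::euclidean_space"
  assumes meas: "\<And>x. (\<lambda>\<omega>. u \<omega> x) \<in> borel_measurable N"
    and deriv: "\<And>\<omega>. \<omega> \<in> space N \<Longrightarrow> has_pds_upto l (u \<omega>)"
    and "set \<alpha> \<subseteq> Basis" "length \<alpha> \<le> l"
  shows "(\<lambda>\<omega>. pds \<alpha> (u \<omega>) x) \<in> borel_measurable N"
  using assms(3,4)
proof (induction \<alpha> arbitrary: x)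
  case Nil
  then show ?case using meas by simp
next
  case (Cons i \<alpha>)
  have IH: "(\<lambda>\<omega>. pds \<alpha> (u \<omega>) x) \<in> borel_measurable N" for x using Cons by auto
  show ?case
  proof (rule borel_measurable_LIMSEQ_metric)
    show "(\<lambda>\<omega>. real (Suc k) *\<^sub>R fdiff ((1 / real (Suc k)) *\<^sub>R i) (pds \<alpha> (u \<omega>)) x)
        \<in> borel_measurable N" for k
      unfolding fdiff_def
      by (intro borel_measurable_scaleR borel_measurable_diff borel_measurable_const IH)
    show "(\<lambda>k. real (Suc k) *\<^sub>R fdiff ((1 / real (Suc k)) *\<^sub>R i) (pds \<alpha> (u \<omega>)) x)
        \<longlonglongrightarrow> pds (i # \<alpha>) (u \<omega>) x"
      if "\<omega> \<in> space N" for \<omega>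
      using deriv[OF that] Cons.prems by (intro has_dir_deriv_LIMSEQ has_pds_upto_dir_deriv) auto
  qed
qed

lemma floor_quotient_LIMSEQ: "(\<lambda>k. real_of_int \<lfloor>real (Suc k) * s\<rfloor> / real (Suc k)) \<longlonglongrightarrow> s"
proof (rule LIM_zero_cancel, rule Lim_null_comparison[OF _ LIMSEQ_Suc[OF lim_1_over_n]])
  have "\<bar>real_of_int \<lfloor>c * s\<rfloor> / c - s\<bar> \<le> 1 / c" if "0 < c" for c :: real
  proof -
    have "real_of_int \<lfloor>c * s\<rfloor> / c - s = - (frac (c * s) / c)"
      using that by (simp add: frac_def field_simps)
    then show ?thesis using that frac_lt_1[of "c * s"] frac_ge_0[of "c * s"]
      by (simp add: divide_right_mono)
  qed
  from this[of "real (Suc _)"]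
  show "\<forall>\<^sub>F k in sequentially. norm (real_of_int \<lfloor>real (Suc k) * s\<rfloor> / real (Suc k) - s)
      \<le> 1 / real (Suc k)" by simp
qed

lemma borel_measurable_pair_continuous:
  fixes g :: "real \<Rightarrow> 'w \<Rightarrow> 'b::metric_space"
  assumes meas: "\<And>s. g s \<in> borel_measurable N"
    and cont: "\<And>\<omega>. \<omega> \<in> space N \<Longrightarrow> continuous_on UNIV (\<lambda>s. g s \<omega>)"
  shows "(\<lambda>(\<omega>, s). g s \<omega>) \<in> borel_measurable (N \<Otimes>\<^sub>M lborel)"
proof (rule borel_measurable_LIMSEQ_metric)
  fix k
  have "(\<lambda>z. g (real_of_int i / real (Suc k)) (fst z)) \<in> borel_measurable (N \<Otimes>\<^sub>M lborel)" for i
    by (rule measurable_compose[OF measurable_fst meas])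
  moreover have "(\<lambda>z. \<lfloor>real (Suc k) * snd z\<rfloor>) \<in> measurable (N \<Otimes>\<^sub>M lborel) (count_space UNIV)"
    by measurable
  ultimately show "(\<lambda>z. g (real_of_int \<lfloor>real (Suc k) * snd z\<rfloor> / real (Suc k)) (fst z))
      \<in> borel_measurable (N \<Otimes>\<^sub>M lborel)"
    by (rule measurable_compose_countable)
next
  fix z :: "'w \<times> real" assume "z \<in> space (N \<Otimes>\<^sub>M lborel)"
  then have "continuous_on UNIV (\<lambda>s. g s (fst z))" using cont by (auto simp: space_pair_measure)
  from continuous_on_tendsto_compose[OF this floor_quotient_LIMSEQ]
  show "(\<lambda>k. g (real_of_int \<lfloor>real (Suc k) * snd z\<rfloor> / real (Suc k)) (fst z))
      \<longlonglongrightarrow> (case z of (\<omega>, s) \<Rightarrow> g s \<omega>)"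
    by (simp add: case_prod_beta)
qed

lemma borel_measurable_integral_continuous:
  fixes g :: "real \<Rightarrow> 'w \<Rightarrow> 'b::euclidean_space"
  assumes "a \<le> b" and meas: "\<And>s. s \<in> {a..b} \<Longrightarrow> g s \<in> borel_measurable N"
    and cont: "\<And>\<omega>. \<omega> \<in> space N \<Longrightarrow> continuous_on {a..b} (\<lambda>s. g s \<omega>)"
  shows "(\<lambda>\<omega>. integral {a..b} (\<lambda>s. g s \<omega>)) \<in> borel_measurable N"
proof -
  define clamp where "clamp s = max a (min b s)" for s
  have clamp: "clamp s \<in> {a..b}" for s using \<open>a \<le> b\<close> by (auto simp: clamp_def)
  have "continuous_on UNIV (\<lambda>s. g (clamp s) \<omega>)" if "\<omega> \<in> space N" for \<omega>
    using clamp by (intro continuous_on_compose2[OF cont[OF that]])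
      (auto simp: clamp_def intro!: continuous_intros)
  then have "(\<lambda>(\<omega>, s). g (clamp s) \<omega>) \<in> borel_measurable (N \<Otimes>\<^sub>M lborel)"
    by (intro borel_measurable_pair_continuous meas clamp)
  then have "(\<lambda>\<omega>. \<integral>s. indicator {a..b} s *\<^sub>R g (clamp s) \<omega> \<partial>lborel) \<in> borel_measurable N"
    by (intro lborel.borel_measurable_lebesgue_integral) (simp add: case_prod_beta)
  moreover have "(\<integral>s. indicator {a..b} s *\<^sub>R g (clamp s) \<omega> \<partial>lborel) = integral {a..b} (\<lambda>s. g s \<omega>)"
    if "\<omega> \<in> space N" for \<omega>
  proof -
    have "(\<integral>s. indicator {a..b} s *\<^sub>R g (clamp s) \<omega> \<partial>lborel)
        = (\<integral>s. indicator {a..b} s *\<^sub>R g s \<omega> \<partial>lborel)"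
      by (intro Bochner_Integration.integral_cong) (auto simp: indicator_def clamp_def)
    then show ?thesis
      using set_borel_integral_eq_integral(2)[OF borel_integrable_atLeastAtMost'[OF cont[OF that]]]
      by (simp add: set_lebesgue_integral_def)
  qed
  ultimately show ?thesis by (simp cong: measurable_cong)
qed

definition running_norm :: "(real \<Rightarrow> 'x \<Rightarrow> 'b::real_normed_vector) \<Rightarrow> real \<Rightarrow> real" where
  "running_norm u t = (SUP (s, x)\<in>{0..t} \<times> UNIV. norm (u s x))"

lemma running_norm_least:
  assumes "0 \<le> t" "\<And>s x. s \<in> {0..t} \<Longrightarrow> norm (u s x) \<le> c"
  shows "running_norm u t \<le> c"
  unfolding running_norm_def using assms by (intro cSUP_least) auto

context
  fixes u :: "real \<Rightarrow> 'x \<Rightarrow> 'b::real_normed_vector" and T C :: real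
  assumes bounded: "\<And>t x. t \<in> {0..T} \<Longrightarrow> norm (u t x) \<le> C"
begin

lemma norm_le_running_norm:
  assumes "t \<in> {0..T}" "s \<in> {0..t}"
  shows "norm (u s x) \<le> running_norm u t"
proof -
  have "bdd_above ((\<lambda>(s, x). norm (u s x)) ` ({0..t} \<times> UNIV))"
    using bounded assms by (intro bdd_aboveI[of _ C]) auto
  then show ?thesis
    unfolding running_norm_def using cSUP_upper[of "(s, x)" "{0..t} \<times> UNIV"] assms by fastforce
qed

lemma running_norm_mono:
  assumes "t \<in> {0..T}" "s \<in> {0..t}"
  shows "running_norm u s \<le> running_norm u t"
  using assms by (intro running_norm_least norm_le_running_norm) auto

lemma running_norm_nonneg:
  assumes "t \<in> {0..T}"
  shows "0 \<le> running_norm u t"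
  by (rule order_trans[OF norm_ge_zero norm_le_running_norm[of t 0]]) (use assms in auto)

lemma continuous_on_running_norm:
  assumes equi: "time_equicontinuous_on {0..T} u"
  shows "continuous_on {0..T} (running_norm u)"
  unfolding continuous_on_iff
proof (intro ballI allI impI)
  fix t e :: real assume t: "t \<in> {0..T}" and "0 < e"
  then obtain d where "0 < d"
    and close: "\<And>s t x. s \<in> {0..T} \<Longrightarrow> t \<in> {0..T} \<Longrightarrow> \<bar>t - s\<bar> < d \<Longrightarrow> norm (u t x - u s x) \<le> e / 2"
    using time_equicontinuous_onE[OF equi, of "e / 2"] by auto
  have running_norm_close: "running_norm u t \<le> running_norm u s + e / 2"
    if st: "s \<in> {0..T}" "t \<in> {0..T}" "\<bar>t - s\<bar> < d" for s t
  proof (rule running_norm_least)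
    fix r x assume r: "r \<in> {0..t}"
    have "norm (u r x) \<le> norm (u (min r s) x) + norm (u r x - u (min r s) x)"
      by (rule norm_triangle_sub)
    also have "\<dots> \<le> running_norm u s + e / 2"
      using st r by (intro add_mono norm_le_running_norm close) auto
    finally show "norm (u r x) \<le> running_norm u s + e / 2" .
  qed (use st in auto)
  show "\<exists>d>0. \<forall>s\<in>{0..T}. dist s t < d \<longrightarrow> dist (running_norm u s) (running_norm u t) < e"
  proof (intro exI[of _ d] conjI ballI impI)
    fix s assume "s \<in> {0..T}" "dist s t < d"
    then have "running_norm u t \<le> running_norm u s + e / 2"
      and "running_norm u s \<le> running_norm u t + e / 2"
      using running_norm_close[of s t] running_norm_close[of t s] t
      by (auto simp: dist_real_def abs_minus_commute)
    then show "dist (running_norm u s) (running_norm u t) < e"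
      using \<open>0 < e\<close> by (auto simp: dist_real_def)
  qed (rule \<open>0 < d\<close>)
qed

end

lemma borel_measurable_running_norm:
  fixes u :: "'w \<Rightarrow> real \<Rightarrow> 'x::euclidean_space \<Rightarrow> 'b::real_normed_vector"
  assumes "0 \<le> t" and meas: "\<And>s x. s \<in> {0..t} \<Longrightarrow> (\<lambda>\<omega>. u \<omega> s x) \<in> borel_measurable N"
    and cont: "\<And>\<omega>. \<omega> \<in> space N \<Longrightarrow> continuous_on ({0..t} \<times> UNIV) (\<lambda>(s, x). u \<omega> s x)"
    and bounded: "\<And>\<omega> s x. \<omega> \<in> space N \<Longrightarrow> s \<in> {0..t} \<Longrightarrow> norm (u \<omega> s x) \<le> C \<omega>"
  shows "(\<lambda>\<omega>. running_norm (u \<omega>) t) \<in> borel_measurable N"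
proof -
  obtain D :: "(real \<times> 'x) set" where countable: "countable D"
    and subset: "D \<subseteq> {0..t} \<times> UNIV" and dense: "{0..t} \<times> UNIV \<subseteq> closure D"
    using separable[of "{0..t} \<times> (UNIV :: 'x set)"] by blast
  have closure: "closure D = {0..t} \<times> UNIV"
    using subset dense closure_minimal[OF subset] by (auto intro!: closed_Times)
  have bdd: "bdd_above ((\<lambda>(s, x). norm (u \<omega> s x)) ` D)" if "\<omega> \<in> space N" for \<omega>
    using bounded[OF that] subset by (intro bdd_aboveI[of _ "C \<omega>"]) auto
  have "running_norm (u \<omega>) t = (SUP (s, x)\<in>D. norm (u \<omega> s x))" if \<omega>: "\<omega> \<in> space N" for \<omega>
  proof (rule antisym)
    show "running_norm (u \<omega>) t \<le> (SUP (s, x)\<in>D. norm (u \<omega> s x))"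
    proof (rule running_norm_least[OF \<open>0 \<le> t\<close>])
      fix s and x :: 'x assume s: "s \<in> {0..t}"
      have "(\<lambda>(s, x). norm (u \<omega> s x)) (s, x) \<le> (SUP (s, x)\<in>D. norm (u \<omega> s x))"
      proof (rule continuous_le_on_closure[where f="\<lambda>(s, x). norm (u \<omega> s x)" and S=D])
        show "continuous_on (closure D) (\<lambda>(s, x). norm (u \<omega> s x))"
          using continuous_on_norm[OF cont[OF \<omega>]] by (simp add: closure case_prod_beta)
      qed (use s closure cSUP_upper[OF _ bdd[OF \<omega>]] in auto)
      then show "norm (u \<omega> s x) \<le> (SUP (s, x)\<in>D. norm (u \<omega> s x))" by simp
    qed
    have "D \<noteq> {}" using dense \<open>0 \<le> t\<close> by auto
    then show "(SUP (s, x)\<in>D. norm (u \<omega> s x)) \<le> running_norm (u \<omega>) t"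
      using subset \<open>0 \<le> t\<close> by (intro cSUP_least)
        (auto intro!: norm_le_running_norm[OF bounded[OF \<omega>]])
  qed
  moreover have "(\<lambda>\<omega>. SUP (s, x)\<in>D. norm (u \<omega> s x)) \<in> borel_measurable N"
    using countable subset bdd measurable_compose[OF meas borel_measurable_norm]
    by (intro borel_measurable_cSUP) (auto simp: case_prod_beta)
  ultimately show ?thesis by (simp cong: measurable_cong)
qed

section \<open>First passage times\<close>

definition first_passage :: "real \<Rightarrow> (real \<Rightarrow> real) \<Rightarrow> real" where
  "first_passage T X = Inf (insert T {t \<in> {0..T}. 1 \<le> X t})"

context
  fixes T :: real and X :: "real \<Rightarrow> real"
  assumes T: "0 \<le> T" and cont: "continuous_on {0..T} X"
begin

lemma first_passage_le: "t \<in> {0..T} \<Longrightarrow> 1 \<le> X t \<Longrightarrow> first_passage T X \<le> t"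
  unfolding first_passage_def using T by (intro cInf_lower bdd_belowI[of _ 0]) auto

lemma first_passage_attained:
  shows "first_passage T X \<in> {0..T}" and "first_passage T X < T \<Longrightarrow> 1 \<le> X (first_passage T X)"
proof -
  have "closed {t \<in> {0..T}. 1 \<le> X t}"
    using continuous_closed_preimage[OF cont closed_atLeastAtMost closed_atLeast[of 1]]
    by (simp add: vimage_def Int_def conj_commute)
  then have "first_passage T X \<in> insert T {t \<in> {0..T}. 1 \<le> X t}"
    unfolding first_passage_def using T by (intro closed_contains_Inf bdd_belowI[of _ 0]) auto
  then show "first_passage T X \<in> {0..T}" and "first_passage T X < T \<Longrightarrow> 1 \<le> X (first_passage T X)"
    using T by auto
qed

lemma first_passage_pos:
  assumes "0 < T" "X 0 < 1"
  shows "0 < first_passage T X"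
  using first_passage_attained assms by (cases "first_passage T X = 0") auto

lemma at_first_passage_le:
  assumes "X 0 < 1"
  shows "X (first_passage T X) \<le> 1"
proof (rule ccontr)
  let ?S = "first_passage T X"
  assume "\<not> X ?S \<le> 1"
  moreover have "continuous_on {0..?S} X"
    using cont first_passage_attained(1) by (auto elim: continuous_on_subset)
  ultimately obtain r where r: "0 \<le> r" "r \<le> ?S" "X r = 1"
    using IVT'[of X 0 1 ?S] assms first_passage_attained(1) by auto
  then have "?S \<le> r" using first_passage_attained(1) by (intro first_passage_le) auto
  then show False using r \<open>\<not> X ?S \<le> 1\<close> by simp
qed

lemma first_passage_le_iff:
  assumes mono: "\<And>s t. t \<in> {0..T} \<Longrightarrow> s \<in> {0..t} \<Longrightarrow> X s \<le> X t" and t: "0 \<le> t" "t < T"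
  shows "first_passage T X \<le> t \<longleftrightarrow> 1 \<le> X t"
  using first_passage_attained first_passage_le[of t] mono[of t "first_passage T X"] t by force

end

lemma stopping_time_first_passage:
  fixes X :: "'w \<Rightarrow> real \<Rightarrow> real"
  assumes "0 \<le> T" and G_sets: "\<And>t. G \<in> sets (F t)"
    and adapted: "\<And>t. t \<in> {0..T} \<Longrightarrow> (\<lambda>\<omega>. X \<omega> t) \<in> borel_measurable (restrict_space (F t) G)"
    and cont: "\<And>\<omega>. \<omega> \<in> G \<Longrightarrow> continuous_on {0..T} (X \<omega>)"
    and mono: "\<And>\<omega> s t. \<omega> \<in> G \<Longrightarrow> t \<in> {0..T} \<Longrightarrow> s \<in> {0..t} \<Longrightarrow> X \<omega> s \<le> X \<omega> t"
  shows "stopping_time F (\<lambda>\<omega>. if \<omega> \<in> G then first_passage T (X \<omega>) else T)" (is "stopping_time F ?S")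
proof
  fix t
  have G_space: "G \<inter> space (F t) = G" using sets.sets_into_space[OF G_sets[of t]] by blast
  have range: "?S \<omega> \<in> {0..T}" for \<omega>
    using first_passage_attained(1)[OF \<open>0 \<le> T\<close> cont] \<open>0 \<le> T\<close> by simp
  have "{\<omega> \<in> space (F t). ?S \<omega> \<le> t} \<in> sets (F t)"
  proof -
    consider "t < 0" | "T \<le> t" | "0 \<le> t" "t < T" by linarith
    then show ?thesis
    proof cases
      case 1
      then have "\<not> ?S \<omega> \<le> t" for \<omega> using range[of \<omega>] unfolding atLeastAtMost_iff by linarith
      then have "{\<omega> \<in> space (F t). ?S \<omega> \<le> t} = {}" by blast
      then show ?thesis by (simp only: sets.empty_sets)
    next
      case 2
      then have "?S \<omega> \<le> t" for \<omega> using range[of \<omega>] unfolding atLeastAtMost_iff by linarith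
      then have "{\<omega> \<in> space (F t). ?S \<omega> \<le> t} = space (F t)" by blast
      then show ?thesis by (simp only: sets.top)
    next
      case 3
      then have "{\<omega> \<in> space (F t). ?S \<omega> \<le> t} = {\<omega> \<in> space (restrict_space (F t) G). 1 \<le> X \<omega> t}"
        using first_passage_le_iff[OF \<open>0 \<le> T\<close> cont mono] G_space
        by (auto simp: space_restrict_space)
      also have "\<dots> \<in> sets (restrict_space (F t) G)"
        using 3 by (intro borel_measurable_le borel_measurable_const adapted) auto
      finally show ?thesis using sets_restrict_space_iff[of G "F t"] G_sets G_space by simp
    qed
  qed
  then show "Measurable.pred (F t) (\<lambda>\<omega>. ?S \<omega> \<le> t)" by (simp add: pred_def)
qed

section \<open>Filtrations\<close>

lemma (in filtration) borel_measurable_mono: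
  assumes "g \<in> borel_measurable (F s)" "s \<le> t"
  shows "g \<in> borel_measurable (F t)"
  using measurable_mono[OF order_refl refl sets_F_mono[OF assms(2)]] assms(1)
  by (auto simp: space_F)

lemma (in filtration) filtration_restrict_space:
  assumes "G \<subseteq> \<Omega>"
  shows "filtration G (\<lambda>t. restrict_space (F t) G)"
proof
  show "space (restrict_space (F t) G) = G" for t
    using assms by (auto simp: space_restrict_space space_F)
  show "sets (restrict_space (F s) G) \<subseteq> sets (restrict_space (F t) G)" if "s \<le> t" for s t
    unfolding sets_restrict_space using sets_F_mono[OF that] by (rule image_mono)
qed

lemma sets_FB:
  assumes "F0 \<subseteq> sets M"
  shows "sets (FB M B F0 t) = sigma_sets (space M) (nat_sets M B t \<union> F0 \<union> null_sets M)"
proof -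
  have "nat_sets M B t \<union> F0 \<union> null_sets M \<subseteq> Pow (space M)"
    using assms sets.space_closed[of M] by (auto simp: nat_sets_def null_sets_def)
  then show ?thesis by (simp add: FB_def)
qed

lemma filtration_FB:
  assumes "F0 \<subseteq> sets M"
  shows "filtration (space M) (FB M B F0)"
proof
  show "space (FB M B F0 t) = space M" for t by (simp add: FB_def space_measure_of_conv)
  show "sets (FB M B F0 s) \<subseteq> sets (FB M B F0 t)" if "s \<le> t" for s t
  proof -
    have "nat_sets M B s \<subseteq> nat_sets M B t" unfolding nat_sets_def using that order_trans by blast
    then show ?thesis unfolding sets_FB[OF assms] by (intro sigma_sets_mono') blast
  qed
qed

lemma null_sets_FB: "F0 \<subseteq> sets M \<Longrightarrow> A \<in> null_sets M \<Longrightarrow> A \<in> sets (FB M B F0 t)"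
  unfolding sets_FB by (intro sigma_sets.Basic) auto

lemma borel_measurable_FB:
  assumes "F0 \<subseteq> sets M" and g: "g \<in> borel_measurable (sigma (space M) F0)"
  shows "g \<in> borel_measurable (FB M B F0 t)"
proof -
  have "F0 \<subseteq> Pow (space M)" using assms(1) sets.space_closed[of M] by (rule subset_trans)
  then have "sets (sigma (space M) F0) \<subseteq> sets (FB M B F0 t)"
    by (simp add: sets_FB[OF assms(1)]) (rule sigma_sets_mono', auto)
  moreover have "space (sigma (space M) F0) = space (FB M B F0 t)"
    by (simp add: filtration.space_F[OF filtration_FB[OF assms(1)]] space_measure_of_conv)
  ultimately show ?thesis using measurable_mono[OF order_refl refl] g by blast
qed

lemma AE_conull_FB:
  assumes "F0 \<subseteq> sets M" and "AE \<omega> in M. P \<omega>"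
  obtains G where "\<And>t. G \<in> sets (FB M B F0 t)" "AE \<omega> in M. \<omega> \<in> G" "\<And>\<omega>. \<omega> \<in> G \<Longrightarrow> P \<omega>"
proof -
  obtain A where off_A: "\<And>\<omega>. \<omega> \<in> space M - A \<Longrightarrow> P \<omega>" and null: "A \<in> null_sets M"
    using AE_E3[OF assms(2)] by blast
  have "space M - A \<in> sets (FB M B F0 t)" for t
    using sets.compl_sets[OF null_sets_FB[OF assms(1) null]]
      filtration.space_F[OF filtration_FB[OF assms(1)]] by metis
  moreover have "AE \<omega> in M. \<omega> \<in> space M - A"
    using AE_not_in[OF null] AE_space by eventually_elim simp
  ultimately show thesis using off_A that by blast
qed

section \<open>The running size of the noise\<close>

definition running_Cb_norm :: "nat \<Rightarrow> (real \<Rightarrow> 'x::euclidean_space \<Rightarrow> 'b::real_normed_vector) \<Rightarrow>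
    real \<Rightarrow> real" where
  "running_Cb_norm l u t = (\<Sum>\<alpha>\<in>multi_indices l. running_norm (\<lambda>s. pds \<alpha> (u s)) t)"

lemma finite_multi_indices: "finite (multi_indices l)"
  unfolding multi_indices_def by (rule finite_lists_length_le) simp

context
  fixes u :: "real \<Rightarrow> 'x::euclidean_space \<Rightarrow> 'b::real_normed_vector" and \<beta> T :: real and l m :: nat
  assumes u: "Cb_hoelder \<beta> m 0 T u" and l: "l < m"
begin

lemma bounded_pds_on_strip:
  obtains C where "\<And>\<alpha> t x. \<alpha> \<in> multi_indices l \<Longrightarrow> t \<in> {0..T} \<Longrightarrow> norm (pds \<alpha> (u t) x) \<le> C"
proof -
  obtain C where "\<And>t. t \<in> {0..T} \<Longrightarrow> pds_bounded_by m C (u t)"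
    using Cb_hoelder_pds_bounded_by[OF u] by blast
  then have "norm (pds \<alpha> (u t) x) \<le> C" if "\<alpha> \<in> multi_indices l" "t \<in> {0..T}" for \<alpha> t x
    using that l by (intro norm_pds_le) (auto simp: multi_indices_def)
  then show thesis by (rule that)
qed

lemma running_Cb_norm_nonneg:
  assumes "t \<in> {0..T}"
  shows "0 \<le> running_Cb_norm l u t"
proof -
  obtain C where bound: "\<And>\<alpha> t x. \<alpha> \<in> multi_indices l \<Longrightarrow> t \<in> {0..T} \<Longrightarrow> norm (pds \<alpha> (u t) x) \<le> C"
    by (rule bounded_pds_on_strip) blast
  show ?thesis unfolding running_Cb_norm_def
    by (intro sum_nonneg running_norm_nonneg[OF bound assms])
qed

lemma running_Cb_norm_mono:
  assumes "t \<in> {0..T}" "s \<in> {0..t}"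
  shows "running_Cb_norm l u s \<le> running_Cb_norm l u t"
proof -
  obtain C where bound: "\<And>\<alpha> t x. \<alpha> \<in> multi_indices l \<Longrightarrow> t \<in> {0..T} \<Longrightarrow> norm (pds \<alpha> (u t) x) \<le> C"
    by (rule bounded_pds_on_strip) blast
  show ?thesis unfolding running_Cb_norm_def by (intro sum_mono running_norm_mono[OF bound assms])
qed

lemma pds_bounded_by_running_Cb_norm:
  assumes "t \<in> {0..T}" "s \<in> {0..t}"
  shows "pds_bounded_by l (running_Cb_norm l u t) (u s)"
  unfolding pds_bounded_by_def
proof (intro conjI allI impI)
  have "has_pds_upto m (u s)" using Cb_hoelder_pds_upto[OF u] assms by auto
  then show "has_pds_upto l (u s)" using l unfolding has_pds_upto_def by (meson less_trans)
  fix \<alpha> x assume "set \<alpha> \<subseteq> (Basis :: 'x set) \<and> length \<alpha> \<le> l"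
  then have \<alpha>: "\<alpha> \<in> multi_indices l" by (simp add: multi_indices_def)
  obtain C where bound: "\<And>\<alpha> t x. \<alpha> \<in> multi_indices l \<Longrightarrow> t \<in> {0..T} \<Longrightarrow> norm (pds \<alpha> (u t) x) \<le> C"
    by (rule bounded_pds_on_strip) blast
  have "norm (pds \<alpha> (u s) x) \<le> running_norm (\<lambda>s. pds \<alpha> (u s)) t"
    by (rule norm_le_running_norm[OF bound[OF \<alpha>] assms])
  also have "\<dots> \<le> running_Cb_norm l u t"
    unfolding running_Cb_norm_def using \<alpha> finite_multi_indices
    by (intro member_le_sum) (auto intro: running_norm_nonneg[OF bound assms(1)])
  finally show "norm (pds \<alpha> (u s) x) \<le> running_Cb_norm l u t" .
qed

lemma continuous_on_running_Cb_norm: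
  assumes "0 < \<beta>"
  shows "continuous_on {0..T} (running_Cb_norm l u)"
proof -
  obtain C where bound: "\<And>\<alpha> t x. \<alpha> \<in> multi_indices l \<Longrightarrow> t \<in> {0..T} \<Longrightarrow> norm (pds \<alpha> (u t) x) \<le> C"
    by (rule bounded_pds_on_strip) blast
  have "continuous_on {0..T} (running_norm (\<lambda>s. pds \<alpha> (u s)))" if "\<alpha> \<in> multi_indices l" for \<alpha>
    using that l \<open>0 < \<beta>\<close>
    by (intro continuous_on_running_norm[OF bound[OF that]]
      Cb_hoelder_pds_time_equicontinuous_on[OF u])
      (auto simp: multi_indices_def)
  then show ?thesis unfolding running_Cb_norm_def[abs_def] by (intro continuous_on_sum)
qed

end

lemma borel_measurable_running_Cb_norm:
  fixes u :: "'w \<Rightarrow> real \<Rightarrow> 'x::euclidean_space \<Rightarrow> 'b::euclidean_space"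
  assumes "0 \<le> t" and meas: "\<And>s x. s \<in> {0..t} \<Longrightarrow> (\<lambda>\<omega>. u \<omega> s x) \<in> borel_measurable N"
    and u: "\<And>\<omega>. \<omega> \<in> space N \<Longrightarrow> Cb_hoelder \<beta> l 0 t (u \<omega>)"
  shows "(\<lambda>\<omega>. running_Cb_norm l (u \<omega>) t) \<in> borel_measurable N"
  unfolding running_Cb_norm_def
proof (rule borel_measurable_sum)
  fix \<alpha> :: "'x list" assume "\<alpha> \<in> multi_indices l"
  then have \<alpha>: "set \<alpha> \<subseteq> Basis" "length \<alpha> \<le> l" by (auto simp: multi_indices_def)
  have "\<exists>C. \<forall>s\<in>{0..t}. \<forall>x. norm (pds \<alpha> (u \<omega> s) x) \<le> C" if "\<omega> \<in> space N" for \<omega>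
    using Cb_hoelder_pds_bounded_by[OF u[OF that]] \<alpha> by (meson norm_pds_le)
  then obtain C where bound: "\<And>\<omega> s x. \<omega> \<in> space N \<Longrightarrow> s \<in> {0..t} \<Longrightarrow> norm (pds \<alpha> (u \<omega> s) x) \<le> C \<omega>"
    by metis
  show "(\<lambda>\<omega>. running_norm (\<lambda>s. pds \<alpha> (u \<omega> s)) t) \<in> borel_measurable N"
  proof (rule borel_measurable_running_norm[OF \<open>0 \<le> t\<close> _ _ bound])
    show "(\<lambda>\<omega>. pds \<alpha> (u \<omega> s) x) \<in> borel_measurable N" if "s \<in> {0..t}" for s x
      using that by (intro borel_measurable_pds[OF meas _ \<alpha>] Cb_hoelder_pds_upto[OF u])
    show "continuous_on ({0..t} \<times> UNIV) (\<lambda>(s, x). pds \<alpha> (u \<omega> s) x)" if "\<omega> \<in> space N" for \<omega>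
      by (rule Cb_hoelder_continuous_on[OF u[OF that] \<alpha>])
  qed
qed

lemma borel_measurable_burgers_drift:
  fixes y :: "'w \<Rightarrow> real \<Rightarrow> real^'n \<Rightarrow> real^'n"
  assumes f_cont: "continuous_on ({0..T} \<times> UNIV) (\<lambda>(t, x, z). f t x z)" and s: "s \<in> {0..T}"
    and meas: "\<And>x. (\<lambda>\<omega>. y \<omega> s x) \<in> borel_measurable N"
    and deriv: "\<And>\<omega>. \<omega> \<in> space N \<Longrightarrow> has_pds_upto 2 (y \<omega> s)"
  shows "(\<lambda>\<omega>. burgers_drift f \<nu> (y \<omega>) s x) \<in> borel_measurable N"
proof -
  have "(\<lambda>\<omega>. pd k (y \<omega> s) x) \<in> borel_measurable N"
    and "(\<lambda>\<omega>. pd k (pd k (y \<omega> s)) x) \<in> borel_measurable N"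
    if "k \<in> Basis" for k
    using borel_measurable_pds[OF meas deriv, of "[k]"]
      borel_measurable_pds[OF meas deriv, of "[k, k]"] that by auto
  moreover have "continuous_on UNIV (\<lambda>z. f s x z)"
    using continuous_on_compose2[OF f_cont, of UNIV "\<lambda>z. (s, (x, z))"] s
    by (force intro!: continuous_intros)
  then have "(\<lambda>\<omega>. f s x (y \<omega> s x)) \<in> borel_measurable N"
    using measurable_compose[OF meas borel_measurable_continuous_onI] by blast
  ultimately show ?thesis
    unfolding burgers_drift_def lap_def adv_def using meas
    by (intro borel_measurable_add borel_measurable_diff borel_measurable_scaleR
        borel_measurable_sum
        borel_measurable_inner borel_measurable_const) auto
qed

text \<open>The noise can be read off from a solution, \<open>\<eta> = y - h - \<integral> drift\<close>. This yields its adaptedness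
  without going into the construction of the stochastic integral.\<close>

lemma noise_adapted:
  fixes F :: "real \<Rightarrow> 'w measure" and y \<eta> :: "'w \<Rightarrow> real \<Rightarrow> real^'n \<Rightarrow> real^'n"
  assumes "filtration G F"
    and y_meas: "\<And>t x. t \<in> {0..T} \<Longrightarrow> (\<lambda>\<omega>. y \<omega> t x) \<in> borel_measurable (F t)"
    and h_meas: "\<And>t x. (\<lambda>\<omega>. h \<omega> x) \<in> borel_measurable (F t)"
    and sol: "\<And>\<omega>. \<omega> \<in> G \<Longrightarrow> burgers_path_sol \<beta> f (h \<omega>) (\<eta> \<omega>) T 2 \<nu> (y \<omega>)"
    and f_cont: "continuous_on ({0..T} \<times> UNIV) (\<lambda>(t, x, z). f t x z)"
    and t: "t \<in> {0..T}"
  shows "(\<lambda>\<omega>. \<eta> \<omega> t x) \<in> borel_measurable (F t)"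
proof -
  interpret filtration G F by fact
  have y: "Cb_hoelder \<beta> 2 0 T (y \<omega>)" if "\<omega> \<in> G" for \<omega>
    using sol[OF that] by (simp add: burgers_path_sol_def)
  have "(\<lambda>\<omega>. integral {0..t} (\<lambda>s. burgers_drift f \<nu> (y \<omega>) s x)) \<in> borel_measurable (F t)"
  proof (rule borel_measurable_integral_continuous)
    fix s assume s: "s \<in> {0..t}"
    then have "(\<lambda>\<omega>. burgers_drift f \<nu> (y \<omega>) s x) \<in> borel_measurable (F s)"
      using t by (intro borel_measurable_burgers_drift[OF f_cont] y_meas Cb_hoelder_pds_upto[OF y])
        (auto simp: space_F)
    then show "(\<lambda>\<omega>. burgers_drift f \<nu> (y \<omega>) s x) \<in> borel_measurable (F t)"
      by (rule borel_measurable_mono) (use s in auto)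
  next
    fix \<omega> assume "\<omega> \<in> space (F t)"
    then have "continuous_on {0..T} (\<lambda>s. burgers_drift f \<nu> (y \<omega>) s x)"
      using continuous_on_burgers_drift[OF f_cont y] space_F by simp
    then show "continuous_on {0..t} (\<lambda>s. burgers_drift f \<nu> (y \<omega>) s x)"
      using t by (auto elim: continuous_on_subset)
  qed (use t in auto)
  then have "(\<lambda>\<omega>. y \<omega> t x - h \<omega> x - integral {0..t} (\<lambda>s. burgers_drift f \<nu> (y \<omega>) s x))
      \<in> borel_measurable (F t)"
    by (intro borel_measurable_diff y_meas[OF t] h_meas)
  moreover have "\<eta> \<omega> t x = y \<omega> t x - h \<omega> x - integral {0..t} (\<lambda>s. burgers_drift f \<nu> (y \<omega>) s x)"
    if "\<omega> \<in> space (F t)" for \<omega>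
    using sol[of \<omega>] that space_F t unfolding burgers_path_sol_def by (simp add: algebra_simps)
  ultimately show ?thesis by (simp cong: measurable_cong)
qed

section \<open>The stochastic equation\<close>

lemma burgers_sol_iff:
  "burgers_sol M F T \<beta> l \<nu> f h \<eta> S y \<longleftrightarrow>
     (\<forall>t\<in>{0..T}. \<forall>x. (\<lambda>\<omega>. if t \<le> S \<omega> then y \<omega> t x else 0) \<in> borel_measurable (F t)) \<and>
     (AE \<omega> in M. burgers_path_sol \<beta> f (h \<omega>) (\<eta> \<omega>) (S \<omega>) l \<nu> (y \<omega>))"
  unfolding burgers_sol_def burgers_path_sol_def burgers_drift_def ..

text \<open>Each \<open>y \<nu>\<close> solves its equation only outside a null set depending on \<open>\<nu>\<close>. The pathwise
  arguments therefore run on a set \<open>G\<close> of full measure on which \<open>y \<mu>\<close> is a solution for all \<open>\<mu>\<close> in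
  a dense set \<open>Q\<close>.\<close>

locale stochastic_burgers = filtration "space M" F
  for M :: "'w measure" and F :: "real \<Rightarrow> 'w measure" +
  fixes T \<beta> \<nu>0 K L :: real and Q :: "real set" and G :: "'w set"
    and f :: "real \<Rightarrow> real^'n \<Rightarrow> real^'n \<Rightarrow> real^'n"
    and h :: "'w \<Rightarrow> real^'n \<Rightarrow> real^'n"
    and \<eta> :: "'w \<Rightarrow> real \<Rightarrow> real^'n \<Rightarrow> real^'n"
    and y :: "real \<Rightarrow> 'w \<Rightarrow> real \<Rightarrow> real^'n \<Rightarrow> real^'n"
  assumes T_pos: "0 < T" and nu0_pos: "0 < \<nu>0" and beta: "0 < \<beta>" "\<beta> < 2"
    and Q: "Q \<subseteq> {0<..\<nu>0}" "{0..\<nu>0} \<subseteq> closure Q"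
    and G_sets: "\<And>t. G \<in> sets (F t)" and AE_G: "AE \<omega> in M. \<omega> \<in> G"
    and f_cont: "continuous_on ({0..T} \<times> UNIV) (\<lambda>(t, x, z). f t x z)"
    and f_pds: "t \<in> {0..T} \<Longrightarrow> pds_bounded_by 2 L (\<lambda>(x, z). f t x z)"
    and h_pds: "\<omega> \<in> G \<Longrightarrow> pds_bounded_by 2 K (h \<omega>)"
    and eta_hoelder: "\<omega> \<in> G \<Longrightarrow> Cb_hoelder \<beta> 4 0 T (\<eta> \<omega>)"
    and dense_sol: "\<omega> \<in> G \<Longrightarrow> \<mu> \<in> Q \<Longrightarrow> burgers_path_sol \<beta> f (h \<omega>) (\<eta> \<omega>) T 2 \<mu> (y \<mu> \<omega>)"
    and h_adapted: "(\<lambda>\<omega>. h \<omega> x) \<in> borel_measurable (F t)"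
    and y_adapted: "\<mu> \<in> Q \<Longrightarrow> t \<in> {0..T} \<Longrightarrow> (\<lambda>\<omega>. y \<mu> \<omega> t x) \<in> borel_measurable (F t)"
begin

definition data_bound :: real where
  "data_bound = 1 + \<nu>0 + real DIM(real^'n) + (real DIM((real^'n) \<times> (real^'n)))\<^sup>2 * L + \<bar>K\<bar>"

lemma data_bound: "1 \<le> data_bound" "\<nu>0 \<le> data_bound" "real DIM(real^'n) \<le> data_bound"
  "(real DIM((real^'n) \<times> (real^'n)))\<^sup>2 * L \<le> data_bound" "K \<le> data_bound"
proof -
  have "0 \<le> L" using pds_bounded_by_nonneg[OF f_pds[of 0]] T_pos by simp
  then have "0 \<le> (real DIM((real^'n) \<times> (real^'n)))\<^sup>2 * L" by simp
  then show "1 \<le> data_bound" "\<nu>0 \<le> data_bound" "real DIM(real^'n) \<le> data_bound"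
    "(real DIM((real^'n) \<times> (real^'n)))\<^sup>2 * L \<le> data_bound" "K \<le> data_bound"
    using nu0_pos unfolding data_bound_def by linarith+
qed

definition total_bound :: "'w \<Rightarrow> real \<Rightarrow> real" where
  "total_bound \<omega> t = data_bound + running_Cb_norm 3 (\<eta> \<omega>) t"

definition passage_process :: "'w \<Rightarrow> real \<Rightarrow> real" where
  "passage_process \<omega> t = 100 * t * (total_bound \<omega> t)^3"

text \<open>The passage process is continuous and increasing, so \<open>lifespan \<le> t\<close> can be decided at time
  \<open>t\<close>; the filtration need not be right-continuous.\<close>

definition lifespan :: "'w \<Rightarrow> real" where
  "lifespan \<omega> = (if \<omega> \<in> G then first_passage T (passage_process \<omega>) else T)"

lemma total_bound_ge:
  assumes "\<omega> \<in> G" "t \<in> {0..T}"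
  shows "data_bound \<le> total_bound \<omega> t"
  using running_Cb_norm_nonneg[OF eta_hoelder[OF assms(1)] _ assms(2), of 3]
  by (simp add: total_bound_def)

lemma passage_process_mono:
  assumes \<omega>: "\<omega> \<in> G" and t: "t \<in> {0..T}" "s \<in> {0..t}"
  shows "passage_process \<omega> s \<le> passage_process \<omega> t"
proof -
  have "0 \<le> total_bound \<omega> s" using total_bound_ge[OF \<omega>, of s] data_bound(1) t by auto
  moreover have "total_bound \<omega> s \<le> total_bound \<omega> t"
    using running_Cb_norm_mono[OF eta_hoelder[OF \<omega>] _ t, of 3] by (simp add: total_bound_def)
  ultimately show ?thesis
    unfolding passage_process_def using t
    by (intro mult_mono power_mono mult_nonneg_nonneg zero_le_power) auto
qed

lemma continuous_on_passage_process:
  assumes "\<omega> \<in> G"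
  shows "continuous_on {0..T} (passage_process \<omega>)"
  unfolding passage_process_def[abs_def] total_bound_def
  by (intro continuous_intros continuous_on_running_Cb_norm[OF eta_hoelder[OF assms]] beta) simp

lemma eta_adapted:
  assumes t: "t \<in> {0..T}"
  shows "(\<lambda>\<omega>. \<eta> \<omega> t x) \<in> borel_measurable (restrict_space (F t) G)"
proof -
  have "closure Q \<noteq> {}" using Q(2) nu0_pos by auto
  then obtain \<mu> where \<mu>: "\<mu> \<in> Q" by auto
  have "G \<subseteq> space M" using sets.sets_into_space[OF G_sets] space_F by blast
  show ?thesis
    by (rule noise_adapted[OF filtration_restrict_space[OF \<open>G \<subseteq> space M\<close>]
      measurable_restrict_space1[OF y_adapted[OF \<mu>]]
          measurable_restrict_space1[OF h_adapted] dense_sol[OF _ \<mu>] f_cont t])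
qed

lemma passage_process_adapted:
  assumes t: "t \<in> {0..T}"
  shows "(\<lambda>\<omega>. passage_process \<omega> t) \<in> borel_measurable (restrict_space (F t) G)"
proof -
  have "G \<subseteq> space M" using sets.sets_into_space[OF G_sets] space_F by blast
  then interpret G: filtration G "\<lambda>t. restrict_space (F t) G" by (rule filtration_restrict_space)
  have "Cb_hoelder \<beta> 3 0 t (\<eta> \<omega>)" if "\<omega> \<in> G" for \<omega>
    using Cb_hoelder_subinterval[OF eta_hoelder[OF that], of t] t
    unfolding Cb_hoelder_def has_pds_upto_def by auto
  moreover have "(\<lambda>\<omega>. \<eta> \<omega> s x) \<in> borel_measurable (restrict_space (F t) G)" if "s \<in> {0..t}" for s x
    using that t by (intro G.borel_measurable_mono[OF eta_adapted]) auto
  ultimately have "(\<lambda>\<omega>. running_Cb_norm 3 (\<eta> \<omega>) t) \<in> borel_measurable (restrict_space (F t) G)"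
    using t by (intro borel_measurable_running_Cb_norm) (auto simp: G.space_F)
  then show ?thesis unfolding passage_process_def total_bound_def
    by (intro borel_measurable_times borel_measurable_power borel_measurable_add
      borel_measurable_const)
qed

lemma stopping_time_lifespan: "stopping_time F lifespan"
  unfolding lifespan_def[abs_def] using T_pos
  by (intro stopping_time_first_passage G_sets passage_process_adapted
    continuous_on_passage_process passage_process_mono) auto

lemma lifespan_range: "0 \<le> lifespan \<omega>" "lifespan \<omega> \<le> T"
  using first_passage_attained(1)[OF _ continuous_on_passage_process, of \<omega>] T_pos
  by (auto simp: lifespan_def)

lemma lifespan_pos: "\<omega> \<in> G \<Longrightarrow> 0 < lifespan \<omega>"
  using first_passage_pos[OF _ continuous_on_passage_process] T_pos
  by (simp add: lifespan_def passage_process_def)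

lemma burgers_path_lifespan:
  assumes \<omega>: "\<omega> \<in> G"
  obtains N where "burgers_path (lifespan \<omega>) (total_bound \<omega> (lifespan \<omega>)) N L \<beta> \<nu>0 f (h \<omega>) (\<eta> \<omega>)"
proof -
  have lifespan: "lifespan \<omega> \<in> {0..T}" using lifespan_range by simp
  then have sub: "t \<in> {0..lifespan \<omega>} \<Longrightarrow> t \<in> {0..T}" for t by auto
  obtain N where eta_pds4: "\<And>t. t \<in> {0..T} \<Longrightarrow> pds_bounded_by 4 N (\<eta> \<omega> t)"
    using Cb_hoelder_pds_bounded_by[OF eta_hoelder[OF \<omega>]] by blast
  note total_bound = total_bound_ge[OF \<omega> lifespan]
  have "burgers_path (lifespan \<omega>) (total_bound \<omega> (lifespan \<omega>)) N L \<beta> \<nu>0 f (h \<omega>) (\<eta> \<omega>)"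
  proof
    show "0 \<le> lifespan \<omega>" using lifespan by simp
    show "1 \<le> total_bound \<omega> (lifespan \<omega>)" "\<nu>0 \<le> total_bound \<omega> (lifespan \<omega>)"
      "real DIM(real^'n) \<le> total_bound \<omega> (lifespan \<omega>)"
      "(real DIM((real^'n) \<times> (real^'n)))\<^sup>2 * L \<le> total_bound \<omega> (lifespan \<omega>)"
      using data_bound total_bound by linarith+
    show "100 * lifespan \<omega> * (total_bound \<omega> (lifespan \<omega>))^3 \<le> 1"
      using at_first_passage_le[OF _ continuous_on_passage_process[OF \<omega>]] T_pos \<omega>
      by (simp add: lifespan_def passage_process_def)
    show "0 < \<beta>" "\<beta> < 2" by (rule beta)+
    show "continuous_on ({0..lifespan \<omega>} \<times> UNIV) (\<lambda>(t, x, z). f t x z)"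
      using sub by (intro continuous_on_subset[OF f_cont]) auto
    show "pds_bounded_by 2 (total_bound \<omega> (lifespan \<omega>)) (h \<omega>)"
      using pds_bounded_by_mono[OF h_pds[OF \<omega>]] data_bound(5) total_bound by simp
    show "Cb_hoelder \<beta> 4 0 (lifespan \<omega>) (\<eta> \<omega>)"
      by (rule Cb_hoelder_subinterval[OF eta_hoelder[OF \<omega>] lifespan_range(2)])
    fix t assume t: "t \<in> {0..lifespan \<omega>}"
    show "pds_bounded_by 2 L (\<lambda>(x, z). f t x z)" "pds_bounded_by 4 N (\<eta> \<omega> t)"
      using f_pds eta_pds4 sub[OF t] by auto
    show "pds_bounded_by 3 (total_bound \<omega> (lifespan \<omega>)) (\<eta> \<omega> t)"
      using pds_bounded_by_mono[OF
          pds_bounded_by_running_Cb_norm[OF eta_hoelder[OF \<omega>] _ lifespan t]] data_bound(1)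
      by (simp add: total_bound_def)
  qed
  then show thesis by (rule that)
qed

lemma dense_sol_lifespan: "\<omega> \<in> G \<Longrightarrow> \<mu> \<in> Q \<Longrightarrow>
    burgers_path_sol \<beta> f (h \<omega>) (\<eta> \<omega>) (lifespan \<omega>) 2 \<mu> (y \<mu> \<omega>)"
  using burgers_path_sol_subinterval[OF dense_sol lifespan_range(2)] .

definition extension_choice :: "'w \<Rightarrow> real \<times> (real \<Rightarrow> real \<Rightarrow> real^'n \<Rightarrow> real^'n)" where
  "extension_choice \<omega> = (SOME (C, Z). viscosity_extension \<nu>0 Q (lifespan \<omega>) (\<lambda>\<mu>. y \<mu> \<omega>) C Z)"

definition extended_sol :: "real \<Rightarrow> 'w \<Rightarrow> real \<Rightarrow> real^'n \<Rightarrow> real^'n" where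
  "extended_sol \<nu> \<omega> t x = (if \<omega> \<in> G then snd (extension_choice \<omega>) \<nu> t x else 0)"

lemma pathwise_extension:
  assumes \<omega>: "\<omega> \<in> G"
  obtains C N where
    "burgers_path (lifespan \<omega>) (total_bound \<omega> (lifespan \<omega>)) N L \<beta> \<nu>0 f (h \<omega>) (\<eta> \<omega>)"
    "viscosity_extension \<nu>0 Q (lifespan \<omega>) (\<lambda>\<mu>. y \<mu> \<omega>) C (\<lambda>\<nu>. extended_sol \<nu> \<omega>)"
proof -
  obtain N where path: "burgers_path (lifespan \<omega>) (total_bound \<omega> (lifespan \<omega>)) N L \<beta> \<nu>0 f
      (h \<omega>) (\<eta> \<omega>)"
    using burgers_path_lifespan[OF \<omega>] by blast
  let ?extension = "\<lambda>(C, Z). viscosity_extension \<nu>0 Q (lifespan \<omega>) (\<lambda>\<mu>. y \<mu> \<omega>) C Z"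
  have "\<exists>p. ?extension p"
    using burgers_path.viscosity_extension_exists[OF path Q dense_sol_lifespan[OF \<omega>]] by simp
  then have "?extension (extension_choice \<omega>)" unfolding extension_choice_def by (rule someI_ex)
  then have "viscosity_extension \<nu>0 Q (lifespan \<omega>) (\<lambda>\<mu>. y \<mu> \<omega>) (fst (extension_choice \<omega>))
      (\<lambda>\<nu>. extended_sol \<nu> \<omega>)"
    using \<omega> by (simp add: case_prod_beta extended_sol_def[abs_def])
  with path show thesis by (rule that)
qed

lemma path_sol_unique:
  assumes \<omega>: "\<omega> \<in> G" and \<tau>: "0 \<le> \<tau>" "\<tau> \<le> lifespan \<omega>"
    and z: "burgers_path_sol \<beta> f (h \<omega>) (\<eta> \<omega>) \<tau> l \<nu> z" "1 \<le> l" "\<nu> \<noteq> 0 \<Longrightarrow> 2 \<le> l"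
    and \<nu>: "\<nu> \<in> {0..\<nu>0}" and t: "t \<in> {0..\<tau>}"
  shows "z t x = extended_sol \<nu> \<omega> t x"
proof (rule pathwise_extension[OF \<omega>])
  fix C N
  assume path: "burgers_path (lifespan \<omega>) (total_bound \<omega> (lifespan \<omega>)) N L \<beta> \<nu>0 f (h \<omega>) (\<eta> \<omega>)"
    and ext: "viscosity_extension \<nu>0 Q (lifespan \<omega>) (\<lambda>\<mu>. y \<mu> \<omega>) C (\<lambda>\<nu>. extended_sol \<nu> \<omega>)"
  show ?thesis
    by (rule burgers_path.viscosity_extension_unique[OF path Q
          dense_sol_lifespan[OF \<omega>] ext \<tau> z \<nu> t])
qed

lemma extended_sol_tendsto:
  assumes \<omega>: "\<omega> \<in> G" and t: "t \<in> {0..lifespan \<omega>}"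
    and q: "\<And>k. q k \<in> Q" "q \<longlonglongrightarrow> \<nu>" and \<nu>: "\<nu> \<in> {0..\<nu>0}"
  shows "(\<lambda>k. y (q k) \<omega> t x) \<longlonglongrightarrow> extended_sol \<nu> \<omega> t x"
proof -
  obtain C where "viscosity_extension \<nu>0 Q (lifespan \<omega>) (\<lambda>\<mu>. y \<mu> \<omega>) C (\<lambda>\<nu>. extended_sol \<nu> \<omega>)"
    using pathwise_extension[OF \<omega>] by blast
  from viscosity_extension_uniform_limit[OF this _ \<nu> q] Q(1)
  have "uniform_limit ({0..lifespan \<omega>} \<times> UNIV) (\<lambda>k (t, x). y (q k) \<omega> t x)
      (\<lambda>(t, x). extended_sol \<nu> \<omega> t x) sequentially" by fastforce
  from tendsto_uniform_limitI[OF this, of "(t, x)"] t show ?thesis by simp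
qed

lemma inviscid_adapted:
  assumes t: "t \<in> {0..T}"
  shows "(\<lambda>\<omega>. if t \<le> lifespan \<omega> then extended_sol 0 \<omega> t x else 0) \<in> borel_measurable (F t)"
proof -
  have zero: "0 \<in> {0..\<nu>0}" using nu0_pos by simp
  then obtain q where q: "\<And>k. q k \<in> Q" "q \<longlonglongrightarrow> (0::real)"
    using subsetD[OF Q(2)] unfolding closure_sequential by blast
  have "(\<lambda>\<omega>. if t \<le> lifespan \<omega> then extended_sol 0 \<omega> t x else 0)
      = (\<lambda>\<omega>. if \<omega> \<in> G \<and> t \<le> lifespan \<omega> then lim (\<lambda>k. y (q k) \<omega> t x) else 0)"
    using limI[OF extended_sol_tendsto[OF _ _ q zero]] t by (auto simp: extended_sol_def)
  moreover have "Measurable.pred (F t) (\<lambda>\<omega>. \<omega> \<in> G \<and> t \<le> lifespan \<omega>)"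
    using G_sets stopping_time_less_const[OF stopping_time_lifespan, of t]
    by (intro pred_intros_logic) (auto simp: not_less[symmetric] intro: pred_intros_logic)
  then have "(\<lambda>\<omega>. if \<omega> \<in> G \<and> t \<le> lifespan \<omega> then lim (\<lambda>k. y (q k) \<omega> t x) else 0)
      \<in> borel_measurable (F t)"
    using t
    by (intro measurable_If borel_measurable_lim_metric y_adapted q borel_measurable_const predE)
  ultimately show ?thesis by simp
qed

lemma inviscid_solution: "burgers_sol M F T \<beta> 1 0 f h \<eta> lifespan (extended_sol 0)"
  unfolding burgers_sol_iff
proof (intro conjI ballI allI inviscid_adapted)
  show "AE \<omega> in M. burgers_path_sol \<beta> f (h \<omega>) (\<eta> \<omega>) (lifespan \<omega>) 1 0 (extended_sol 0 \<omega>)"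
    using AE_G
  proof eventually_elim
    case (elim \<omega>)
    obtain C N where path: "burgers_path (lifespan \<omega>)
        (total_bound \<omega> (lifespan \<omega>)) N L \<beta> \<nu>0 f (h \<omega>) (\<eta> \<omega>)"
      and ext: "viscosity_extension \<nu>0 Q (lifespan \<omega>) (\<lambda>\<mu>. y \<mu> \<omega>) C (\<lambda>\<nu>. extended_sol \<nu> \<omega>)"
      using pathwise_extension[OF elim] by blast
    show ?case
      using burgers_path.viscosity_extension_inviscid[OF path Q dense_sol_lifespan[OF elim] ext]
        nu0_pos
      by simp
  qed
qed

lemma burgers_sol_eq_extended_sol:
  assumes sol: "burgers_sol M F T \<beta> l \<nu> f h \<eta> S' z" and "\<And>\<omega>. 0 \<le> S' \<omega>"
    and l: "1 \<le> l" "\<nu> \<noteq> 0 \<Longrightarrow> 2 \<le> l" and \<nu>: "\<nu> \<in> {0..\<nu>0}"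
  shows "AE \<omega> in M. \<forall>t\<in>{0..min (lifespan \<omega>) (S' \<omega>)}. \<forall>x. z \<omega> t x = extended_sol \<nu> \<omega> t x"
proof -
  have "AE \<omega> in M. burgers_path_sol \<beta> f (h \<omega>) (\<eta> \<omega>) (S' \<omega>) l \<nu> (z \<omega>)"
    using sol unfolding burgers_sol_iff by blast
  with AE_G show ?thesis
  proof eventually_elim
    case (elim \<omega>)
    have "burgers_path_sol \<beta> f (h \<omega>) (\<eta> \<omega>) (min (lifespan \<omega>) (S' \<omega>)) l \<nu> (z \<omega>)"
      by (rule burgers_path_sol_subinterval[OF elim(2)]) simp
    from path_sol_unique[OF elim(1) _ _ this l \<nu>] show ?case using lifespan_range assms(2) by simp
  qed
qed

lemma extended_sol_eq_viscous_sol: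
  assumes "burgers_sol M F T \<beta> 2 \<nu> f h \<eta> (\<lambda>_. T) z" "\<nu> \<in> {0<..\<nu>0}"
  shows "AE \<omega> in M. \<forall>t\<in>{0..lifespan \<omega>}. \<forall>x. extended_sol \<nu> \<omega> t x = z \<omega> t x"
proof -
  have "AE \<omega> in M. \<forall>t\<in>{0..min (lifespan \<omega>) T}. \<forall>x. z \<omega> t x = extended_sol \<nu> \<omega> t x"
    by (rule burgers_sol_eq_extended_sol[OF assms(1)]) (use assms(2) T_pos in auto)
  then show ?thesis by eventually_elim (simp add: lifespan_range min_absorb1)
qed

lemma extended_sol_continuous_bounded:
  assumes "\<nu> \<in> {0..\<nu>0}"
  shows "continuous_on ({0..lifespan \<omega>} \<times> UNIV) (\<lambda>(t, x). extended_sol \<nu> \<omega> t x) \<and>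
    bounded ((\<lambda>(t, x). extended_sol \<nu> \<omega> t x) ` ({0..lifespan \<omega>} \<times> UNIV))"
proof (cases "\<omega> \<in> G")
  case True
  obtain C N where path: "burgers_path (lifespan \<omega>)
      (total_bound \<omega> (lifespan \<omega>)) N L \<beta> \<nu>0 f (h \<omega>) (\<eta> \<omega>)"
    and ext: "viscosity_extension \<nu>0 Q (lifespan \<omega>) (\<lambda>\<mu>. y \<mu> \<omega>) C (\<lambda>\<nu>. extended_sol \<nu> \<omega>)"
    using pathwise_extension[OF True] by blast
  show ?thesis
    using burgers_path.viscosity_extension_continuous_bounded[OF path
      Q dense_sol_lifespan[OF True] ext assms]
    by simp
next
  case False
  then have "(\<lambda>(t, x). extended_sol \<nu> \<omega> t x) = (\<lambda>_. 0)" by (auto simp: extended_sol_def)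
  then show ?thesis by (simp add: image_constant_conv)
qed

lemma extended_sol_continuous_in_viscosity:
  assumes "\<nu> \<in> {0..\<nu>0}" "0 < \<epsilon>"
  shows "\<exists>\<delta>>0. \<forall>\<mu>\<in>{0..\<nu>0}. \<bar>\<mu> - \<nu>\<bar> < \<delta> \<longrightarrow>
      (\<forall>t\<in>{0..lifespan \<omega>}. \<forall>x. dist (extended_sol \<mu> \<omega> t x) (extended_sol \<nu> \<omega> t x) < \<epsilon>)"
proof (cases "\<omega> \<in> G")
  case True
  then obtain C where "viscosity_extension \<nu>0 Q (lifespan \<omega>) (\<lambda>\<mu>. y \<mu> \<omega>) C (\<lambda>\<nu>. extended_sol \<nu> \<omega>)" 
    using pathwise_extension by blast
  from viscosity_extension_uniformly_continuous[OF this assms] show ?thesis .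
next
  case False
  then show ?thesis using \<open>0 < \<epsilon>\<close> by (intro exI[of _ 1]) (simp add: extended_sol_def)
qed

lemma extended_sol_inviscid_limit:
  assumes "0 < \<epsilon>"
  shows "\<exists>\<delta>>0. \<forall>\<nu>\<in>{0<..\<nu>0}. \<nu> < \<delta> \<longrightarrow>
      (\<forall>t\<in>{0..lifespan \<omega>}. \<forall>x. dist (extended_sol \<nu> \<omega> t x) (extended_sol 0 \<omega> t x) < \<epsilon>)"
proof -
  have "0 \<in> {0..\<nu>0}" using nu0_pos by simp
  from extended_sol_continuous_in_viscosity[OF this assms, of \<omega>] show ?thesis by fastforce
qed

end

lemma rational_viscosities_dense:
  fixes \<nu>0 :: real
  assumes "0 < \<nu>0"
  shows "{0..\<nu>0} \<subseteq> closure ({0<..\<nu>0} \<inter> \<rat>)"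
proof -
  have "{0<..<\<nu>0} \<subseteq> closure ({0<..<\<nu>0} \<inter> \<rat>)"
    using open_Int_closure_subset[of "{0<..<\<nu>0}" \<rat>] by (simp add: Rats_closure_real)
  also have "\<dots> \<subseteq> closure ({0<..\<nu>0} \<inter> \<rat>)" by (intro closure_mono) auto
  finally have "closure {0<..<\<nu>0} \<subseteq> closure ({0<..\<nu>0} \<inter> \<rat>)" by (simp add: closure_minimal)
  then show ?thesis using assms by simp
qed

lemma burgers_sol_adapted:
  assumes "burgers_sol M F T \<beta> l \<nu> f h \<eta> (\<lambda>_. T) y" "t \<in> {0..T}"
  shows "(\<lambda>\<omega>. y \<omega> t x) \<in> borel_measurable (F t)"
proof -
  have "(\<lambda>\<omega>. if t \<le> T then y \<omega> t x else 0) \<in> borel_measurable (F t)"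
    using assms unfolding burgers_sol_iff by blast
  then show ?thesis using assms(2) by simp
qed

lemma C2beta_b_pds_bounded_by:
  assumes "C2beta_b \<beta> u" "\<And>\<alpha> x. set \<alpha> \<subseteq> Basis \<Longrightarrow> length \<alpha> \<le> 2 \<Longrightarrow> norm (pds \<alpha> u x) \<le> K"
  shows "pds_bounded_by 2 K u"
  using assms by (simp add: C2beta_b_def pds_bounded_by_def)

lemma stochastic_burgers_FB:
  fixes B :: "real \<Rightarrow> 'w \<Rightarrow> real^'d" and y :: "real \<Rightarrow> 'w \<Rightarrow> real \<Rightarrow> real^'n \<Rightarrow> real^'n"
  assumes pos: "0 < T" "0 < \<nu>0" and beta: "0 < \<beta>" "\<beta> < 2" and F0: "F0 \<subseteq> sets M"
    and f: "Cb_hoelder \<beta> 2 0 T (\<lambda>t (x, z). f t x z)"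
    and h_meas: "\<And>x. (\<lambda>\<omega>. h \<omega> x) \<in> borel_measurable (sigma (space M) F0)"
    and h_pds: "AE \<omega> in M. pds_bounded_by 2 K (h \<omega>)"
    and eta_hoelder: "AE \<omega> in M. Cb_hoelder \<beta> 4 0 T (\<eta> \<omega>)"
    and sol: "\<And>\<nu>. \<nu> \<in> {0<..\<nu>0} \<Longrightarrow> burgers_sol M (FB M B F0) T \<beta> 2 \<nu> f h \<eta> (\<lambda>_. T) (y \<nu>)"
  obtains L G where "stochastic_burgers M (FB M B F0) T \<beta> \<nu>0 K L ({0<..\<nu>0} \<inter> \<rat>) G f h \<eta> y"
proof -
  let ?Q = "{0<..\<nu>0} \<inter> \<rat>"
  let ?regular = "\<lambda>\<omega>. pds_bounded_by 2 K (h \<omega>) \<and> Cb_hoelder \<beta> 4 0 T (\<eta> \<omega>) \<and>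
    (\<forall>\<mu>\<in>?Q. burgers_path_sol \<beta> f (h \<omega>) (\<eta> \<omega>) T 2 \<mu> (y \<mu> \<omega>))"
  have "AE \<omega> in M. \<forall>\<mu>\<in>?Q. burgers_path_sol \<beta> f (h \<omega>) (\<eta> \<omega>) T 2 \<mu> (y \<mu> \<omega>)"
    using sol by (intro AE_ball_countable') (auto simp: burgers_sol_iff countable_rat)
  with h_pds eta_hoelder have "AE \<omega> in M. ?regular \<omega>" by eventually_elim blast
  then obtain G where G: "\<And>t. G \<in> sets (FB M B F0 t)" "AE \<omega> in M. \<omega> \<in> G"
    and regular: "\<And>\<omega>. \<omega> \<in> G \<Longrightarrow> ?regular \<omega>"
    by (rule AE_conull_FB[OF F0]) blast
  obtain L where f_pds: "\<And>t. t \<in> {0..T} \<Longrightarrow> pds_bounded_by 2 L (\<lambda>(x, z). f t x z)"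
    using Cb_hoelder_pds_bounded_by[OF f] by blast
  have "stochastic_burgers M (FB M B F0) T \<beta> \<nu>0 K L ?Q G f h \<eta> y"
  proof (intro stochastic_burgers.intro stochastic_burgers_axioms.intro filtration_FB F0)
    show "continuous_on ({0..T} \<times> UNIV) (\<lambda>(t, x, z). f t x z)"
      using Cb_hoelder_continuous_on[OF f, of "[]"] by simp
    show "(\<lambda>\<omega>. y \<mu> \<omega> t x) \<in> borel_measurable (FB M B F0 t)" if "\<mu> \<in> ?Q" "t \<in> {0..T}" for \<mu> t x
      using that by (intro burgers_sol_adapted[OF sol]) auto
  qed (use pos beta rational_viscosities_dense[OF pos(2)] G regular f_pds
      borel_measurable_FB[OF F0 h_meas] in auto)
  then show thesis by (rule that)
qed

theorem mainTheorem3: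
  fixes M :: "'w measure"
    and T \<beta> \<nu>0 :: real
    and B :: "real \<Rightarrow> 'w \<Rightarrow> real^'d"
    and F0 :: "'w set set"
    and f :: "real \<Rightarrow> real^'n \<Rightarrow> real^'n \<Rightarrow> real^'n"
    and g :: "'w \<Rightarrow> real \<Rightarrow> real^'n \<Rightarrow> real^'n^'d"
    and h :: "'w \<Rightarrow> real^'n \<Rightarrow> real^'n"
    and \<eta> :: "'w \<Rightarrow> real \<Rightarrow> real^'n \<Rightarrow> real^'n"
    and \<Omega>0 :: "'w set"
    and y :: "real \<Rightarrow> 'w \<Rightarrow> real \<Rightarrow> real^'n \<Rightarrow> real^'n"
  assumes T_pos: "T > 0"
    and beta: "0 < \<beta>" "\<beta> < 1"
    and BM: "std_BM M B"
    and F0: "sigma_algebra (space M) F0" "F0 \<subseteq> sets M"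
    and F0_indep: "prob_space.indep_set M F0
          (sigma_sets (space M) {B s -` A \<inter> space M | s A. 0 \<le> s \<and> A \<in> sets borel})"
    \<comment> \<open>(A1)\<close>
    and A1_reg: "Cb_hoelder \<beta> 2 0 T (\<lambda>t (x, z). f t x z)"
    and A1_lin: "\<exists>L. \<forall>t\<in>{0..T}. \<forall>x z z'. norm (f t x z) \<le> L * (1 + norm z) \<and>
                    norm (f t x z - f t x z') \<le> L * norm (z - z')"
    and A1_loc: "\<forall>D>0. \<exists>C. \<forall>\<alpha>. set \<alpha> \<subseteq> Basis \<and> 1 \<le> length \<alpha> \<and> length \<alpha> \<le> 2 \<longrightarrow>
                   (\<forall>t\<in>{0..T}. \<forall>x z. (\<forall>i. \<bar>z $ i\<bar> \<le> D) \<longrightarrow>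
                      norm (pds \<alpha> (\<lambda>(x', z'). f t x' z') (x, z)) \<le> C)"
    and A1_supp: "compact (closure {x. f 0 x 0 \<noteq> 0})"
    \<comment> \<open>(A2)\<close>
    and A2_adapt: "\<forall>s\<in>{0..T}. \<forall>x. (\<lambda>\<omega>. g \<omega> s x) \<in> borel_measurable (FB M B F0 s)"
    and A2_Hk: "\<forall>\<omega>\<in>space M. \<forall>s\<in>{0..T}. in_Hk (CARD('n) div 2 + 5) (g \<omega> s)"
    and A2_int: "\<exists>p. p > 4 / (1 - \<beta>) \<and>
          (\<integral>\<^sup>+\<omega>. (\<integral>\<^sup>+s\<in>{0..T}. ennreal (Hk_norm (CARD('n) div 2 + 5) (g \<omega> s) powr p) \<partial>lborel) \<partial>M) < \<infinity>"
    \<comment> \<open>(A3)\<close>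
    and A3_meas: "\<forall>x. (\<lambda>\<omega>. h \<omega> x) \<in> borel_measurable (sigma (space M) F0)"
    and A3_reg: "\<forall>\<omega>. C2beta_b \<beta> (h \<omega>)"
    \<comment> \<open>\<Omega>_0 and the regular version \<eta> of the stochastic integral\<close>
    and Omega0: "\<Omega>0 \<in> sets M" "prob_space.prob M \<Omega>0 = 1"
    and eta_version: "is_stoch_int_version M (FB M B F0) B T g \<eta>"
    and eta_reg: "\<forall>\<omega>\<in>\<Omega>0. Cb_hoelder \<beta> 4 0 T (\<eta> \<omega>)"
    \<comment> \<open>uniform bound on h\<close>
    and h_bdd: "\<exists>K. \<forall>\<omega>\<in>\<Omega>0. \<forall>\<alpha>. set \<alpha> \<subseteq> Basis \<and> length \<alpha> \<le> 2 \<longrightarrow>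
                   (\<forall>x. norm (pds \<alpha> (h \<omega>) x) \<le> K)"
    \<comment> \<open>the viscous solutions\<close>
    and nu0: "\<nu>0 > 0"
    and y_sol: "\<forall>\<nu>\<in>{0<..\<nu>0}. burgers_sol M (FB M B F0) T \<beta> 2 \<nu> f h \<eta> (\<lambda>_. T) (y \<nu>)"
  shows "\<exists>S y0.
     stopping_time (FB M B F0) S \<and> (\<forall>\<omega>. 0 \<le> S \<omega> \<and> S \<omega> \<le> T) \<and> (AE \<omega> in M. S \<omega> > 0) \<and>
     burgers_sol M (FB M B F0) T \<beta> 1 0 f h \<eta> S y0 \<and>
     (\<forall>S' y0'. stopping_time (FB M B F0) S' \<and> (\<forall>\<omega>. 0 \<le> S' \<omega> \<and> S' \<omega> \<le> T) \<and>
         (AE \<omega> in M. S' \<omega> > 0) \<and> burgers_sol M (FB M B F0) T \<beta> 1 0 f h \<eta> S' y0' \<longrightarrow>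
         (AE \<omega> in M. \<forall>t\<in>{0..min (S \<omega>) (S' \<omega>)}. \<forall>x. y0' \<omega> t x = y0 \<omega> t x)) \<and>
     (\<exists>Y :: real \<Rightarrow> 'w \<Rightarrow> real \<Rightarrow> real^'n \<Rightarrow> real^'n.
         (\<forall>\<nu>\<in>{0<..\<nu>0}. AE \<omega> in M. \<forall>t\<in>{0..S \<omega>}. \<forall>x. Y \<nu> \<omega> t x = y \<nu> \<omega> t x) \<and>
         (AE \<omega> in M. \<forall>t\<in>{0..S \<omega>}. \<forall>x. Y 0 \<omega> t x = y0 \<omega> t x) \<and>
         (\<forall>\<omega>\<in>space M. \<forall>\<nu>\<in>{0..\<nu>0}.
             continuous_on ({0..S \<omega>} \<times> UNIV) (\<lambda>(t, x). Y \<nu> \<omega> t x) \<and>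
             bounded ((\<lambda>(t, x). Y \<nu> \<omega> t x) ` ({0..S \<omega>} \<times> UNIV))) \<and>
         (\<forall>\<omega>\<in>space M. \<forall>\<nu>\<in>{0..\<nu>0}. \<forall>\<epsilon>>0. \<exists>\<delta>>0. \<forall>\<nu>'\<in>{0..\<nu>0}. \<bar>\<nu>' - \<nu>\<bar> < \<delta> \<longrightarrow>
             (\<forall>t\<in>{0..S \<omega>}. \<forall>x. dist (Y \<nu>' \<omega> t x) (Y \<nu> \<omega> t x) < \<epsilon>)) \<and>
         (AE \<omega> in M. \<forall>\<epsilon>>0. \<exists>\<delta>>0. \<forall>\<nu>\<in>{0<..\<nu>0}. \<nu> < \<delta> \<longrightarrow>
             (\<forall>t\<in>{0..S \<omega>}. \<forall>x. dist (Y \<nu> \<omega> t x) (y0 \<omega> t x) < \<epsilon>)))"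
proof -
  interpret prob_space M using BM by (simp add: std_BM_def)
  obtain K where "\<And>\<omega>. \<omega> \<in> \<Omega>0 \<Longrightarrow> pds_bounded_by 2 K (h \<omega>)"
    using h_bdd C2beta_b_pds_bounded_by[OF A3_reg[rule_format]] by metis
  then have h_pds: "AE \<omega> in M. pds_bounded_by 2 K (h \<omega>)"
    using AE_prob_1[OF Omega0(2)] by (auto elim: eventually_mono)
  have eta_hoelder: "AE \<omega> in M. Cb_hoelder \<beta> 4 0 T (\<eta> \<omega>)"
    using AE_prob_1[OF Omega0(2)] eta_reg by (auto elim: eventually_mono)
  obtain L G where "stochastic_burgers M (FB M B F0) T \<beta> \<nu>0 K L ({0<..\<nu>0} \<inter> \<rat>) G f h \<eta> y"
    using stochastic_burgers_FB[OF T_pos nu0 beta(1) _ F0(2) A1_reg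
      A3_meas[rule_format] h_pds eta_hoelder
        y_sol[rule_format]] beta(2) by auto
  then interpret stochastic_burgers M "FB M B F0" T \<beta> \<nu>0 K L "{0<..\<nu>0} \<inter> \<rat>" G f h \<eta> y .
  show ?thesis
  proof (intro exI[of _ lifespan] exI[of _ "extended_sol 0"]
    exI[of _ extended_sol] conjI allI ballI impI)
    show "AE \<omega> in M. \<forall>t\<in>{0..min (lifespan \<omega>) (S' \<omega>)}. \<forall>x. y0' \<omega> t x = extended_sol 0 \<omega> t x"
      if "stopping_time (FB M B F0) S' \<and> (\<forall>\<omega>. 0 \<le> S' \<omega> \<and> S' \<omega> \<le> T) \<and>
         (AE \<omega> in M. S' \<omega> > 0) \<and> burgers_sol M (FB M B F0) T \<beta> 1 0 f h \<eta> S' y0'" for S' y0'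
      using that nu0 by (intro burgers_sol_eq_extended_sol[of 1]) auto
    show "AE \<omega> in M. 0 < lifespan \<omega>" using AE_G by eventually_elim (rule lifespan_pos)
  qed (use extended_sol_continuous_bounded y_sol extended_sol_eq_viscous_sol in
      \<open>auto intro: stopping_time_lifespan lifespan_range inviscid_solution
        extended_sol_continuous_in_viscosity extended_sol_inviscid_limit simp del: One_nat_def\<close>)
qed

end
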